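(* Let $\mathcal T$ be a Gaussian quantum Markov semigroup on $B(\Gamma(\mathbb C^d))$ admitting a normal invariant state, and let $\widetilde{\mathcal T}\in[\mathcal T]$ be a representative in normal form. Let $\mathfrak R_+$ be the positive recurrent subspace and $\mathfrak T$ the transient subspace of $\widetilde{\mathcal T}$. Then $\mathfrak R_+^\perp=\mathfrak T$.
   Context: $\Gamma(\mathbb C^d)$ is the bosonic Fock space with exponential vectors $e_z=\sum_n z^{\otimes n}/\sqrt{n!}$ (inner products linear in the second argument). Weyl operators are the unitaries with $W(z)e_w=e^{-\|z\|^2/2-\langle z,w\rangle}e_{z+w}$, so $W(z+w)=e^{i\sigma(z,w)}W(z)W(w)$, $\sigma(z,w)=\Im\langle z,w\rangle$. $\mathbb C^d$ is identified with $\mathbb R^{2d}$ by $x+iy\mapsto(x,y)^T$; $\langle z,w\rangle_{\mathbb R}=\Re\langle z,w\rangle$; a real linear $A$ corresponds to a real matrix $\mathbf A$, with spectrum $\mathrm{Sp}(\mathbf A)$ computed on the complexification. $\mathbf J=\begin{pmatrix}O&I\\-I&O\end{pmatrix}$. A quantum Markov semigroup is a w*-continuous semigroup of normal completely positive unital maps on $B(\Gamma(\mathbb C^d))$; $\mathcal T_{*t}$ is the predual map on trace class operators. It is Gaussian with parameters $(Z,C,\zeta)$ ($Z,C$ real linear on $\mathbb C^d$, $C$ symmetric, $\mathbf C+i(\mathbf Z^T\mathbf J+\mathbf J\mathbf Z)\ge0$, $\zeta\in\mathbb C^d$) if $\mathcal T_t(W(z))=\exp(-\frac12\int_0^t\langle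 e^{sZ}z,Ce^{sZ}z\rangle_{\mathbb R}ds+i\int_0^t\langle\zeta,e^{sZ}z\rangle_{\mathbb R}ds)W(e^{tZ}z)$. A normal invariant state is a density operator $\rho$ with $\mathcal T_{*t}(\rho)=\rho$ for all $t\ge0$. Normal form. For $M$ real linear preserving $\sigma$ (symplectic), $U(M)$ is a unitary with $U(M)W(z)U(M)^*=W(Mz)$, $\mathcal T^M_t(x)=U(M)\mathcal T_t(U(M)^*xU(M))U(M)^*$, and $[\mathcal T]=\{\mathcal T^M\}$. If $\mathcal T$ has a normal invariant state there are $0\le d_0\le d$, $\phi_1,\dots,\phi_{d_0}\in\mathbb R$ and $\widetilde{\mathcal T}\in[\mathcal T]$ "in normal form", meaning that, with respect to $\mathbb C^d=\widetilde V_0\oplus\widetilde V_-$, where $\widetilde V_0$ (resp. $\widetilde V_-$) is the span of the first $d_0$ (resp. last $d-d_0$) canonical basis vectors, its parameters are $\widetilde Z=\widetilde Z_0\oplus\widetilde Z_-$, $\widetilde C=0\oplus\widetilde C_-$, $\widetilde\zeta=(\widetilde\zeta_0,\widetilde\zeta_-)$, with $\widetilde{\mathbf Z}_0=\begin{pmatrix}O&-\Phi\\\Phi&O\end{pmatrix}$, $\Phi=\mathrm{diag}(\phi_j)$, $\mathrm{Sp}(\widetilde{\mathbf Z}_-)\subseteq\{\Re z<0\}$, and $\widetilde\zeta_0\in\ker(\widetilde{\mathbf Z}_0)^\perp$. Recurrence and transience. Closed subspaces are identified with orthogonal projections, and suprema are taken in the lattice of projections. $\mathfrak R_+:=\sup\{\mathrm{supp}(\rho):\rho\text{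 a normal invariant state of }\widetilde{\mathcal T}\}$ and $\mathfrak T:=\sup\{p\text{ projection}:\exists\,C>0\text{ such that for every normal state }\rho,\ \int_0^{+\infty}\mathrm{tr}(\widetilde{\mathcal T}_{*s}(\rho)p)\,ds\le C\}$. *)

theory Defs
  imports "HOL-Analysis.Analysis" "HOL-Library.Multiset"
begin

section \<open>Complex Hilbert spaces and their operators\<close>

text \<open>The complex inner product is linear in the second argument.\<close>

class complex_hilbert = real_inner + complete_space +
  fixes scaleC :: "complex \<Rightarrow> 'a \<Rightarrow> 'a"  (infixr "*\<^sub>C" 75)
    and cinner :: "'a \<Rightarrow> 'a \<Rightarrow> complex"
  assumes scaleC_add_right: "c *\<^sub>C (x + y) = c *\<^sub>C x + c *\<^sub>C y"
    and scaleC_add_left: "(b + c) *\<^sub>C x = b *\<^sub>C x + c *\<^sub>C x"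
    and scaleC_scaleC: "b *\<^sub>C c *\<^sub>C x = (b * c) *\<^sub>C x"
    and scaleC_of_real: "complex_of_real r *\<^sub>C x = r *\<^sub>R x"
    and cinner_commute: "cinner x y = cnj (cinner y x)"
    and cinner_add_right: "cinner x (y + z) = cinner x y + cinner x z"
    and cinner_scaleC_right: "cinner x (c *\<^sub>C y) = c * cinner x y"
    and inner_eq_Re_cinner: "x \<bullet> y = Re (cinner x y)"

definition bounded_op :: "('a::complex_hilbert \<Rightarrow> 'a) \<Rightarrow> bool" where
  "bounded_op A \<longleftrightarrow> bounded_linear A \<and> (\<forall>c x. A (c *\<^sub>C x) = c *\<^sub>C A x)"

definition adj :: "('a::complex_hilbert \<Rightarrow> 'a) \<Rightarrow> ('a \<Rightarrow> 'a)" where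
  "adj A = (THE B. bounded_op B \<and> (\<forall>x y. cinner (A x) y = cinner x (B y)))"

definition unitary_op :: "('a::complex_hilbert \<Rightarrow> 'a) \<Rightarrow> bool" where
  "unitary_op U \<longleftrightarrow> bounded_op U \<and> adj U \<circ> U = id \<and> U \<circ> adj U = id"

definition positive_op :: "('a::complex_hilbert \<Rightarrow> 'a) \<Rightarrow> bool" where
  "positive_op A \<longleftrightarrow> bounded_op A \<and> (\<forall>x. cinner x (A x) \<in> \<real>\<^sub>\<ge>\<^sub>0)"

definition projection :: "('a::complex_hilbert \<Rightarrow> 'a) \<Rightarrow> bool" where
  "projection p \<longleftrightarrow> bounded_op p \<and> p \<circ> p = p \<and> adj p = p"

definition is_onb :: "'a::complex_hilbert set \<Rightarrow> bool" where
  "is_onb E \<longleftrightarrow> (\<forall>e\<in>E. \<forall>f\<in>E. cinner e f = (if e = f then 1 else 0)) \<and>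
     (\<forall>x. (\<forall>e\<in>E. cinner e x = 0) \<longrightarrow> x = 0)"

text \<open>In the next definition \<open>P\<close> is the modulus \<open>(A\<^sup>* A)\<^sup>1\<^sup>/\<^sup>2\<close> of \<open>A\<close>. Neither
  the condition nor the value of the trace of a trace class operator depends on the basis.\<close>

definition trace_class :: "('a::complex_hilbert \<Rightarrow> 'a) \<Rightarrow> bool" where
  "trace_class A \<longleftrightarrow> bounded_op A \<and>
     (\<exists>P E. positive_op P \<and> P \<circ> P = adj A \<circ> A \<and> is_onb E \<and>
        (\<lambda>e. Re (cinner e (P e))) summable_on E)"

definition trace_op :: "('a::complex_hilbert \<Rightarrow> 'a) \<Rightarrow> complex" where
  "trace_op A = (\<Sum>\<^sub>\<infinity>e\<in>(SOME E. is_onb E). cinner e (A e))"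

text \<open>Density operators, i.e. normal states.\<close>

definition density_op :: "('a::complex_hilbert \<Rightarrow> 'a) \<Rightarrow> bool" where
  "density_op \<rho> \<longleftrightarrow> positive_op \<rho> \<and> trace_class \<rho> \<and> trace_op \<rho> = 1"

text \<open>Closed complex subspaces stand for the orthogonal projections onto them;
  \<open>csup\<close> is then the supremum in the lattice of projections.\<close>

definition closed_csubspace :: "'a::complex_hilbert set \<Rightarrow> bool" where
  "closed_csubspace S \<longleftrightarrow> closed S \<and> 0 \<in> S \<and> (\<forall>x\<in>S. \<forall>y\<in>S. x + y \<in> S) \<and>
     (\<forall>c. \<forall>x\<in>S. c *\<^sub>C x \<in> S)"

definition csup :: "'a::complex_hilbert set set \<Rightarrow> 'a set" where
  "csup F = \<Inter>{S. closed_csubspace S \<and> (\<forall>V\<in>F. V \<subseteq> S)}"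

definition orth :: "'a::complex_hilbert set \<Rightarrow> 'a set" where
  "orth S = {x. \<forall>y\<in>S. cinner y x = 0}"

definition supp :: "('a::complex_hilbert \<Rightarrow> 'a) \<Rightarrow> 'a set" where
  "supp \<rho> = closure (range \<rho>)"


section \<open>Quantum Markov semigroups\<close>

text \<open>Maps on the algebra of bounded operators are total functions on \<open>'a \<Rightarrow> 'a\<close>, of which
  only the values on bounded operators matter.\<close>

definition weak_star :: "('a::complex_hilbert \<Rightarrow> 'a) topology" where
  "weak_star = topology_generated_by
     {{A. bounded_op A \<and> trace_op (\<rho> \<circ> A) \<in> U} | \<rho> U. trace_class \<rho> \<and> open U}"

definition op_linear :: "(('a::complex_hilbert \<Rightarrow> 'a) \<Rightarrow> ('a \<Rightarrow> 'a)) \<Rightarrow> bool" where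
  "op_linear \<Phi> \<longleftrightarrow> (\<forall>A. bounded_op A \<longrightarrow> bounded_op (\<Phi> A)) \<and>
     (\<forall>A B a b. bounded_op A \<longrightarrow> bounded_op B \<longrightarrow>
        \<Phi> (\<lambda>x. a *\<^sub>C A x + b *\<^sub>C B x) = (\<lambda>x. a *\<^sub>C \<Phi> A x + b *\<^sub>C \<Phi> B x))"

definition positive_op_matrix :: "nat \<Rightarrow> (nat \<Rightarrow> nat \<Rightarrow> 'a::complex_hilbert \<Rightarrow> 'a) \<Rightarrow> bool" where
  "positive_op_matrix n a \<longleftrightarrow> (\<forall>i<n. \<forall>j<n. bounded_op (a i j)) \<and>
     (\<forall>u. (\<Sum>i<n. \<Sum>j<n. cinner (u i) (a i j (u j))) \<in> \<real>\<^sub>\<ge>\<^sub>0)"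

definition completely_positive :: "(('a::complex_hilbert \<Rightarrow> 'a) \<Rightarrow> ('a \<Rightarrow> 'a)) \<Rightarrow> bool" where
  "completely_positive \<Phi> \<longleftrightarrow> op_linear \<Phi> \<and>
     (\<forall>n a. positive_op_matrix n a \<longrightarrow> positive_op_matrix n (\<lambda>i j. \<Phi> (a i j)))"

definition normal_map :: "(('a::complex_hilbert \<Rightarrow> 'a) \<Rightarrow> ('a \<Rightarrow> 'a)) \<Rightarrow> bool" where
  "normal_map \<Phi> \<longleftrightarrow> continuous_map weak_star weak_star \<Phi>"

definition qms :: "(real \<Rightarrow> ('a::complex_hilbert \<Rightarrow> 'a) \<Rightarrow> ('a \<Rightarrow> 'a)) \<Rightarrow> bool" where
  "qms T \<longleftrightarrow>
     (\<forall>t\<ge>0. completely_positive (T t) \<and> normal_map (T t) \<and> T t id = id) \<and>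
     (\<forall>A. bounded_op A \<longrightarrow> T 0 A = A) \<and>
     (\<forall>s\<ge>0. \<forall>t\<ge>0. \<forall>A. bounded_op A \<longrightarrow> T (s + t) A = T s (T t A)) \<and>
     (\<forall>A. bounded_op A \<longrightarrow> continuous_map (top_of_set {0..}) weak_star (\<lambda>t. T t A))"

definition predual :: "(('a::complex_hilbert \<Rightarrow> 'a) \<Rightarrow> ('a \<Rightarrow> 'a)) \<Rightarrow> ('a \<Rightarrow> 'a) \<Rightarrow> ('a \<Rightarrow> 'a)" where
  "predual \<Phi> \<rho> = (THE \<eta>. trace_class \<eta> \<and>
     (\<forall>A. bounded_op A \<longrightarrow> trace_op (\<eta> \<circ> A) = trace_op (\<rho> \<circ> \<Phi> A)))"

definition invariant_state ::
    "(real \<Rightarrow> ('a::complex_hilbert \<Rightarrow> 'a) \<Rightarrow> ('a \<Rightarrow> 'a)) \<Rightarrow> ('a \<Rightarrow> 'a) \<Rightarrow> bool" where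
  "invariant_state T \<rho> \<longleftrightarrow> density_op \<rho> \<and> (\<forall>t\<ge>0. predual (T t) \<rho> = \<rho>)"

definition positive_recurrent ::
    "(real \<Rightarrow> ('a::complex_hilbert \<Rightarrow> 'a) \<Rightarrow> ('a \<Rightarrow> 'a)) \<Rightarrow> 'a set" where
  "positive_recurrent T = csup {supp \<rho> | \<rho>. invariant_state T \<rho>}"

text \<open>The trace in the integrand is a nonnegative real.\<close>

definition transient ::
    "(real \<Rightarrow> ('a::complex_hilbert \<Rightarrow> 'a) \<Rightarrow> ('a \<Rightarrow> 'a)) \<Rightarrow> 'a set" where
  "transient T = csup {range p | p. projection p \<and>
     (\<exists>C>0. \<forall>\<rho>. density_op \<rho> \<longrightarrow>
        (\<integral>\<^sup>+ s \<in> {0..}. ennreal (Re (trace_op (predual (T s) \<rho> \<circ> p))) \<partial>lborel) \<le> ennreal C)}"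


section \<open>The bosonic Fock space\<close>

definition sq_summable :: "('b \<Rightarrow> complex) \<Rightarrow> bool" where
  "sq_summable f \<longleftrightarrow> (\<lambda>x. (cmod (f x))\<^sup>2) summable_on UNIV"

lemma sq_summableI:
  assumes "\<And>F. finite F \<Longrightarrow> (\<Sum>x\<in>F. (cmod (f x))\<^sup>2) \<le> B"
  shows "sq_summable f"
  unfolding sq_summable_def
  by (rule nonneg_bdd_above_summable_on) (use assms in \<open>auto intro!: bdd_aboveI[of _ B]\<close>)

lemma sq_summable_zero: "sq_summable (\<lambda>_. 0)"
  by (simp add: sq_summable_def)

lemma sq_summable_add:
  assumes "sq_summable f" "sq_summable g"
  shows "sq_summable (\<lambda>x. f x + g x)"
proof -
  have "(\<lambda>x. 2 * (cmod (f x))\<^sup>2 + 2 * (cmod (g x))\<^sup>2) summable_on UNIV"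
    using assms unfolding sq_summable_def
    by (intro summable_on_add summable_on_cmult_right)
  then show ?thesis
    unfolding sq_summable_def
  proof (rule summable_on_comparison_test)
    fix x
    have "(cmod (f x + g x))\<^sup>2 \<le> (cmod (f x) + cmod (g x))\<^sup>2"
      by (intro power_mono norm_triangle_ineq) simp
    also have "\<dots> \<le> 2 * (cmod (f x))\<^sup>2 + 2 * (cmod (g x))\<^sup>2"
      using sum_squares_bound[of "cmod (f x)" "cmod (g x)"] by (simp add: power2_sum)
    finally show "(cmod (f x + g x))\<^sup>2 \<le> 2 * (cmod (f x))\<^sup>2 + 2 * (cmod (g x))\<^sup>2" .
  qed auto
qed

lemma sq_summable_cmult:
  assumes "sq_summable f"
  shows "sq_summable (\<lambda>x. c * f x)"
  using summable_on_cmult_right[of "\<lambda>x. (cmod (f x))\<^sup>2" UNIV "(cmod c)\<^sup>2"] assms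
  by (simp add: sq_summable_def norm_mult power_mult_distrib)

lemma sq_summable_product:
  assumes "sq_summable f" "sq_summable g"
  shows "(\<lambda>x. cnj (f x) * g x) summable_on UNIV"
proof -
  have "(\<lambda>x. (cmod (f x))\<^sup>2 + (cmod (g x))\<^sup>2) summable_on UNIV"
    using assms unfolding sq_summable_def by (intro summable_on_add)
  then have "(\<lambda>x. norm (cnj (f x) * g x)) summable_on UNIV"
  proof (rule summable_on_comparison_test)
    fix x
    have "0 \<le> cmod (f x) * cmod (g x)" by simp
    with sum_squares_bound[of "cmod (f x)" "cmod (g x)"]
    have "cmod (f x) * cmod (g x) \<le> (cmod (f x))\<^sup>2 + (cmod (g x))\<^sup>2" by linarith
    then show "norm (cnj (f x) * g x) \<le> (cmod (f x))\<^sup>2 + (cmod (g x))\<^sup>2"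
      by (simp add: norm_mult)
  qed auto
  then show ?thesis by (rule abs_summable_summable)
qed

text \<open>Square summable functions on words form the full Fock space: the value at
  \<open>[i\<^sub>1, \<dots>, i\<^sub>n]\<close> is the coefficient of the tensor product of the canonical basis vectors with
  these indices. The bosonic Fock space is the permutation invariant part.\<close>

typedef 'd fock =
  "{f :: 'd list \<Rightarrow> complex. sq_summable f \<and> (\<forall>xs ys. mset xs = mset ys \<longrightarrow> f xs = f ys)}"
  morphisms coeff_fock Abs_fock
  by (rule exI[of _ "\<lambda>_. 0"]) (simp add: sq_summable_zero)

setup_lifting type_definition_fock

lemma sq_summable_coeff: "sq_summable (coeff_fock f)"
  using coeff_fock[of f] by blast

lemma coeff_summable: "(\<lambda>xs. cnj (coeff_fock f xs) * coeff_fock g xs) summable_on UNIV"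
  by (rule sq_summable_product) (rule sq_summable_coeff)+

instantiation fock :: (type) real_inner
begin

lift_definition zero_fock :: "'a fock" is "\<lambda>_. 0"
  by (simp add: sq_summable_zero)

lift_definition plus_fock :: "'a fock \<Rightarrow> 'a fock \<Rightarrow> 'a fock" is "\<lambda>f g xs. f xs + g xs"
  by (intro conjI allI impI) (blast intro: sq_summable_add, metis)

lift_definition scaleR_fock :: "real \<Rightarrow> 'a fock \<Rightarrow> 'a fock" is "\<lambda>r f xs. complex_of_real r * f xs"
  by (intro conjI allI impI) (blast intro: sq_summable_cmult, metis)

definition uminus_fock :: "'a fock \<Rightarrow> 'a fock" where
  "uminus_fock f = (-1) *\<^sub>R f"

definition minus_fock :: "'a fock \<Rightarrow> 'a fock \<Rightarrow> 'a fock" where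
  "minus_fock f g = f + (- g)"

definition inner_fock :: "'a fock \<Rightarrow> 'a fock \<Rightarrow> real" where
  "inner_fock f g = Re (\<Sum>\<^sub>\<infinity>xs. cnj (coeff_fock f xs) * coeff_fock g xs)"

definition norm_fock :: "'a fock \<Rightarrow> real" where
  "norm_fock f = sqrt (inner f f)"

definition sgn_fock :: "'a fock \<Rightarrow> 'a fock" where
  "sgn_fock f = inverse (norm f) *\<^sub>R f"

definition dist_fock :: "'a fock \<Rightarrow> 'a fock \<Rightarrow> real" where
  "dist_fock f g = norm (f - g)"

definition uniformity_fock :: "('a fock \<times> 'a fock) filter" where
  "uniformity_fock = (INF e\<in>{0<..}. principal {(x, y). dist x y < e})"

definition open_fock :: "'a fock set \<Rightarrow> bool" where
  "open_fock U = (\<forall>x\<in>U. eventually (\<lambda>(x', y). x' = x \<longrightarrow> y \<in> U) uniformity)"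

lemma coeff_simps:
  fixes f g :: "'a fock"
  shows "coeff_fock 0 xs = 0" "coeff_fock (f + g) xs = coeff_fock f xs + coeff_fock g xs"
    "coeff_fock (r *\<^sub>R f) xs = r * coeff_fock f xs"
    "coeff_fock (- f) xs = - coeff_fock f xs"
    "coeff_fock (f - g) xs = coeff_fock f xs - coeff_fock g xs"
  by (simp_all add: zero_fock.rep_eq plus_fock.rep_eq scaleR_fock.rep_eq
      uminus_fock_def minus_fock_def)

lemma fock_eqI: "(\<And>xs. coeff_fock f xs = coeff_fock g xs) \<Longrightarrow> f = g"
  by (simp add: coeff_fock_inject[symmetric] fun_eq_iff)

lemma inner_self_fock:
  fixes f :: "'a fock"
  shows "inner f f = (\<Sum>\<^sub>\<infinity>xs. (cmod (coeff_fock f xs))\<^sup>2)"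
proof -
  have "inner f f = (\<Sum>\<^sub>\<infinity>xs. Re (cnj (coeff_fock f xs) * coeff_fock f xs))"
    unfolding inner_fock_def by (rule infsum_Re[symmetric, OF coeff_summable])
  also have "(\<lambda>xs. Re (cnj (coeff_fock f xs) * coeff_fock f xs)) =
      (\<lambda>xs. (cmod (coeff_fock f xs))\<^sup>2)"
    by (simp add: fun_eq_iff cmod_power2) (simp add: power2_eq_square)
  finally show ?thesis .
qed

lemma norm_coeff_sum_le:
  fixes f :: "'a fock"
  assumes "finite F"
  shows "(\<Sum>xs\<in>F. (cmod (coeff_fock f xs))\<^sup>2) \<le> (norm f)\<^sup>2"
proof -
  have "(\<Sum>xs\<in>F. (cmod (coeff_fock f xs))\<^sup>2) \<le> inner f f"
    unfolding inner_self_fock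
    by (rule finite_sum_le_infsum)
      (use sq_summable_coeff[of f] assms in \<open>auto simp: sq_summable_def\<close>)
  moreover have "0 \<le> inner f f" unfolding inner_self_fock by (rule infsum_nonneg) simp
  ultimately show ?thesis by (simp add: norm_fock_def)
qed

lemma norm_coeff_le: "cmod (coeff_fock f xs) \<le> norm f"
proof -
  have "0 \<le> inner f f" unfolding inner_self_fock by (rule infsum_nonneg) simp
  then have "0 \<le> norm f" by (simp add: norm_fock_def)
  with norm_coeff_sum_le[of "{xs}" f] show ?thesis by (simp add: power2_le_iff_abs_le)
qed

lemma norm_fock_leI:
  fixes f :: "'a fock"
  assumes "\<And>F. finite F \<Longrightarrow> (\<Sum>xs\<in>F. (cmod (coeff_fock f xs))\<^sup>2) \<le> B\<^sup>2" "0 \<le> B"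
  shows "norm f \<le> B"
proof -
  have "inner f f \<le> B\<^sup>2"
    unfolding inner_self_fock
    by (rule infsum_le_finite_sums)
      (use sq_summable_coeff[of f] assms in \<open>auto simp: sq_summable_def\<close>)
  then show ?thesis using assms(2) by (simp add: norm_fock_def real_le_lsqrt)
qed

instance
proof
  fix f g h :: "'a fock" and a b :: real
  show "f + g + h = f + (g + h)" "f + g = g + f" "0 + f = f" "- f + f = 0" "f - g = f + - g"
    by (auto intro!: fock_eqI simp: coeff_simps)
  show "a *\<^sub>R (f + g) = a *\<^sub>R f + a *\<^sub>R g" "(a + b) *\<^sub>R f = a *\<^sub>R f + b *\<^sub>R f"
    "a *\<^sub>R b *\<^sub>R f = (a * b) *\<^sub>R f" "1 *\<^sub>R f = f"
    by (auto intro!: fock_eqI simp: coeff_simps algebra_simps)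
  show comm: "inner f g = inner g f" for f g :: "'a fock"
  proof -
    have "inner f g = Re (cnj (\<Sum>\<^sub>\<infinity>xs. cnj (coeff_fock f xs) * coeff_fock g xs))"
      by (simp add: inner_fock_def)
    also have "\<dots> = inner g f"
      unfolding infsum_cnj[symmetric] inner_fock_def by (simp add: mult.commute)
    finally show ?thesis .
  qed
  show "inner (f + g) h = inner f h + inner g h"
    unfolding inner_fock_def coeff_simps complex_cnj_add distrib_right
    by (subst infsum_add) (simp_all add: coeff_summable)
  have "inner (a *\<^sub>R f) g =
      Re (\<Sum>\<^sub>\<infinity>xs. complex_of_real a * (cnj (coeff_fock f xs) * coeff_fock g xs))"
    by (simp add: inner_fock_def coeff_simps mult.assoc)
  also have "\<dots> = a * inner f g"
    unfolding infsum_cmult_right' inner_fock_def by simp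
  finally show "inner (a *\<^sub>R f) g = a * inner f g" .
  show "0 \<le> inner f f" unfolding inner_self_fock by (rule infsum_nonneg) simp
  show "inner f f = 0 \<longleftrightarrow> f = 0"
  proof
    assume "inner f f = 0"
    then have "norm f = 0" by (simp add: norm_fock_def)
    then show "f = 0" using norm_coeff_le[of f] by (auto intro!: fock_eqI simp: coeff_simps)
  qed (simp add: inner_self_fock coeff_simps)
  show "norm f = sqrt (inner f f)" by (rule norm_fock_def)
  show "sgn f = inverse (norm f) *\<^sub>R f" by (rule sgn_fock_def)
  show "dist f g = norm (f - g)" by (rule dist_fock_def)
  show "uniformity = (INF e\<in>{0<..}. principal {(x::'a fock, y). dist x y < e})"
    by (rule uniformity_fock_def)
  show "open U \<longleftrightarrow> (\<forall>x\<in>U. eventually (\<lambda>(x', y). x' = x \<longrightarrow> y \<in> U) uniformity)"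
    for U :: "'a fock set" by (rule open_fock_def)
qed

end

instantiation fock :: (type) complex_hilbert
begin

lift_definition scaleC_fock :: "complex \<Rightarrow> 'a fock \<Rightarrow> 'a fock" is "\<lambda>c f xs. c * f xs"
  by (intro conjI allI impI) (blast intro: sq_summable_cmult, metis)

definition cinner_fock :: "'a fock \<Rightarrow> 'a fock \<Rightarrow> complex" where
  "cinner_fock f g = (\<Sum>\<^sub>\<infinity>xs. cnj (coeff_fock f xs) * coeff_fock g xs)"

instance
proof
  fix f g h :: "'a fock" and a :: real and c e :: complex
  show "c *\<^sub>C (f + g) = c *\<^sub>C f + c *\<^sub>C g" "(c + e) *\<^sub>C f = c *\<^sub>C f + e *\<^sub>C f"
    "c *\<^sub>C e *\<^sub>C f = (c * e) *\<^sub>C f" "complex_of_real a *\<^sub>C f = a *\<^sub>R f"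
    by (auto intro!: fock_eqI simp: coeff_simps scaleC_fock.rep_eq algebra_simps)
  show "cinner f g = cnj (cinner g f)"
    unfolding cinner_fock_def by (subst infsum_cnj[symmetric]) (simp add: mult.commute)
  show "cinner f (g + h) = cinner f g + cinner f h"
    unfolding cinner_fock_def coeff_simps distrib_left
    by (rule infsum_add) (rule coeff_summable)+
  show "cinner f (c *\<^sub>C g) = c * cinner f g"
    unfolding cinner_fock_def scaleC_fock.rep_eq
    by (subst infsum_cmult_right'[symmetric]) (simp add: mult.left_commute)
  show "inner f g = Re (cinner f g)" by (simp add: inner_fock_def cinner_fock_def)
  show "convergent X" if X: "Cauchy X" for X :: "nat \<Rightarrow> 'a fock"
  proof -
    have "Cauchy (\<lambda>n. coeff_fock (X n) xs)" for xs
    proof (rule metric_CauchyI)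
      fix e :: real assume "0 < e"
      then obtain M where "\<forall>m\<ge>M. \<forall>n\<ge>M. dist (X m) (X n) < e"
        using X by (meson Cauchy_def)
      moreover have "dist (coeff_fock (X m) xs) (coeff_fock (X n) xs) \<le> dist (X m) (X n)" for m n
        using norm_coeff_le[of "X m - X n" xs] by (simp add: dist_norm dist_fock_def coeff_simps)
      ultimately show "\<exists>M. \<forall>m\<ge>M. \<forall>n\<ge>M. dist (coeff_fock (X m) xs) (coeff_fock (X n) xs) < e"
        by (meson le_less_trans)
    qed
    then have "\<forall>xs. \<exists>l. (\<lambda>n. coeff_fock (X n) xs) \<longlonglongrightarrow> l"
      by (simp add: Cauchy_convergent_iff convergent_def)
    then obtain l where l: "\<And>xs. (\<lambda>n. coeff_fock (X n) xs) \<longlonglongrightarrow> l xs" by metis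
    have bound: "(\<Sum>xs\<in>F. (cmod (coeff_fock (X m) xs - l xs))\<^sup>2) \<le> e\<^sup>2"
      if M: "\<forall>m\<ge>M. \<forall>n\<ge>M. dist (X m) (X n) < e" and m: "m \<ge> M" and F: "finite F" for M m e F
    proof (rule LIMSEQ_le_const2)
      show "(\<lambda>n. \<Sum>xs\<in>F. (cmod (coeff_fock (X m) xs - coeff_fock (X n) xs))\<^sup>2) \<longlonglongrightarrow>
          (\<Sum>xs\<in>F. (cmod (coeff_fock (X m) xs - l xs))\<^sup>2)"
        by (intro tendsto_intros l)
      have "(\<Sum>xs\<in>F. (cmod (coeff_fock (X m) xs - coeff_fock (X n) xs))\<^sup>2) \<le> e\<^sup>2" if "n \<ge> M" for n
      proof -
        have "(\<Sum>xs\<in>F. (cmod (coeff_fock (X m) xs - coeff_fock (X n) xs))\<^sup>2) \<le> (norm (X m - X n))\<^sup>2"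
          using norm_coeff_sum_le[OF F, of "X m - X n"] by (simp add: coeff_simps)
        also have "\<dots> \<le> e\<^sup>2"
        proof (rule power_mono)
          show "norm (X m - X n) \<le> e" using M m that by (simp add: dist_fock_def less_imp_le)
          show "0 \<le> norm (X m - X n)"
            using norm_coeff_le[of "X m - X n" "[]"] norm_ge_zero order_trans by blast
        qed
        finally show ?thesis .
      qed
      then show "\<exists>N. \<forall>n\<ge>N. (\<Sum>xs\<in>F. (cmod (coeff_fock (X m) xs - coeff_fock (X n) xs))\<^sup>2) \<le> e\<^sup>2"
        by blast
    qed
    obtain M where M: "\<forall>m\<ge>M. \<forall>n\<ge>M. dist (X m) (X n) < 1"
      using X unfolding Cauchy_def by (metis zero_less_one)
    have "sq_summable (\<lambda>xs. coeff_fock (X M) xs - l xs)"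
      by (rule sq_summableI[of _ "1\<^sup>2"]) (rule bound[OF M order_refl])
    then have "sq_summable (\<lambda>xs. coeff_fock (X M) xs + (-1) * (coeff_fock (X M) xs - l xs))"
      by (intro sq_summable_add sq_summable_cmult sq_summable_coeff)
    then have "sq_summable l" by simp
    moreover have "l xs = l ys" if "mset xs = mset ys" for xs ys
    proof -
      have "coeff_fock (X n) xs = coeff_fock (X n) ys" for n using coeff_fock[of "X n"] that by blast
      then show ?thesis using l[of xs] l[of ys] by (simp add: LIMSEQ_unique)
    qed
    ultimately have
      "l \<in> {f. sq_summable f \<and> (\<forall>xs ys. mset xs = mset ys \<longrightarrow> f xs = f ys)}" by blast
    from Abs_fock_inverse[OF this] obtain L where L: "coeff_fock L = l" by blast
    have "X \<longlonglongrightarrow> L"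
      unfolding lim_sequentially
    proof (intro allI impI)
      fix r :: real assume r: "0 < r"
      then obtain M where M: "\<forall>m\<ge>M. \<forall>n\<ge>M. dist (X m) (X n) < r / 2"
        using X unfolding Cauchy_def by (meson half_gt_zero)
      have "dist (X n) L < r" if "n \<ge> M" for n
      proof -
        have "norm (X n - L) \<le> r / 2"
          by (rule norm_fock_leI) (use bound[OF M that] r in \<open>auto simp: coeff_simps L\<close>)
        then show ?thesis using r by (simp add: dist_fock_def)
      qed
      then show "\<exists>M. \<forall>n\<ge>M. dist (X n) L < r" by blast
    qed
    then show ?thesis by (auto simp: convergent_def)
  qed
qed

end


section \<open>Exponential vectors and Weyl operators\<close>

lemma sum_words_length:
  fixes a :: "'d::finite \<Rightarrow> real"
  shows "(\<Sum>xs | length xs = n. prod_list (map a xs)) = (\<Sum>i\<in>UNIV. a i) ^ n"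
proof (induction n)
  case (Suc n)
  have eq: "{xs :: 'd list. length xs = Suc n} = (\<lambda>(x, xs). x # xs) ` (UNIV \<times> {xs. length xs = n})"
    by (auto simp: length_Suc_conv image_iff)
  have "(\<Sum>xs | length xs = Suc n. prod_list (map a xs)) =
      (\<Sum>(x, xs)\<in>UNIV \<times> {xs. length xs = n}. a x * prod_list (map a xs))"
    unfolding eq by (subst sum.reindex) (auto simp: inj_on_def o_def case_prod_unfold)
  also have "\<dots> = (\<Sum>i\<in>UNIV. a i) * (\<Sum>xs | length xs = n. prod_list (map a xs))"
    by (simp add: sum.cartesian_product[symmetric] sum_product)
  finally show ?case using Suc by simp
qed simp

lemma finite_words_length: "finite {xs :: 'd::finite list. length xs = n}"
  using finite_lists_length_eq[of "UNIV :: 'd set" n] by simp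

lift_definition expvec :: "complex ^ 'd::finite \<Rightarrow> 'd fock" is
  "\<lambda>z xs. (\<Prod>i\<leftarrow>xs. z $ i) / complex_of_real (sqrt (fact (length xs)))"
proof -
  fix z :: "complex ^ 'd"
  let ?f = "\<lambda>xs. (\<Prod>i\<leftarrow>xs. z $ i) / complex_of_real (sqrt (fact (length xs)))"
  define a where "a i = (cmod (z $ i))\<^sup>2" for i
  have norm_prod: "(cmod (\<Prod>i\<leftarrow>xs. z $ i))\<^sup>2 = prod_list (map a xs)" for xs
    by (induction xs) (auto simp: a_def norm_mult power_mult_distrib)
  have f: "(cmod (?f xs))\<^sup>2 = prod_list (map a xs) / fact (length xs)" for xs
    by (simp add: norm_divide power_divide norm_prod)
  have a0: "0 \<le> prod_list (map a xs)" for xs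
    by (induction xs) (auto simp: a_def)
  define S where "S = (\<Sum>i\<in>UNIV. a i)"
  have S: "0 \<le> S" by (auto simp: S_def a_def intro!: sum_nonneg)
  show "sq_summable ?f \<and> (\<forall>xs ys. mset xs = mset ys \<longrightarrow> ?f xs = ?f ys)"
  proof (intro conjI allI impI)
    show "sq_summable ?f"
    proof (rule sq_summableI)
      fix F :: "'d list set" assume F: "finite F"
      define N where "N = Suc (Max (insert 0 (length ` F)))"
      have "length xs < N" if "xs \<in> F" for xs
        using F that by (auto simp: N_def less_Suc_eq_le intro!: Max_ge)
      then have sub: "F \<subseteq> (\<Union>n<N. {xs. length xs = n})" by auto
      have "(\<Sum>xs\<in>F. (cmod (?f xs))\<^sup>2) \<le> (\<Sum>xs\<in>(\<Union>n<N. {xs. length xs = n}). (cmod (?f xs))\<^sup>2)"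
        by (rule sum_mono2) (use sub finite_words_length in auto)
      also have "\<dots> = (\<Sum>n<N. \<Sum>xs | length xs = n. (cmod (?f xs))\<^sup>2)"
        by (rule sum.UNION_disjoint) (use finite_words_length in auto)
      also have "\<dots> = (\<Sum>n<N. S ^ n /\<^sub>R fact n)"
        unfolding f S_def sum_words_length[symmetric]
        by (auto intro!: sum.cong simp: sum_divide_distrib divide_simps)
      also have "\<dots> \<le> (\<Sum>n. S ^ n /\<^sub>R fact n)"
        by (rule sum_le_suminf) (use S summable_exp_generic[of S] in auto)
      finally show "(\<Sum>xs\<in>F. (cmod (?f xs))\<^sup>2) \<le> (\<Sum>n. S ^ n /\<^sub>R fact n)" .
    qed
    fix xs ys :: "'d list" assume "mset xs = mset ys"
    moreover from this have "length xs = length ys" by (metis size_mset)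
    moreover from \<open>mset xs = mset ys\<close>
    have "prod_mset (mset (map (\<lambda>i. z $ i) xs)) = prod_mset (mset (map (\<lambda>i. z $ i) ys))" by simp
    then have "(\<Prod>i\<leftarrow>xs. z $ i) = (\<Prod>i\<leftarrow>ys. z $ i)" by (simp only: prod_mset_prod_list)
    ultimately show "?f xs = ?f ys" by simp
  qed
qed

definition cdot :: "complex ^ 'd \<Rightarrow> complex ^ 'd::finite \<Rightarrow> complex" where
  "cdot z w = (\<Sum>i\<in>UNIV. cnj (z $ i) * w $ i)"

text \<open>Consequently \<open>z \<bullet> w = Re (cdot z w)\<close> in the library inner product.\<close>

lemma inner_eq_Re_cdot: "z \<bullet> w = Re (cdot z w)"
  by (simp add: inner_vec_def cdot_def inner_complex_def)

definition symp_form :: "complex ^ 'd \<Rightarrow> complex ^ 'd::finite \<Rightarrow> real" where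
  "symp_form z w = Im (cdot z w)"

definition weyl :: "complex ^ 'd \<Rightarrow> 'd::finite fock \<Rightarrow> 'd fock" where
  "weyl z = (THE U. unitary_op U \<and>
     (\<forall>w. U (expvec w) = exp (- complex_of_real ((norm z)\<^sup>2) / 2 - cdot z w) *\<^sub>C expvec (z + w)))"


section \<open>Gaussian quantum Markov semigroups\<close>

text \<open>The index \<open>Inl i\<close> refers to the real part and \<open>Inr i\<close> to the imaginary part of the
  \<open>i\<close>-th coordinate.\<close>

definition to_real :: "complex ^ 'd \<Rightarrow> real ^ ('d + 'd::finite)" where
  "to_real z = (\<chi> k. case k of Inl i \<Rightarrow> Re (z $ i) | Inr i \<Rightarrow> Im (z $ i))"

definition of_real_vec :: "real ^ ('d + 'd::finite) \<Rightarrow> complex ^ 'd" where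
  "of_real_vec v = (\<chi> i. Complex (v $ Inl i) (v $ Inr i))"

definition real_mat :: "(complex ^ 'd \<Rightarrow> complex ^ 'd) \<Rightarrow> real ^ ('d + 'd) ^ ('d + 'd::finite)" where
  "real_mat A = matrix (to_real \<circ> A \<circ> of_real_vec)"

definition J_mat :: "real ^ ('d + 'd) ^ ('d + 'd::finite)" where
  "J_mat = (\<chi> k l. case (k, l) of
      (Inl i, Inr j) \<Rightarrow> (if i = j then 1 else 0)
    | (Inr i, Inl j) \<Rightarrow> (if i = j then - 1 else 0)
    | _ \<Rightarrow> 0)"

definition psd_mat :: "complex ^ 'n ^ 'n::finite \<Rightarrow> bool" where
  "psd_mat M \<longleftrightarrow> (\<forall>v. (\<Sum>k\<in>UNIV. cnj (v $ k) * (M *v v) $ k) \<in> \<real>\<^sub>\<ge>\<^sub>0)"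

text \<open>The flow of \<open>Z\<close>, i.e. the operator exponential of \<open>t Z\<close>.\<close>

definition flow :: "(complex ^ 'd \<Rightarrow> complex ^ 'd::finite) \<Rightarrow> real \<Rightarrow> complex ^ 'd \<Rightarrow> complex ^ 'd" where
  "flow Z t z = (\<Sum>n. (t ^ n / fact n) *\<^sub>R (Z ^^ n) z)"

definition gaussian_params ::
    "(complex ^ 'd \<Rightarrow> complex ^ 'd::finite) \<Rightarrow> (complex ^ 'd \<Rightarrow> complex ^ 'd) \<Rightarrow> bool" where
  "gaussian_params Z C \<longleftrightarrow> linear Z \<and> linear C \<and> (\<forall>z w. z \<bullet> C w = C z \<bullet> w) \<and>
     psd_mat (\<chi> k l. complex_of_real (real_mat C $ k $ l) +
       \<i> * complex_of_real ((transpose (real_mat Z) ** J_mat + J_mat ** real_mat Z) $ k $ l))"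

definition gaussian_qms ::
    "(real \<Rightarrow> ('d::finite fock \<Rightarrow> 'd fock) \<Rightarrow> ('d fock \<Rightarrow> 'd fock)) \<Rightarrow>
     (complex ^ 'd \<Rightarrow> complex ^ 'd) \<Rightarrow> (complex ^ 'd \<Rightarrow> complex ^ 'd) \<Rightarrow> complex ^ 'd \<Rightarrow> bool" where
  "gaussian_qms T Z C \<zeta> \<longleftrightarrow> qms T \<and> gaussian_params Z C \<and>
     (\<forall>t\<ge>0. \<forall>z. T t (weyl z) = (\<lambda>f.
        exp (complex_of_real (- (integral {0..t} (\<lambda>s. flow Z s z \<bullet> C (flow Z s z))) / 2)
             + \<i> * complex_of_real (integral {0..t} (\<lambda>s. \<zeta> \<bullet> flow Z s z)))
        *\<^sub>C weyl (flow Z t z) f))"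

text \<open>\<open>symp_conj T T'\<close> says that \<open>T'\<close> belongs to the class of \<open>T\<close>. The unitary \<open>U\<close>
  implementing \<open>M\<close> is unique up to a phase, which cancels below.\<close>

definition symp_conj ::
    "(real \<Rightarrow> ('d::finite fock \<Rightarrow> 'd fock) \<Rightarrow> ('d fock \<Rightarrow> 'd fock)) \<Rightarrow>
     (real \<Rightarrow> ('d fock \<Rightarrow> 'd fock) \<Rightarrow> ('d fock \<Rightarrow> 'd fock)) \<Rightarrow> bool" where
  "symp_conj T T' \<longleftrightarrow> (\<exists>M U. linear M \<and> (\<forall>z w. symp_form (M z) (M w) = symp_form z w) \<and>
     unitary_op U \<and> (\<forall>z. U \<circ> weyl z \<circ> adj U = weyl (M z)) \<and>
     (\<forall>t\<ge>0. \<forall>A. bounded_op A \<longrightarrow> T' t A = U \<circ> T t (adj U \<circ> A \<circ> U) \<circ> adj U))"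


section \<open>Normal form\<close>

definition first_inds :: "nat \<Rightarrow> 'd::{finite, linorder} set" where
  "first_inds m = {i. card {j. j < i} < m}"

definition coord_space :: "'d set \<Rightarrow> (complex ^ 'd::finite) set" where
  "coord_space I = {z. \<forall>i. i \<notin> I \<longrightarrow> z $ i = 0}"

definition coord_part :: "'d set \<Rightarrow> complex ^ 'd \<Rightarrow> complex ^ 'd::finite" where
  "coord_part I z = (\<chi> i. if i \<in> I then z $ i else 0)"

text \<open>Spectrum of the complexification of the restriction of \<open>A\<close> to \<open>coord_space I\<close>, for \<open>A\<close>
  leaving this subspace invariant.\<close>

definition spectrum_on :: "'d set \<Rightarrow> (complex ^ 'd \<Rightarrow> complex ^ 'd::finite) \<Rightarrow> complex set" where
  "spectrum_on I A = {l. \<exists>v. v \<noteq> 0 \<and> (\<forall>i. i \<notin> I \<longrightarrow> v $ Inl i = 0 \<and> v $ Inr i = 0) \<and>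
     map_matrix complex_of_real (real_mat A) *v v = l *s v}"

definition normal_form ::
    "(complex ^ 'd::{finite, linorder} \<Rightarrow> complex ^ 'd::{finite, linorder}) \<Rightarrow>
     (complex ^ 'd::{finite, linorder} \<Rightarrow> complex ^ 'd::{finite, linorder}) \<Rightarrow>
     complex ^ 'd::{finite, linorder} \<Rightarrow> bool" where
  "normal_form Z C \<zeta> \<longleftrightarrow> (\<exists>d0 \<phi>. d0 \<le> CARD('d) \<and>
     (let I0 = first_inds d0; V0 = coord_space I0; Vm = coord_space (- I0) in
        Z ` V0 \<subseteq> V0 \<and> Z ` Vm \<subseteq> Vm \<and>
        C ` V0 \<subseteq> {0} \<and> C ` Vm \<subseteq> Vm \<and>
        (\<forall>i\<in>I0. \<forall>j\<in>I0.
           real_mat Z $ Inl i $ Inl j = 0 \<and>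
           real_mat Z $ Inl i $ Inr j = (if i = j then - \<phi> i else 0) \<and>
           real_mat Z $ Inr i $ Inl j = (if i = j then \<phi> i else 0) \<and>
           real_mat Z $ Inr i $ Inr j = 0) \<and>
        spectrum_on (- I0) Z \<subseteq> {z. Re z < 0} \<and>
        (\<forall>w\<in>V0. Z w = 0 \<longrightarrow> w \<bullet> coord_part I0 \<zeta> = 0)))"

end

theory Submission
  imports Defs "HOL-Probability.Probability"
begin

text \<open>Let \<open>p\<close> project onto the positive recurrent subspace. If \<open>q\<close> has bounded potential, then
  \<open>tr (\<rho> q) = 0\<close> for each invariant \<open>\<rho>\<close>, so the transient subspace is orthogonal to the recurrent
  one. Conversely, \<open>p\<close> is subharmonic and \<open>T h p - p\<close> has bounded potential by telescoping, so a vector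
  \<open>v\<close> orthogonal to both subspaces satisfies \<open>\<langle>v, T h p v\<rangle> = 0\<close> for all \<open>h\<close>. Cesaro means of the orbit
  of the vector state of \<open>v\<close> have a limit point, an invariant state vanishing on \<open>p\<close>. If the orbit is
  tight, this state is normal, hence supported by \<open>p\<close>: a contradiction.

  Tightness comes from the invariant density. Write \<open>T t (W z) = c t z W (F t z)\<close>; the characteristic
  function of the invariant density satisfies \<open>\<chi> z = c t z \<chi> (F t z)\<close>, is \<open>1\<close> at \<open>0\<close> and vanishes at
  infinity. As \<open>\<bar>c t z\<bar> \<le> 1\<close>, the flow \<open>F\<close> is bounded uniformly in time, whence \<open>c t z\<close> tends to \<open>1\<close>
  as \<open>z\<close> tends to \<open>0\<close>, uniformly in \<open>t\<close>. So the characteristic functions of the states along an orbit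
  are equicontinuous at \<open>0\<close>, and averaging them over narrow Gaussian distributions bounds the
  probability of a large particle number.\<close>

section \<open>Complex inner product spaces\<close>

text \<open>The obstacle is normality. Time averages have limit points only among all states on the
  bounded operators, so states are handled as positive functionals; such a functional comes from a
  density operator once finite basis projections capture mass arbitrarily close to 1. The same
  criterion shows that the predual of a normal map preserves densities. Since a trace refers to one
  chosen basis, traces are computed from \<open>\<rho> = Q Q\<close> with \<open>Q\<close> symmetric
  and Hilbert-Schmidt, the root coming from the power series of the square root of
  \<open>1 - x\<close>. The flow is bounded because the modulus of \<open>\<chi>\<close> is at least
  1/2 on some ball and below 1/2 far out: as the factor \<open>c t z\<close> only decreases the
  modulus, \<open>F t z\<close> cannot leave a fixed ball, and homogeneity does the rest. Averaging
  is effective because the mean of \<open>weyl z\<close> over independent real coordinates of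
  variance \<open>r^2\<close> is \<open>(1 + r^2)^(-d)\<close> times \<open>q^N\<close>, where
  \<open>N\<close> is the particle number and \<open>q = (1 - r^2) / (1 + r^2)\<close>. A mean close
  to 1 forces mass onto short words, since \<open>q^N\<close> is at most \<open>q^n\<close> beyond
  length \<open>n\<close>.\<close>

lemma cinner_zero_right [simp]: "cinner x (0::'a::complex_hilbert) = 0"
  using cinner_add_right[of x 0 0] by simp

lemma cinner_zero_left [simp]: "cinner (0::'a::complex_hilbert) x = 0"
  using cinner_commute[of 0 x] by simp

lemma cinner_add_left: "cinner (x + y) (z::'a::complex_hilbert) = cinner x z + cinner y z"
  by (metis cinner_add_right cinner_commute complex_cnj_add)

lemma cinner_scaleC_left: "cinner (c *\<^sub>C x) (y::'a::complex_hilbert) = cnj c * cinner x y"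
  by (metis cinner_commute cinner_scaleC_right complex_cnj_mult)

lemma scaleC_one [simp]: "1 *\<^sub>C (x::'a::complex_hilbert) = x"
  using scaleC_of_real[of 1 x] by simp

lemma scaleC_zero_left [simp]: "0 *\<^sub>C (x::'a::complex_hilbert) = 0"
  using scaleC_of_real[of 0 x] by simp

lemma scaleC_zero_right [simp]: "c *\<^sub>C (0::'a::complex_hilbert) = 0"
  by (metis add_cancel_right_right scaleC_add_right)

lemma scaleC_minus1: "(-1) *\<^sub>C (x::'a::complex_hilbert) = - x"
  using scaleC_of_real[of "-1" x] by simp

lemma scaleC_minus_left [simp]: "(- c) *\<^sub>C (x::'a::complex_hilbert) = - (c *\<^sub>C x)"
  using scaleC_scaleC[of "-1" c x] by (simp add: scaleC_minus1)

lemma scaleC_minus_right [simp]: "c *\<^sub>C (- x) = - (c *\<^sub>C (x::'a::complex_hilbert))"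
  using scaleC_scaleC[of c "-1" x] by (simp add: scaleC_minus1)

lemma scaleC_diff_right: "c *\<^sub>C (x - y) = c *\<^sub>C x - c *\<^sub>C (y::'a::complex_hilbert)"
  using scaleC_add_right[of c x "- y"] by simp

lemma cinner_minus_right [simp]: "cinner x (- y) = - cinner x (y::'a::complex_hilbert)"
  using cinner_scaleC_right[of x "-1" y] by (simp add: scaleC_minus1)

lemma cinner_minus_left [simp]: "cinner (- x) y = - cinner x (y::'a::complex_hilbert)"
  using cinner_scaleC_left[of "-1" x y] by (simp add: scaleC_minus1)

lemma cinner_diff_right: "cinner x (y - z) = cinner x y - cinner x (z::'a::complex_hilbert)"
  using cinner_add_right[of x y "- z"] by simp

lemma cinner_diff_left: "cinner (x - y) z = cinner x z - cinner y (z::'a::complex_hilbert)"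
  using cinner_add_left[of x "- y" z] by simp

lemma cinner_self: "cinner x x = complex_of_real ((norm (x::'a::complex_hilbert))\<^sup>2)"
proof -
  have "Im (cinner x x) = 0"
    using arg_cong[OF cinner_commute[of x x], of Im] by simp
  moreover have "Re (cinner x x) = (norm x)\<^sup>2"
    using inner_eq_Re_cinner[of x x] by (simp add: power2_norm_eq_inner)
  ultimately show ?thesis by (simp add: complex_eq_iff)
qed

lemma cinner_self_eq_0 [simp]: "cinner x x = 0 \<longleftrightarrow> x = (0::'a::complex_hilbert)"
  by (simp add: cinner_self)

lemma norm_scaleC: "norm (c *\<^sub>C (x::'a::complex_hilbert)) = cmod c * norm x"
proof -
  have "complex_of_real ((norm (c *\<^sub>C x))\<^sup>2) = complex_of_real ((cmod c * norm x)\<^sup>2)"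
    unfolding cinner_self[symmetric] cinner_scaleC_left cinner_scaleC_right
    by (simp add: cinner_self power_mult_distrib mult.assoc[symmetric] complex_norm_square[symmetric] mult.commute)
  then have "(norm (c *\<^sub>C x))\<^sup>2 = (cmod c * norm x)\<^sup>2" by (simp only: of_real_eq_iff)
  then show ?thesis by simp
qed

lemma cinner_eqI: "(\<And>z. cinner z x = cinner z y) \<Longrightarrow> x = (y::'a::complex_hilbert)"
  by (metis cinner_diff_right cinner_self_eq_0 eq_iff_diff_eq_0)

text \<open>Multiplying \<open>y\<close> by a phase makes the inner product real and nonnegative, so
  the real Cauchy-Schwarz inequality applies.\<close>

lemma cmod_cinner_le: "cmod (cinner x y) \<le> norm x * norm (y::'a::complex_hilbert)"
proof (cases "cinner x y = 0")
  case False
  define c where "c = cnj (cinner x y) / cmod (cinner x y)"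
  have c: "cmod c = 1" using False by (simp add: c_def norm_divide)
  have "cinner x (c *\<^sub>C y) = complex_of_real (cmod (cinner x y))"
    using False by (simp add: c_def cinner_scaleC_right complex_norm_square[symmetric]
        mult.commute power2_eq_square divide_simps flip: of_real_mult)
  then have "cmod (cinner x y) = x \<bullet> (c *\<^sub>C y)" by (simp add: inner_eq_Re_cinner)
  also have "\<dots> \<le> norm x * norm (c *\<^sub>C y)" by (rule norm_cauchy_schwarz)
  finally show ?thesis by (simp add: norm_scaleC c)
qed simp

lemma bounded_bilinear_cinner: "bounded_bilinear (cinner :: 'a::complex_hilbert \<Rightarrow> 'a \<Rightarrow> complex)"
proof
  show "cinner (r *\<^sub>R a) b = r *\<^sub>R cinner a b" "cinner a (r *\<^sub>R b) = r *\<^sub>R cinner a b"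
    for r and a b :: 'a
    unfolding scaleC_of_real[symmetric] by (simp_all add: cinner_scaleC_left cinner_scaleC_right scaleR_conv_of_real)
  show "\<exists>K. \<forall>(a::'a) b. norm (cinner a b) \<le> norm a * norm b * K"
    by (intro exI[of _ 1]) (simp add: cmod_cinner_le)
qed (simp_all add: cinner_add_left cinner_add_right)

interpretation cinner: bounded_bilinear "cinner :: 'a::complex_hilbert \<Rightarrow> 'a \<Rightarrow> complex"
  by (rule bounded_bilinear_cinner)

lemma bounded_bilinear_scaleC: "bounded_bilinear (scaleC :: complex \<Rightarrow> 'a::complex_hilbert \<Rightarrow> 'a)"
proof
  show "(r *\<^sub>R a) *\<^sub>C b = r *\<^sub>R (a *\<^sub>C b)" "a *\<^sub>C (r *\<^sub>R b) = r *\<^sub>R (a *\<^sub>C b)" for r a and b :: 'a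
    unfolding scaleC_of_real[symmetric] by (simp_all add: scaleC_scaleC scaleR_conv_of_real mult.commute)
  show "\<exists>K. \<forall>a (b::'a). norm (a *\<^sub>C b) \<le> norm a * norm b * K"
    by (intro exI[of _ 1]) (simp add: norm_scaleC)
qed (simp_all add: scaleC_add_left scaleC_add_right)

interpretation scaleC: bounded_bilinear "scaleC :: complex \<Rightarrow> 'a::complex_hilbert \<Rightarrow> 'a"
  by (rule bounded_bilinear_scaleC)

lemmas cinner_simps = cinner_add_left cinner_add_right cinner_diff_left cinner_diff_right
  cinner_scaleC_left cinner_scaleC_right cinner.sum_left cinner.sum_right

section \<open>Closed complex subspaces and their suprema\<close>

lemma closed_csubspace_diff: "closed_csubspace S \<Longrightarrow> x \<in> S \<Longrightarrow> y \<in> S \<Longrightarrow> x - y \<in> S"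
  unfolding closed_csubspace_def by (metis add_uminus_conv_diff scaleC_minus1)

lemma closed_csubspace_scaleR: "closed_csubspace S \<Longrightarrow> x \<in> S \<Longrightarrow> r *\<^sub>R x \<in> S"
  unfolding closed_csubspace_def by (metis scaleC_of_real)

lemma closed_csubspace_Inter:
  "(\<And>S. S \<in> \<F> \<Longrightarrow> closed_csubspace S) \<Longrightarrow> closed_csubspace (\<Inter>\<F>)"
  by (auto simp: closed_csubspace_def intro!: closed_Inter)

lemma closed_csubspace_csup: "closed_csubspace (csup F)"
  unfolding csup_def by (rule closed_csubspace_Inter) blast

lemma csup_upper: "V \<in> F \<Longrightarrow> V \<subseteq> csup F"
  unfolding csup_def by blast

lemma csup_least: "closed_csubspace S \<Longrightarrow> (\<And>V. V \<in> F \<Longrightarrow> V \<subseteq> S) \<Longrightarrow> csup F \<subseteq> S"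
  unfolding csup_def by blast

lemma closed_csubspace_orth: "closed_csubspace (orth S)"
proof -
  have "orth S = (\<Inter>y\<in>S. {x. cinner y x = 0})" by (auto simp: orth_def)
  moreover have "closed {x. cinner y x = 0}" for y :: 'a
    by (intro closed_Collect_eq continuous_intros cinner.continuous_on)
  ultimately have "closed (orth S)" by (auto intro!: closed_INT)
  then show ?thesis by (auto simp: closed_csubspace_def orth_def cinner_simps)
qed

lemma closed_csubspace_ker:
  assumes "bounded_op A" shows "closed_csubspace {x. A x = 0}"
proof -
  interpret bounded_linear A using assms by (simp add: bounded_op_def)
  have "closed {x. A x = 0}"
    by (intro closed_Collect_eq linear_continuous_on bounded_linear_axioms continuous_on_const)
  then show ?thesis using assms by (auto simp: closed_csubspace_def bounded_op_def add zero)
qed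

section \<open>Orthogonal decomposition and the Riesz representation\<close>

lemma parallelogram_law:
  fixes x y :: "'a::real_inner"
  shows "(norm (x + y))\<^sup>2 + (norm (x - y))\<^sup>2 = 2 * (norm x)\<^sup>2 + 2 * (norm y)\<^sup>2"
  by (simp add: power2_norm_eq_inner inner_simps inner_commute)

text \<open>A minimizing sequence in \<open>S\<close> is Cauchy by the parallelogram law, because
  midpoints stay in \<open>S\<close>. Its limit is a nearest point, and minimality makes the
  residual orthogonal to \<open>S\<close>.\<close>

lemma orth_projection_exists:
  fixes S :: "'a::complex_hilbert set"
  assumes S: "closed_csubspace S"
  obtains y where "y \<in> S" "x - y \<in> orth S"
proof -
  define d where "d = Inf (norm ` (\<lambda>s. x - s) ` S)"
  have ne: "norm ` (\<lambda>s. x - s) ` S \<noteq> {}" using S by (auto simp: closed_csubspace_def)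
  have bdd: "bdd_below (norm ` (\<lambda>s. x - s) ` S)" by (intro bdd_belowI[of _ 0]) auto
  have d: "d \<le> norm (x - s)" if "s \<in> S" for s
    unfolding d_def using that bdd by (intro cInf_lower) auto
  have d0: "0 \<le> d" unfolding d_def using ne by (intro cInf_greatest) auto
  have "\<exists>s\<in>S. norm (x - s) < d + 1 / real (Suc n)" for n
    using cInf_lessD[OF ne, of "d + 1 / real (Suc n)"] unfolding d_def[symmetric] by auto
  then obtain s where s: "\<And>n. s n \<in> S" "\<And>n. norm (x - s n) < d + 1 / real (Suc n)" by metis
  have est: "(norm (u - v))\<^sup>2 \<le> 2 * (norm (x - u))\<^sup>2 + 2 * (norm (x - v))\<^sup>2 - 4 * d\<^sup>2"
    if "u \<in> S" "v \<in> S" for u v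
  proof -
    have "(1/2) *\<^sub>R (u + v) \<in> S" using S that by (intro closed_csubspace_scaleR) (auto simp: closed_csubspace_def)
    then have "d \<le> norm (x - (1/2) *\<^sub>R (u + v))" by (rule d)
    also have "x - (1/2) *\<^sub>R (u + v) = (1/2) *\<^sub>R ((x - u) + (x - v))"
      by (simp add: algebra_simps scaleR_2[symmetric])
    finally have "2 * d \<le> norm ((x - u) + (x - v))" by simp
    then have "(2 * d)\<^sup>2 \<le> (norm ((x - u) + (x - v)))\<^sup>2" using d0 by (intro power_mono) auto
    moreover have "norm (u - v) = norm ((x - u) - (x - v))" by (simp add: norm_minus_commute)
    ultimately show ?thesis using parallelogram_law[of "x - u" "x - v"]
      by (simp add: power_mult_distrib)
  qed
  have lim: "(\<lambda>n. norm (x - s n)) \<longlonglongrightarrow> d"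
  proof (rule tendsto_sandwich[of "\<lambda>_. d" _ _ "\<lambda>n. d + 1 / real (Suc n)"])
    show "(\<lambda>n. d + 1 / real (Suc n)) \<longlonglongrightarrow> d"
      using tendsto_add[OF tendsto_const[of d] LIMSEQ_inverse_real_of_nat]
      by (simp add: inverse_eq_divide)
  qed (use s d in \<open>auto intro!: always_eventually simp: less_imp_le\<close>)
  have "Cauchy s"
  proof (rule metric_CauchyI)
    fix e :: real assume e: "0 < e"
    have "(\<lambda>n. (norm (x - s n))\<^sup>2) \<longlonglongrightarrow> d\<^sup>2" by (intro tendsto_intros lim)
    then have "eventually (\<lambda>n. (norm (x - s n))\<^sup>2 < d\<^sup>2 + e\<^sup>2 / 4) sequentially"
      by (rule order_tendstoD) (use e in simp)
    then obtain N where N: "\<And>n. n \<ge> N \<Longrightarrow> (norm (x - s n))\<^sup>2 < d\<^sup>2 + e\<^sup>2 / 4"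
      by (auto simp: eventually_sequentially)
    have "dist (s m) (s n) < e" if "m \<ge> N" "n \<ge> N" for m n
    proof -
      have "(norm (s m - s n))\<^sup>2 < e\<^sup>2"
        using est[OF s(1)[of m] s(1)[of n]] N[OF that(1)] N[OF that(2)] by linarith
      then show ?thesis using e by (simp add: dist_norm power2_less_imp_less)
    qed
    then show "\<exists>M. \<forall>m\<ge>M. \<forall>n\<ge>M. dist (s m) (s n) < e" by blast
  qed
  then obtain y where y: "s \<longlonglongrightarrow> y" using Cauchy_convergent convergent_def by blast
  have yS: "y \<in> S" using S s(1) y unfolding closed_csubspace_def closed_sequential_limits by blast
  have ny: "norm (x - y) = d"
    by (rule LIMSEQ_unique[OF _ lim]) (intro tendsto_intros y)
  have "cinner u (x - y) = 0" if u: "u \<in> S" for u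
  proof (cases "u = 0")
    case False
    \<comment> \<open>The optimal step along \<open>u\<close>: it lowers the squared distance by the
      squared modulus of \<open>cinner u (x - y)\<close> over the squared norm of \<open>u\<close>,
      so minimality of \<open>y\<close> forces this to vanish.\<close>
    define c where "c = cinner u (x - y) / complex_of_real ((norm u)\<^sup>2)"
    have "y + c *\<^sub>C u \<in> S" using S yS u by (auto simp: closed_csubspace_def)
    then have "d\<^sup>2 \<le> (norm (x - (y + c *\<^sub>C u)))\<^sup>2" using d d0 by (intro power_mono) auto
    also have "(norm (x - (y + c *\<^sub>C u)))\<^sup>2 = d\<^sup>2 - (cmod (cinner u (x - y)))\<^sup>2 / (norm u)\<^sup>2"
    proof -
      define k where "k = cinner u (x - y)"
      have ck: "complex_of_real ((norm u)\<^sup>2) * c = k" using False by (simp add: c_def k_def)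
      have "complex_of_real ((norm (x - (y + c *\<^sub>C u)))\<^sup>2) =
          cinner ((x - y) - c *\<^sub>C u) ((x - y) - c *\<^sub>C u)"
        by (simp only: cinner_self diff_diff_eq)
      also have "\<dots> = complex_of_real (d\<^sup>2) - c * cnj k - cnj c * k + cnj c * (complex_of_real ((norm u)\<^sup>2) * c)"
        unfolding cinner_diff_left[of "x - y"] cinner_diff_right[of _ "x - y" "c *\<^sub>C u"]
          cinner_scaleC_left cinner_scaleC_right cinner_commute[of "x - y" u] k_def[symmetric]
        unfolding cinner_self ny by (simp add: algebra_simps)
      also have "\<dots> = complex_of_real (d\<^sup>2) - c * cnj k" unfolding ck by simp
      also have "c * cnj k = complex_of_real ((cmod k)\<^sup>2 / (norm u)\<^sup>2)"
        unfolding c_def k_def[symmetric] of_real_divide complex_norm_square by simp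
      finally show ?thesis unfolding k_def of_real_diff[symmetric] by (simp only: of_real_eq_iff)
    qed
    finally show ?thesis using False by (simp add: divide_le_0_iff)
  qed simp
  then have "x - y \<in> orth S" by (simp add: orth_def)
  with yS that show ?thesis by blast
qed

text \<open>For \<open>x\<close> in the double complement, the residual of its projection is
  orthogonal both to \<open>x\<close> and to the projection, hence to itself.\<close>

lemma orth_orth:
  assumes S: "closed_csubspace S" shows "orth (orth S) = S"
proof
  show "S \<subseteq> orth (orth S)"
    by (auto simp: orth_def) (metis cinner_commute complex_cnj_zero)
  show "orth (orth S) \<subseteq> S"
  proof
    fix x assume x: "x \<in> orth (orth S)"
    obtain y where y: "y \<in> S" "x - y \<in> orth S" using orth_projection_exists[OF S] by blast
    have "cinner (x - y) x = 0" using x y(2) by (auto simp: orth_def)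
    moreover have "cinner (x - y) y = 0"
      using y cinner_commute[of "x - y" y] by (auto simp: orth_def)
    ultimately have "cinner (x - y) (x - y) = 0" by (simp add: cinner_diff_right)
    then have "x - y = 0" by (simp only: cinner_self_eq_0)
    then show "x \<in> S" using y(1) by simp
  qed
qed

text \<open>A vector \<open>u\<close> orthogonal to the kernel represents \<open>f\<close> up to a
  scalar, because subtracting \<open>(f x / f u) *\<^sub>C u\<close> from \<open>x\<close> lands in
  the kernel.\<close>

lemma riesz_representation:
  fixes f :: "'a::complex_hilbert \<Rightarrow> complex"
  assumes f: "bounded_linear f" and fC: "\<And>c x. f (c *\<^sub>C x) = c * f x"
  obtains y where "\<And>x. f x = cinner y x"
proof -
  interpret bounded_linear f by (rule f)
  define S where "S = {x. f x = 0}"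
  have "closed S" unfolding S_def
    by (intro closed_Collect_eq linear_continuous_on f continuous_on_const)
  then have S: "closed_csubspace S"
    by (auto simp: closed_csubspace_def S_def add zero fC)
  show ?thesis
  proof (cases "\<forall>x. f x = 0")
    case True then show ?thesis using that[of 0] by simp
  next
    case False
    then obtain x0 where x0: "f x0 \<noteq> 0" by blast
    obtain y0 where y0: "y0 \<in> S" "x0 - y0 \<in> orth S" using orth_projection_exists[OF S] by blast
    define u where "u = x0 - y0"
    have fu: "f u \<noteq> 0" using x0 y0(1) by (simp add: u_def diff S_def)
    then have u0: "u \<noteq> 0" using zero by auto
    have uS: "cinner u s = 0" if "s \<in> S" for s
      using y0(2) that cinner_commute[of u s] by (auto simp: orth_def u_def)
    have "f x = cinner ((cnj (f u) / complex_of_real ((norm u)\<^sup>2)) *\<^sub>C u) x" for x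
    proof -
      have "x - (f x / f u) *\<^sub>C u \<in> S" using fu by (simp add: S_def diff fC)
      from uS[OF this] have "cinner u x = (f x / f u) * complex_of_real ((norm u)\<^sup>2)"
        by (simp add: cinner_simps cinner_self)
      then show ?thesis using fu u0 by (simp add: cinner_scaleC_left)
    qed
    then show ?thesis using that by blast
  qed
qed

section \<open>Bounded operators\<close>

lemma bounded_op_linear: "bounded_op A \<Longrightarrow> bounded_linear A"
  by (simp add: bounded_op_def)

lemma bounded_opI:
  assumes "\<And>x y. A (x + y) = A x + A y" "\<And>c x. A (c *\<^sub>C x) = c *\<^sub>C A x" "\<And>x. norm (A x) \<le> K * norm x"
  shows "bounded_op A"
  unfolding bounded_op_def
proof
  show "bounded_linear A"
    by (rule bounded_linear_intro[where K = K])
      (use assms in \<open>auto simp: scaleC_of_real[symmetric] mult.commute\<close>)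
qed (use assms in auto)

lemma bounded_op_norm_bound:
  assumes "bounded_op A" obtains K where "K > 0" "\<And>x. norm (A x) \<le> K * norm x"
  using bounded_linear.pos_bounded[OF bounded_op_linear[OF assms]] by (metis mult.commute)

lemma bounded_op_simps:
  assumes "bounded_op A"
  shows "A (x + y) = A x + A y" "A (x - y) = A x - A y" "A (c *\<^sub>C x) = c *\<^sub>C A x" "A 0 = 0" "A (- x) = - A x"
    "A (r *\<^sub>R x) = r *\<^sub>R A x" "A (sum g I) = (\<Sum>i\<in>I. A (g i))"
proof -
  interpret bounded_linear A using assms by (rule bounded_op_linear)
  show "A (x + y) = A x + A y" "A (x - y) = A x - A y" "A 0 = 0" "A (- x) = - A x"
    "A (r *\<^sub>R x) = r *\<^sub>R A x" "A (sum g I) = (\<Sum>i\<in>I. A (g i))"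
    by (rule add diff zero neg scaleR sum)+
qed (use assms in \<open>simp add: bounded_op_def\<close>)

lemma bounded_op_id [simp]: "bounded_op id"
  by (rule bounded_opI[where K = 1]) auto

lemma bounded_op_zero [simp]: "bounded_op (\<lambda>x. 0)"
  by (rule bounded_opI[where K = 1]) auto

lemma bounded_op_comp: 
  assumes "bounded_op A" "bounded_op B" shows "bounded_op (A \<circ> B)"
  using assms bounded_linear_compose[of A B] by (auto simp: bounded_op_def o_def)

lemma bounded_op_lincomb:
  assumes "bounded_op A" "bounded_op B" shows "bounded_op (\<lambda>x. a *\<^sub>C A x + b *\<^sub>C B x)"
  unfolding bounded_op_def
proof
  show "bounded_linear (\<lambda>x. a *\<^sub>C A x + b *\<^sub>C B x)"
    by (intro bounded_linear_add bounded_linear_compose[OF scaleC.bounded_linear_right] bounded_op_linear assms)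
qed (use assms in \<open>auto simp: bounded_op_simps scaleC_add_right scaleC_scaleC mult.commute\<close>)

lemma bounded_op_scaleC: "bounded_op A \<Longrightarrow> bounded_op (\<lambda>x. c *\<^sub>C A x)"
  using bounded_op_lincomb[of A A c 0] by simp

lemma bounded_op_add: "bounded_op A \<Longrightarrow> bounded_op B \<Longrightarrow> bounded_op (\<lambda>x. A x + B x)"
  using bounded_op_lincomb[of A B 1 1] by simp

lemma bounded_op_diff: "bounded_op A \<Longrightarrow> bounded_op B \<Longrightarrow> bounded_op (\<lambda>x. A x - B x)"
  using bounded_op_lincomb[of A B 1 "-1"] by (simp add: scaleC_minus1)

lemma bounded_op_sum: "(\<And>i. i \<in> I \<Longrightarrow> bounded_op (A i)) \<Longrightarrow> bounded_op (\<lambda>x. \<Sum>i\<in>I. A i x)"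
  by (induction I rule: infinite_finite_induct) (auto intro: bounded_op_add)

text \<open>Riesz representation of the functionals \<open>cinner y (A x)\<close> in
  \<open>x\<close> yields the adjoint pointwise. Uniqueness is shown as well, because
  \<open>adj\<close> is a definite description.\<close>

lemma adj_existence:
  fixes A :: "'a::complex_hilbert \<Rightarrow> 'a"
  assumes A: "bounded_op A"
  shows "bounded_op (adj A) \<and> (\<forall>x y. cinner (A x) y = cinner x (adj A y))"
proof -
  obtain K where K: "K > 0" "\<And>x. norm (A x) \<le> K * norm x" by (rule bounded_op_norm_bound[OF A]) blast
  have "\<exists>z. \<forall>x. cinner y (A x) = cinner z x" for y
  proof (rule riesz_representation[of "\<lambda>x. cinner y (A x)"])
    show "bounded_linear (\<lambda>x. cinner y (A x))"
      by (intro bounded_linear_compose[OF cinner.bounded_linear_right] bounded_op_linear A)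
  qed (auto simp: bounded_op_simps[OF A] cinner_scaleC_right)
  then obtain B where B: "\<And>x y. cinner y (A x) = cinner (B y) x" by metis
  have B': "cinner x (B y) = cinner (A x) y" for x y
    by (metis B cinner_commute)
  have "bounded_op B"
  proof (rule bounded_opI[where K = K])
    fix x y c
    show "B (x + y) = B x + B y" by (rule cinner_eqI) (simp add: cinner_simps B')
    show "B (c *\<^sub>C x) = c *\<^sub>C B x" by (rule cinner_eqI) (simp add: cinner_simps B')
    have "(norm (B x))\<^sup>2 = cmod (cinner (B x) (B x))" by (simp only: cinner_self norm_of_real abs_power2)
    also have "\<dots> = cmod (cinner (A (B x)) x)" by (simp add: B')
    also have "\<dots> \<le> norm (A (B x)) * norm x" by (rule cmod_cinner_le)
    also have "\<dots> \<le> (K * norm (B x)) * norm x" by (intro mult_right_mono K) auto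
    finally have "norm (B x) * norm (B x) \<le> norm (B x) * (K * norm x)"
      by (simp add: power2_eq_square algebra_simps)
    then show "norm (B x) \<le> K * norm x"
      using K(1) by (cases "norm (B x) = 0") auto
  qed
  then have "\<exists>!B. bounded_op B \<and> (\<forall>x y. cinner (A x) y = cinner x (B y))"
  proof (intro ex1I[of _ B] conjI)
    fix C assume "bounded_op C \<and> (\<forall>x y. cinner (A x) y = cinner x (C y))"
    then show "C = B" by (intro ext cinner_eqI) (simp add: B')
  qed (auto simp: B')
  from theI'[OF this] show ?thesis unfolding adj_def .
qed

lemma bounded_op_adj: "bounded_op A \<Longrightarrow> bounded_op (adj A)"
  using adj_existence by blast

lemma cinner_adj_right: "bounded_op A \<Longrightarrow> cinner x (adj A y) = cinner (A x) y"
  using adj_existence by metis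

lemma cinner_adj_left: "bounded_op A \<Longrightarrow> cinner (adj A x) y = cinner x (A y)"
  using cinner_adj_right[of A y x] by (metis cinner_commute)

lemma adj_eqI:
  assumes "bounded_op A" "\<And>x y. cinner (A x) y = cinner x (B y)" shows "adj A = B"
  by (intro ext cinner_eqI) (simp add: cinner_adj_right[OF assms(1)] assms(2))

lemma adj_adj: "bounded_op A \<Longrightarrow> adj (adj A) = A"
  by (rule adj_eqI) (auto simp: bounded_op_adj cinner_adj_left)

lemma adj_comp: "bounded_op A \<Longrightarrow> bounded_op B \<Longrightarrow> adj (A \<circ> B) = adj B \<circ> adj A"
  by (rule adj_eqI) (auto simp: bounded_op_comp cinner_adj_right)

lemma norm_adj_le:
  assumes A: "bounded_op A" and K: "\<And>x. norm (A x) \<le> K * norm x" "K \<ge> 0"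
  shows "norm (adj A x) \<le> K * norm x"
proof -
  have "(norm (adj A x))\<^sup>2 = cmod (cinner (adj A x) (adj A x))" by (simp only: cinner_self norm_of_real abs_power2)
  also have "\<dots> = cmod (cinner (A (adj A x)) x)" by (simp add: cinner_adj_right A)
  also have "\<dots> \<le> norm (A (adj A x)) * norm x" by (rule cmod_cinner_le)
  also have "\<dots> \<le> (K * norm (adj A x)) * norm x" by (intro mult_right_mono K) auto
  finally have "norm (adj A x) * norm (adj A x) \<le> norm (adj A x) * (K * norm x)"
    by (simp add: power2_eq_square algebra_simps)
  then show ?thesis
    using K(2) by (cases "norm (adj A x) = 0") auto
qed

section \<open>Positive operators and the Cauchy-Schwarz inequality for their forms\<close>

lemma nonneg_Reals_complex_iff: "z \<in> \<real>\<^sub>\<ge>\<^sub>0 \<longleftrightarrow> Re z \<ge> 0 \<and> Im z = 0"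
  by (auto simp: complex_nonneg_Reals_iff)

text \<open>Cauchy-Schwarz for a positive semidefinite sesquilinear form on a pair of vectors: \<open>a\<close>, \<open>b\<close> are
  the diagonal and \<open>c\<close>, \<open>d\<close> the off-diagonal values.\<close>

lemma psd_form_cauchy_schwarz:
  fixes a b c d :: complex
  assumes pos: "\<And>l. a + l * c + cnj l * d + l * cnj l * b \<in> \<real>\<^sub>\<ge>\<^sub>0" and a: "a \<in> \<real>\<^sub>\<ge>\<^sub>0" and b: "b \<in> \<real>\<^sub>\<ge>\<^sub>0"
  shows "d = cnj c" "(cmod c)\<^sup>2 \<le> Re a * Re b"
proof -
  have i: "Im a = 0" "Im b = 0" and r: "Re a \<ge> 0" "Re b \<ge> 0" using a b by (auto simp: nonneg_Reals_complex_iff)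
  show d: "d = cnj c"
    \<comment> \<open>Reality of the form at \<open>1\<close> determines the imaginary part of
      \<open>d\<close>, and at \<open>\<i>\<close> its real part.\<close>
    using pos[of 1] pos[of \<i>] i by (auto simp: nonneg_Reals_complex_iff complex_eq_iff)
  \<comment> \<open>The choice \<open>l = - t * cnj c\<close> leaves a real quadratic in
    \<open>t\<close> that is nonnegative everywhere.\<close>
  have *: "0 \<le> Re a - 2 * t * (cmod c)\<^sup>2 + t\<^sup>2 * (cmod c)\<^sup>2 * Re b" for t :: real
  proof -
    define l where "l = - complex_of_real t * cnj c"
    have "a + l * c + cnj l * d + l * cnj l * b =
      a - complex_of_real (2 * t * (cmod c)\<^sup>2) + complex_of_real (t\<^sup>2 * (cmod c)\<^sup>2) * b"
      unfolding of_real_mult[of "2 * t"] of_real_mult[of "t\<^sup>2"] complex_norm_square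
      by (simp add: l_def d power2_eq_square algebra_simps)
    moreover have "Re (a - complex_of_real (2 * t * (cmod c)\<^sup>2) + complex_of_real (t\<^sup>2 * (cmod c)\<^sup>2) * b) =
      Re a - 2 * t * (cmod c)\<^sup>2 + t\<^sup>2 * (cmod c)\<^sup>2 * Re b" by simp
    ultimately show ?thesis using pos[of l] unfolding nonneg_Reals_complex_iff by metis
  qed
  show "(cmod c)\<^sup>2 \<le> Re a * Re b"
  proof (cases "c = 0")
    case False
    then have c: "(cmod c)\<^sup>2 > 0" by simp
    show ?thesis
    proof (cases "Re b = 0")
      case True
      \<comment> \<open>Here the quadratic is affine, and this \<open>t\<close> would give it the
        value \<open>-1\<close>.\<close>
      show ?thesis using *[of "(Re a + 1) / (2 * (cmod c)\<^sup>2)"] c True by (simp add: field_simps)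
    next
      case nz: False
      then have "Re b > 0" using r by simp
      \<comment> \<open>The point \<open>1 / Re b\<close> minimizes the quadratic.\<close>
      have "0 \<le> Re a - 2 * (1 / Re b) * (cmod c)\<^sup>2 + (1 / Re b)\<^sup>2 * (cmod c)\<^sup>2 * Re b" by (rule *)
      also have "\<dots> = Re a - (cmod c)\<^sup>2 / Re b" using nz by (simp add: field_simps power2_eq_square)
      finally show ?thesis using \<open>Re b > 0\<close> by (simp add: field_simps)
    qed
  qed (use r in simp)
qed

lemma positive_op_bounded: "positive_op A \<Longrightarrow> bounded_op A"
  by (simp add: positive_op_def)

text \<open>Expanding the form at \<open>x + l *\<^sub>C y\<close> gives an instance of
  \<open>psd_form_cauchy_schwarz\<close>.\<close>

lemma positive_op_form:
  assumes "positive_op A"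
  shows "cinner y (A x) = cnj (cinner x (A y))"
    "(cmod (cinner x (A y)))\<^sup>2 \<le> Re (cinner x (A x)) * Re (cinner y (A y))"
proof -
  have A: "bounded_op A" using assms by (rule positive_op_bounded)
  have "cinner x (A x) + l * cinner x (A y) + cnj l * cinner y (A x) + l * cnj l * cinner y (A y) =
      cinner (x + l *\<^sub>C y) (A (x + l *\<^sub>C y))" for l
    by (simp add: bounded_op_simps[OF A] cinner_simps algebra_simps)
  then have "cinner x (A x) + l * cinner x (A y) + cnj l * cinner y (A x) + l * cnj l * cinner y (A y) \<in> \<real>\<^sub>\<ge>\<^sub>0" for l
    using assms by (simp add: positive_op_def)
  from psd_form_cauchy_schwarz[OF this]
  show "cinner y (A x) = cnj (cinner x (A y))"
    "(cmod (cinner x (A y)))\<^sup>2 \<le> Re (cinner x (A x)) * Re (cinner y (A y))"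
    using assms by (auto simp: positive_op_def)
qed

lemma positive_op_cinner_real: "positive_op A \<Longrightarrow> cinner x (A x) = complex_of_real (Re (cinner x (A x)))"
  by (auto simp: positive_op_def nonneg_Reals_complex_iff complex_eq_iff)

lemma positive_op_Re_nonneg: "positive_op A \<Longrightarrow> 0 \<le> Re (cinner x (A x))"
  by (auto simp: positive_op_def nonneg_Reals_complex_iff)

lemma positive_op_symmetric: "positive_op A \<Longrightarrow> cinner (A x) y = cinner x (A y)"
  by (metis cinner_commute positive_op_form(1))

lemma positive_op_adj: "positive_op A \<Longrightarrow> adj A = A"
  by (rule adj_eqI) (auto simp: positive_op_symmetric positive_op_bounded)

text \<open>Cauchy-Schwarz against \<open>A x\<close> itself bounds the fourth power of the norm of
  \<open>A x\<close> by a product with a zero factor.\<close>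

lemma positive_op_kernel:
  assumes "positive_op A" "Re (cinner x (A x)) = 0" shows "A x = 0"
proof -
  have "(cmod (cinner (A x) (A x)))\<^sup>2 \<le> Re (cinner (A x) (A (A x))) * Re (cinner x (A x))"
    by (rule positive_op_form(2)[OF assms(1)])
  then show ?thesis using assms(2) by simp
qed

text \<open>Cauchy-Schwarz against \<open>A x\<close>, with both diagonal values bounded through
  \<open>K\<close>, leaves a common factor of the squared norm of \<open>A x\<close> to
  cancel.\<close>

lemma positive_op_norm_le:
  assumes "positive_op A" and le: "\<And>x. Re (cinner x (A x)) \<le> K * (norm x)\<^sup>2" 
  shows "norm (A x) \<le> K * norm x"
proof (cases "A x = 0")
  case True
  have "0 \<le> K * (norm x)\<^sup>2" using le[of x] positive_op_Re_nonneg[OF assms(1), of x] by simp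
  then show ?thesis using True by (cases "x = 0") (auto simp: zero_le_mult_iff)
next
  case False
  have "(cmod (cinner (A x) (A x)))\<^sup>2 \<le> Re (cinner (A x) (A (A x))) * Re (cinner x (A x))"
    by (rule positive_op_form(2)[OF assms(1)])
  also have "\<dots> \<le> (K * (norm (A x))\<^sup>2) * (K * (norm x)\<^sup>2)"
    by (intro mult_mono le positive_op_Re_nonneg[OF assms(1)])
       (use order_trans[OF positive_op_Re_nonneg[OF assms(1)] le] in auto)
  finally have "(norm (A x))\<^sup>2 * (norm (A x))\<^sup>2 \<le> (norm (A x))\<^sup>2 * (K * norm x)\<^sup>2"
    unfolding cinner_self norm_of_real abs_power2 by (simp add: power2_eq_square algebra_simps)
  then have "(norm (A x))\<^sup>2 \<le> (K * norm x)\<^sup>2" using False by (simp only: mult_le_cancel_left) simp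
  moreover have "0 \<le> K"
  proof -
    have "x \<noteq> 0" using False bounded_op_simps(4)[OF positive_op_bounded[OF assms(1)]] by auto
    moreover have "0 \<le> K * (norm x)\<^sup>2" using le[of x] positive_op_Re_nonneg[OF assms(1), of x] by simp
    ultimately show ?thesis by (simp add: zero_le_mult_iff)
  qed
  ultimately show ?thesis by (simp add: power2_le_iff_abs_le)
qed

lemma cinner_adj_comp: "bounded_op A \<Longrightarrow> cinner x ((adj A \<circ> A) x) = complex_of_real ((norm (A x))\<^sup>2)"
  by (simp add: cinner_adj_right cinner_self)

lemma positive_op_adj_comp: "bounded_op A \<Longrightarrow> positive_op (adj A \<circ> A)"
  unfolding positive_op_def
  by (auto simp: bounded_op_comp bounded_op_adj cinner_adj_comp simp del: comp_apply of_real_power)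

lemma positive_op_add: "positive_op A \<Longrightarrow> positive_op B \<Longrightarrow> positive_op (\<lambda>x. A x + B x)"
  by (auto simp: positive_op_def bounded_op_add cinner_simps nonneg_Reals_add_I)

lemma positive_op_sum: "(\<And>i. i \<in> I \<Longrightarrow> positive_op (A i)) \<Longrightarrow> positive_op (\<lambda>x. \<Sum>i\<in>I. A i x)"
proof (induction I rule: infinite_finite_induct)
qed (auto simp: positive_op_add, auto simp: positive_op_def)

section \<open>Projections and operators of rank one\<close>

lemma projection_iff:
  "projection p \<longleftrightarrow> bounded_op p \<and> (\<forall>x. p (p x) = p x) \<and> (\<forall>x y. cinner (p x) y = cinner x (p y))"
proof
  assume p: "projection p"
  then have b: "bounded_op p" "adj p = p" "p (p x) = p x" for x
    by (auto simp: projection_def fun_eq_iff)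
  then show "bounded_op p \<and> (\<forall>x. p (p x) = p x) \<and> (\<forall>x y. cinner (p x) y = cinner x (p y))"
    using cinner_adj_right[OF b(1)] by simp
next
  assume "bounded_op p \<and> (\<forall>x. p (p x) = p x) \<and> (\<forall>x y. cinner (p x) y = cinner x (p y))"
  moreover from this have "adj p = p" by (intro adj_eqI) auto
  ultimately show "projection p" by (auto simp: projection_def fun_eq_iff)
qed

lemma projection_cinner: "projection p \<Longrightarrow> cinner x (p x) = complex_of_real ((norm (p x))\<^sup>2)"
  unfolding projection_iff cinner_self[symmetric] by metis

lemma positive_op_projection: "projection p \<Longrightarrow> positive_op p"
  by (auto simp: positive_op_def projection_cinner nonneg_Reals_complex_iff projection_iff)

lemma positive_op_projection_compl:
  assumes "projection p" shows "positive_op (\<lambda>x. x - p x)"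
proof -
  have b: "bounded_op (\<lambda>x. x - p x)" using assms bounded_op_diff[OF bounded_op_id, of p] by (simp add: projection_iff)
  have "cinner x (x - p x) = cinner (x - p x) (x - p x)" for x
    using assms by (simp add: projection_iff cinner_simps) 
  then show ?thesis using b by (simp add: positive_op_def cinner_self nonneg_Reals_complex_iff del: of_real_power)
qed

text \<open>The decomposition into a vector of \<open>S\<close> and one orthogonal to
  \<open>S\<close> is unique, so linearity and idempotence follow by exhibiting a decomposition of
  the required form.\<close>

lemma projection_onto_exists:
  fixes S :: "'a::complex_hilbert set"
  assumes S: "closed_csubspace S"
  obtains p where "projection p" "range p = S" "\<And>x. p x = x \<longleftrightarrow> x \<in> S" "\<And>x. p x = 0 \<longleftrightarrow> x \<in> orth S"
proof -
  have "\<exists>y. y \<in> S \<and> x - y \<in> orth S" for x using orth_projection_exists[OF S] by metis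
  then obtain p where p: "\<And>x. p x \<in> S" "\<And>x. x - p x \<in> orth S" by metis
  have uniq: "p x = y" if "y \<in> S" "x - y \<in> orth S" for x y
  proof -
    have 1: "p x - y \<in> S" using S p that by (intro closed_csubspace_diff) auto
    have "(x - y) - (x - p x) \<in> orth S"
      by (rule closed_csubspace_diff[OF closed_csubspace_orth that(2) p(2)])
    then have "cinner (p x - y) (p x - y) = 0" using 1 by (simp add: orth_def)
    then show ?thesis by (simp only: cinner_self_eq_0) simp
  qed
  have sub: "closed_csubspace (orth S)" by (rule closed_csubspace_orth)
  have b: "bounded_op p"
  proof (rule bounded_opI[where K = 1])
    fix x y c
    show "p (x + y) = p x + p y"
    proof (rule uniq)
      have "(x - p x) + (y - p y) \<in> orth S" using sub p by (auto simp: closed_csubspace_def)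
      then show "x + y - (p x + p y) \<in> orth S" by (simp add: algebra_simps)
    qed (use S p in \<open>auto simp: closed_csubspace_def\<close>)
    show "p (c *\<^sub>C x) = c *\<^sub>C p x"
      by (rule uniq) (use S sub p in \<open>auto simp: closed_csubspace_def scaleC_diff_right[symmetric]\<close>)
    have "cinner (p x) (x - p x) = 0" using p by (auto simp: orth_def)
    then have "complex_of_real ((norm (p x))\<^sup>2) = cinner (p x) x" by (simp add: cinner_simps cinner_self)
    then have "(norm (p x))\<^sup>2 = cmod (cinner (p x) x)" by (metis abs_power2 norm_of_real)
    also have "\<dots> \<le> norm (p x) * norm x" by (rule cmod_cinner_le)
    finally show "norm (p x) \<le> 1 * norm x" by (cases "norm (p x) = 0") (auto simp: power2_eq_square)
  qed
  have idem: "p x = x" if "x \<in> S" for x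
    by (rule uniq) (use that sub in \<open>auto simp: closed_csubspace_def\<close>)
  have "cinner (p x) y = cinner x (p y)" for x y
  proof -
    have "cinner (p x) (y - p y) = 0" using p by (auto simp: orth_def)
    moreover have "cinner (p y) (x - p x) = 0" using p by (auto simp: orth_def)
    then have "cinner (x - p x) (p y) = 0" using cinner_commute[of "x - p x" "p y"] by simp
    ultimately show ?thesis by (simp add: cinner_simps)
  qed
  then have "projection p" using b p idem by (auto simp: projection_iff)
  moreover have "range p = S" using p idem by (auto simp: image_iff) metis
  moreover have "p x = x \<longleftrightarrow> x \<in> S" for x using p idem by metis
  moreover have "p x = 0 \<longleftrightarrow> x \<in> orth S" for x
    using p(2)[of x] uniq[of 0 x] S by (auto simp: closed_csubspace_def)
  ultimately show ?thesis using that by blast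
qed

text \<open>Dirac's ket-bra of \<open>y\<close> and \<open>x\<close>: the first argument spans the
  range, the second is paired with the input.\<close>

definition rank1 :: "'a::complex_hilbert \<Rightarrow> 'a \<Rightarrow> 'a \<Rightarrow> 'a" where
  "rank1 y x = (\<lambda>u. cinner x u *\<^sub>C y)"

lemma norm_rank1_le: "norm (rank1 y x u) \<le> (norm y * norm x) * norm u"
  using mult_right_mono[OF cmod_cinner_le[of x u], of "norm y"]
  by (simp add: rank1_def norm_scaleC mult_ac)

lemma bounded_op_rank1 [simp]: "bounded_op (rank1 y x)"
  by (rule bounded_opI[OF _ _ norm_rank1_le])
    (auto simp: rank1_def cinner_simps scaleC_add_left scaleC_scaleC)

lemma cinner_rank1: "cinner u (rank1 y x v) = cinner x v * cinner u y"
  by (simp add: rank1_def cinner_simps)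

lemma cinner_rank1_self: "cinner u (rank1 y y u) = complex_of_real ((cmod (cinner y u))\<^sup>2)"
  unfolding cinner_rank1 complex_norm_square cinner_commute[of u y] by (rule refl)

lemma positive_op_rank1: "positive_op (rank1 y y)"
  by (auto simp: positive_op_def cinner_rank1_self nonneg_Reals_complex_iff)

lemma rank1_comp_left: "bounded_op A \<Longrightarrow> A \<circ> rank1 y x = rank1 (A y) x"
  by (auto simp: rank1_def bounded_op_simps fun_eq_iff)

instance complex_hilbert \<subseteq> banach ..

section \<open>Orthonormal bases\<close>

text \<open>The density argument behind the extensions below: once the vectors with a given property
  form a closed subspace containing a total set, nothing nonzero is orthogonal to them.\<close>

lemma total_subset_UNIV:
  assumes total: "\<And>x. (\<And>d. d \<in> D \<Longrightarrow> cinner d x = 0) \<Longrightarrow> x = 0"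
    and S: "closed_csubspace S" "D \<subseteq> S"
  shows "S = UNIV"
proof -
  have "orth S = {0}"
    using total S(2) by (auto simp: orth_def subset_iff)
  then have "orth (orth S) = UNIV" by (auto simp: orth_def)
  then show ?thesis using orth_orth[OF S(1)] by simp
qed

definition orthonormal :: "'a::complex_hilbert set \<Rightarrow> bool" where
  "orthonormal E \<longleftrightarrow> (\<forall>e\<in>E. \<forall>f\<in>E. cinner e f = (if e = f then 1 else 0))"

lemma orthonormal_onb: "is_onb E \<Longrightarrow> orthonormal E"
  by (simp add: is_onb_def orthonormal_def)

lemma orthonormal_subset: "orthonormal E \<Longrightarrow> F \<subseteq> E \<Longrightarrow> orthonormal F"
  unfolding orthonormal_def by (meson subset_iff)

text \<open>A maximal orthonormal set is a basis, since a nonzero vector orthogonal to it could be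
  normalized and added. Existence gives meaning to the basis chosen inside
  \<open>trace_op\<close>.\<close>

lemma onb_exists: "\<exists>E :: 'a::complex_hilbert set. is_onb E"
proof -
  have "\<exists>M\<in>{E :: 'a set. orthonormal E}. \<forall>X\<in>{E. orthonormal E}. M \<subseteq> X \<longrightarrow> X = M"
  proof (rule subset_Zorn_nonempty)
    show "{E :: 'a set. orthonormal E} \<noteq> {}" by (auto simp: orthonormal_def)
    fix \<C> assume C: "\<C> \<noteq> {}" "subset.chain {E :: 'a set. orthonormal E} \<C>"
    have "cinner e f = (if e = f then 1 else 0)" if ef: "e \<in> \<Union>\<C>" "f \<in> \<Union>\<C>" for e f
    proof -
      obtain A B where AB: "A \<in> \<C>" "B \<in> \<C>" "e \<in> A" "f \<in> B" using ef by blast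
      then have "A \<subseteq> B \<or> B \<subseteq> A" using C(2) by (auto simp: subset.chain_def)
      moreover have "orthonormal A" "orthonormal B" using AB C(2) by (auto simp: subset.chain_def)
      ultimately show ?thesis using AB by (auto simp: orthonormal_def)
    qed
    then show "\<Union>\<C> \<in> {E. orthonormal E}" by (auto simp: orthonormal_def)
  qed
  then obtain M :: "'a set" where M: "orthonormal M" "\<And>X. orthonormal X \<Longrightarrow> M \<subseteq> X \<Longrightarrow> X = M" by blast
  have "x = 0" if x: "\<forall>e\<in>M. cinner e x = 0" for x
  proof (rule ccontr)
    assume x0: "x \<noteq> 0"
    define u where "u = complex_of_real (1 / norm x) *\<^sub>C x"
    have "cinner u u = complex_of_real ((norm u)\<^sup>2)" by (rule cinner_self)
    also have "norm u = 1" using x0 by (simp add: u_def norm_scaleC norm_divide)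
    finally have uu: "cinner u u = 1" by simp
    have eu: "cinner e u = 0" "cinner u e = 0" if "e \<in> M" for e
      using x that cinner_commute[of x e] by (auto simp: u_def cinner_simps)
    have "orthonormal (insert u M)" using M(1) uu eu by (auto simp: orthonormal_def)
    then have "insert u M = M" using M(2) by blast
    then show False using eu(1)[of u] uu by auto
  qed
  then have "is_onb M" using M(1) unfolding is_onb_def orthonormal_def by blast
  then show ?thesis by blast
qed

text \<open>The very basis over which \<open>trace_op\<close> sums.\<close>

definition onb0 :: "'a::complex_hilbert set" where
  "onb0 = (SOME E. is_onb E)"

lemma is_onb_onb0: "is_onb (onb0 :: 'a::complex_hilbert set)"
  unfolding onb0_def by (rule someI_ex) (rule onb_exists)

text \<open>For a finite orthonormal \<open>F\<close> this is the projection onto its span; for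
  infinite \<open>F\<close> the sum is \<open>0\<close> by convention.\<close>

definition fproj :: "'a::complex_hilbert set \<Rightarrow> 'a \<Rightarrow> 'a" where
  "fproj F = (\<lambda>x. \<Sum>e\<in>F. rank1 e e x)"

lemma bounded_op_fproj [simp]: "bounded_op (fproj F)"
  unfolding fproj_def by (rule bounded_op_sum) simp

lemma positive_op_fproj: "positive_op (fproj F)"
  unfolding fproj_def by (rule positive_op_sum) (rule positive_op_rank1)

lemma fproj_idem:
  assumes "finite F" "orthonormal F" shows "fproj F (fproj F x) = fproj F x"
proof -
  have "rank1 e e (fproj F x) = rank1 e e x" if "e \<in> F" for e
  proof -
    have "cinner e (fproj F x) = (\<Sum>f\<in>F. if f = e then cinner e x else 0)"
      unfolding fproj_def cinner.sum_right cinner_rank1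
      using assms(2) that by (intro sum.cong) (auto simp: orthonormal_def)
    also have "\<dots> = cinner e x" using assms(1) that by simp
    finally show ?thesis by (simp add: rank1_def)
  qed
  then show ?thesis by (simp add: fproj_def)
qed

lemma fproj_in: "finite F \<Longrightarrow> orthonormal F \<Longrightarrow> e \<in> F \<Longrightarrow> fproj F e = e"
proof -
  assume F: "finite F" "orthonormal F" "e \<in> F"
  have "fproj F e = (\<Sum>f\<in>F. if f = e then e else 0)"
    unfolding fproj_def rank1_def using F by (intro sum.cong) (auto simp: orthonormal_def)
  then show ?thesis using F by simp
qed

lemma fproj_notin: "orthonormal E \<Longrightarrow> F \<subseteq> E \<Longrightarrow> e \<in> E \<Longrightarrow> e \<notin> F \<Longrightarrow> fproj F e = 0"
  unfolding fproj_def rank1_def by (intro sum.neutral) (auto simp: orthonormal_def subset_iff)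

lemma projection_fproj: "finite F \<Longrightarrow> orthonormal F \<Longrightarrow> projection (fproj F)"
  unfolding projection_iff
  using positive_op_symmetric[OF positive_op_fproj[of F]] by (simp add: fproj_idem)

lemma norm_projection_le:
  assumes "projection p" shows "norm (p x) \<le> norm x"
proof -
  have "0 \<le> Re (cinner x (x - p x))"
    by (rule positive_op_Re_nonneg[OF positive_op_projection_compl[OF assms]])
  then have "(norm (p x))\<^sup>2 \<le> (norm x)\<^sup>2"
    unfolding cinner_diff_right projection_cinner[OF assms] cinner_self by simp
  then show ?thesis by simp
qed

text \<open>The vectors with a convergent expansion form a closed subspace, because the partial sums
  are projections and hence uniformly contractive; this subspace contains \<open>E\<close>.\<close>

lemma onb_expansion:
  assumes E: "is_onb E" shows "((\<lambda>e. rank1 e e x) has_sum x) E"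
proof -
  define S where "S = {x. ((\<lambda>e. rank1 e e x) has_sum x) E}"
  have on: "orthonormal E" using E by (rule orthonormal_onb)
  have sum_eq: "sum (\<lambda>e. rank1 e e x) F = fproj F x" for x F by (simp add: fproj_def)
  have S_iff: "x \<in> S \<longleftrightarrow> ((\<lambda>F. fproj F x) \<longlongrightarrow> x) (finite_subsets_at_top E)" for x
    unfolding S_def has_sum_def sum_eq by simp
  have le: "norm (fproj F x) \<le> norm x" if "finite F" "F \<subseteq> E" for F x
    by (intro norm_projection_le projection_fproj orthonormal_subset[OF on] that)
  have "closed S"
    unfolding closed_sequential_limits
  proof (intro allI impI, elim conjE)
    fix s x assume s: "\<forall>n. s n \<in> S" and lim: "s \<longlonglongrightarrow> x"
    show "x \<in> S" unfolding S_iff tendsto_iff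
    proof (intro allI impI)
      fix r :: real assume r: "0 < r"
      obtain n where n: "dist (s n) x < r / 3"
        using metric_LIMSEQ_D[OF lim, of "r / 3"] r by auto
      have "eventually (\<lambda>F. dist (fproj F (s n)) (s n) < r / 3) (finite_subsets_at_top E)"
        using s r unfolding S_iff tendsto_iff by (metis divide_pos_pos zero_less_numeral)
      then show "eventually (\<lambda>F. dist (fproj F x) x < r) (finite_subsets_at_top E)"
        using eventually_finite_subsets_at_top_weakI[of E "\<lambda>F. finite F \<and> F \<subseteq> E", simplified]
      proof eventually_elim
        case (elim F)
        have "norm (fproj F (x - s n)) \<le> norm (x - s n)" using le elim by blast
        then have "dist (fproj F x) (fproj F (s n)) < r / 3"
          using n by (simp add: dist_norm bounded_op_simps[OF bounded_op_fproj] norm_minus_commute)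
        then have "dist (fproj F x) (s n) < 2 * r / 3" using elim dist_triangle[of "fproj F x" "s n" "fproj F (s n)"] by simp
        then show ?case using n dist_triangle[of "fproj F x" x "s n"] by simp
      qed
    qed
  qed
  moreover have "c *\<^sub>C x \<in> S" if "x \<in> S" for c x
    using that unfolding S_iff by (auto simp: bounded_op_simps intro!: scaleC.tendsto)
  ultimately have "closed_csubspace S"
    by (auto simp: closed_csubspace_def S_iff bounded_op_simps tendsto_add)
  moreover have "E \<subseteq> S"
  proof
    fix e assume e: "e \<in> E"
    have "((\<lambda>F. fproj F e) \<longlongrightarrow> e) (finite_subsets_at_top E)"
    proof (rule tendsto_eventually)
      show "\<forall>\<^sub>F F in finite_subsets_at_top E. fproj F e = e"
        unfolding eventually_finite_subsets_at_top
        by (rule exI[of _ "{e}"]) (use e fproj_in orthonormal_subset[OF on] in auto)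
    qed
    then show "e \<in> S" by (simp add: S_iff)
  qed
  ultimately have "S = UNIV"
    by (intro total_subset_UNIV[of E]) (use E in \<open>auto simp: is_onb_def\<close>)
  then show ?thesis by (auto simp: S_def)
qed

lemma fproj_tendsto:
  assumes "is_onb E" shows "((\<lambda>F. fproj F x) \<longlongrightarrow> x) (finite_subsets_at_top E)"
  using onb_expansion[OF assms, of x] unfolding has_sum_def fproj_def by simp

lemma parseval:
  assumes E: "is_onb E"
  shows "((\<lambda>e. cinner x e * cinner e y) has_sum cinner x y) E"
  using has_sum_bounded_linear[OF cinner.bounded_linear_right onb_expansion[OF E, of y], of x]
  by (simp add: cinner_rank1 mult.commute)

lemma parseval_norm:
  assumes E: "is_onb E"
  shows "((\<lambda>e. (cmod (cinner e x))\<^sup>2) has_sum (norm x)\<^sup>2) E"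
proof -
  have "((\<lambda>e. Re (cinner x e * cinner e x)) has_sum Re (cinner x x)) E"
    by (rule has_sum_Re[OF parseval[OF E]])
  moreover have "cinner x e * cinner e x = complex_of_real ((cmod (cinner e x))\<^sup>2)" for e
    unfolding cinner_commute[of x e] complex_norm_square by (rule mult.commute)
  ultimately show ?thesis by (simp add: cinner_self)
qed

section \<open>Square roots of positive operators\<close>

text \<open>The Taylor coefficients of the square root of \<open>1 - x\<close> at
  \<open>0\<close>.\<close>

definition sqrt_coeff :: "nat \<Rightarrow> real" where
  "sqrt_coeff k = (- 1) ^ k * ((1 / 2) gchoose k)"

lemma sqrt_coeff_0 [simp]: "sqrt_coeff 0 = 1"
  by (simp add: sqrt_coeff_def)

lemma sqrt_coeff_nonpos: "k > 0 \<Longrightarrow> sqrt_coeff k \<le> 0"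
proof -
  assume "k > 0"
  then obtain j where k: "k = Suc j" by (cases k) auto
  have "sqrt_coeff k = pochhammer (- (1 / 2)) k / fact k"
    by (simp add: sqrt_coeff_def gbinomial_pochhammer flip: power_mult_distrib mult.assoc)
  also have "pochhammer (- (1 / 2) :: real) k = - (1 / 2) * pochhammer (1 / 2) j"
    by (simp add: k pochhammer_rec)
  finally show ?thesis
    using pochhammer_nonneg[of "1 / 2 :: real" j] by simp
qed

text \<open>Only the coefficient of index \<open>0\<close> is positive, so the absolute sums are
  \<open>2\<close> minus the partial sums. The latter are
  \<open>pochhammer (1 / 2) m / fact m\<close>, which is nonnegative. Thus the series converges
  absolutely at the boundary of its disc.\<close>

lemma sqrt_coeff_summable: "summable (\<lambda>k. \<bar>sqrt_coeff k\<bar>)"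
proof (rule summableI_nonneg_bounded)
  fix n
  have s: "(\<Sum>k\<le>m. sqrt_coeff k) \<ge> 0" for m
  proof -
    have "(\<Sum>k\<le>m. sqrt_coeff k) = (- 1) ^ m * ((1 / 2 - 1) gchoose m)"
      using gbinomial_sum_lower_neg[of "1 / 2 :: real" m] by (simp add: sqrt_coeff_def mult.commute)
    also have "\<dots> = pochhammer (1 / 2) m / fact m"
      by (simp add: gbinomial_pochhammer flip: power_mult_distrib mult.assoc)
    also have "\<dots> \<ge> 0" using pochhammer_nonneg[of "1 / 2 :: real" m] by simp
    finally show ?thesis .
  qed
  have "(\<Sum>k\<le>m. \<bar>sqrt_coeff k\<bar>) = 2 - (\<Sum>k\<le>m. sqrt_coeff k)" for m
    by (induction m) (use sqrt_coeff_nonpos[of "Suc _"] in auto)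
  then have "(\<Sum>k\<le>m. \<bar>sqrt_coeff k\<bar>) \<le> 2" for m using s[of m] by simp
  moreover have "(\<Sum>k<n. \<bar>sqrt_coeff k\<bar>) \<le> (\<Sum>k\<le>n. \<bar>sqrt_coeff k\<bar>)" by (rule sum_mono2) auto
  ultimately show "(\<Sum>k<n. \<bar>sqrt_coeff k\<bar>) \<le> 2" using order_trans by blast
qed simp

text \<open>Vandermonde's identity produces the coefficients of \<open>1 - x\<close>, the square of
  the series.\<close>

lemma sqrt_coeff_convolution:
  "(\<Sum>i\<le>n. sqrt_coeff i * sqrt_coeff (n - i)) = (if n = 0 then 1 else if n = 1 then - 1 else 0)"
proof -
  have "(\<Sum>i\<le>n. sqrt_coeff i * sqrt_coeff (n - i)) =
      (\<Sum>i\<le>n. (- 1) ^ n * (((1 / 2) gchoose i) * ((1 / 2) gchoose (n - i))))"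
    by (intro sum.cong) (auto simp: sqrt_coeff_def power_add[symmetric])
  also have "\<dots> = (- 1) ^ n * ((1 / 2 + 1 / 2) gchoose n)"
    unfolding sum_distrib_left[symmetric] using gbinomial_Vandermonde[of "1 / 2 :: real" "1 / 2" n]
    by (simp add: atMost_atLeast0)
  also have "(1 / 2 + 1 / 2 :: real) = of_nat 1" by simp
  also have "(of_nat 1 :: real) gchoose n = of_nat (1 choose n)" by (rule binomial_gbinomial[symmetric])
  finally show ?thesis by (cases n) (auto simp: binomial_eq_0)
qed

lemma bounded_op_funpow: "bounded_op X \<Longrightarrow> bounded_op (X ^^ n)"
  by (induction n) (auto simp: bounded_op_comp id_def[symmetric] simp del: o_apply)

lemma contraction_funpow:
  fixes X :: "'a::real_normed_vector \<Rightarrow> 'a"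
  assumes "\<And>x. norm (X x) \<le> norm x"
  shows "norm ((X ^^ n) x) \<le> norm x"
proof (induction n)
  case (Suc n)
  then show ?case using order_trans[OF assms[of "(X ^^ n) x"]] by simp
qed simp

lemma symmetric_funpow:
  fixes X :: "'a::complex_hilbert \<Rightarrow> 'a"
  assumes "\<And>x y. cinner (X x) y = cinner x (X y)"
  shows "cinner ((X ^^ n) x) y = cinner x ((X ^^ n) y)"
proof (induction n arbitrary: y)
  case (Suc n)
  have "cinner ((X ^^ Suc n) x) y = cinner ((X ^^ n) x) (X y)" by (simp add: assms)
  then show ?case by (simp add: Suc funpow_swap1)
qed simp

text \<open>\<open>Q\<close> is the power series of the square root of \<open>1 - x\<close>
  evaluated at \<open>X\<close>; absolute summability of the coefficients suffices, as the powers of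
  \<open>X\<close> are contractions.\<close>

lemma sqrt_contraction:
  fixes X :: "'a::complex_hilbert \<Rightarrow> 'a"
  assumes X: "bounded_op X" "\<And>x. norm (X x) \<le> norm x" "\<And>x y. cinner (X x) y = cinner x (X y)"
  obtains Q where "bounded_op Q" "\<And>x y. cinner (Q x) y = cinner x (Q y)" "\<And>x. Q (Q x) = x - X x"
proof -
  define A where "A k x = sqrt_coeff k *\<^sub>R (X ^^ k) x" for k and x :: 'a
  define Q where "Q x = (\<Sum>k. A k x)" for x
  have nA: "norm (A k x) \<le> \<bar>sqrt_coeff k\<bar> * norm x" for k x
    using mult_left_mono[OF contraction_funpow[OF X(2), of k x], of "\<bar>sqrt_coeff k\<bar>"] by (simp add: A_def)
  have Xk: "bounded_op (X ^^ k)" for k by (rule bounded_op_funpow[OF X(1)])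
  have sumn: "summable (\<lambda>k. \<bar>sqrt_coeff k\<bar> * norm x)" for x :: 'a
    using sqrt_coeff_summable by (rule summable_mult2)
  have ns: "summable (\<lambda>k. norm (A k x))" for x
    by (rule summable_comparison_test'[OF sumn, of 0]) (use nA in auto)
  have su: "summable (\<lambda>k. A k x)" for x using ns by (rule summable_norm_cancel)
  have hs: "((\<lambda>k. A k x) has_sum Q x) UNIV" for x
    unfolding Q_def by (intro norm_summable_imp_has_sum ns summable_sums su)
  have Q: "bounded_op Q"
  proof (rule bounded_opI)
    fix x y :: 'a and c
    show "Q (x + y) = Q x + Q y"
      unfolding Q_def suminf_add[OF su su]
      by (simp add: A_def bounded_op_simps[OF Xk] scaleR_add_right)
    have "((\<lambda>k. c *\<^sub>C A k x) has_sum (c *\<^sub>C Q x)) UNIV"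
      by (rule has_sum_bounded_linear[OF scaleC.bounded_linear_right hs])
    then have "((\<lambda>k. A k (c *\<^sub>C x)) has_sum (c *\<^sub>C Q x)) UNIV"
      by (simp add: A_def bounded_op_simps[OF Xk] scaleC.scaleR_right)
    then show "Q (c *\<^sub>C x) = c *\<^sub>C Q x" using hs has_sum_unique by blast
    have "norm (Q x) \<le> (\<Sum>k. norm (A k x))" unfolding Q_def by (rule summable_norm[OF ns])
    also have "\<dots> \<le> (\<Sum>k. \<bar>sqrt_coeff k\<bar> * norm x)" by (rule suminf_le[OF nA ns sumn])
    also have "\<dots> = (\<Sum>k. \<bar>sqrt_coeff k\<bar>) * norm x" by (rule suminf_mult2[OF sqrt_coeff_summable, symmetric])
    finally show "norm (Q x) \<le> (\<Sum>k. \<bar>sqrt_coeff k\<bar>) * norm x" .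
  qed
  have sym: "cinner (Q x) y = cinner x (Q y)" for x y
  proof -
    have "((\<lambda>k. cinner (A k x) y) has_sum cinner (Q x) y) UNIV"
      by (rule has_sum_bounded_linear[OF cinner.bounded_linear_left hs])
    moreover have "((\<lambda>k. cinner x (A k y)) has_sum cinner x (Q y)) UNIV"
      by (rule has_sum_bounded_linear[OF cinner.bounded_linear_right hs])
    moreover have "cinner (A k x) y = cinner x (A k y)" for k
      by (simp add: A_def cinner.scaleR_left cinner.scaleR_right symmetric_funpow[OF X(3)])
    ultimately show ?thesis by (simp add: has_sum_unique)
  qed
  have QQ: "Q (Q x) = x - X x" for x
  proof -
    \<comment> \<open>\<open>Q (Q x)\<close> becomes an absolutely summable double series.
      Regrouping along the diagonals \<open>i + j = n\<close> lets the convolution identity leave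
      only \<open>x - X x\<close>.\<close>
    define f where "f = (\<lambda>(i, j). (sqrt_coeff i * sqrt_coeff j) *\<^sub>R (X ^^ (i + j)) x)"
    have AA: "A i (A j x) = f (i, j)" for i j
      by (simp add: A_def f_def bounded_op_simps[OF Xk] funpow_add)
    have inner: "((\<lambda>j. f (i, j)) has_sum A i (Q x)) UNIV" for i
    proof -
      have "bounded_linear (A i)" unfolding A_def
        by (intro bounded_linear_compose[OF bounded_linear_scaleR_right] bounded_op_linear Xk)
      from has_sum_bounded_linear[OF this hs[of x]] show ?thesis by (simp add: AA)
    qed
    have abs: "(\<lambda>p. norm (f p)) summable_on UNIV \<times> UNIV"
    proof (rule summable_on_comparison_test)
      have c: "((\<lambda>k. \<bar>sqrt_coeff k\<bar>) has_sum (\<Sum>k. \<bar>sqrt_coeff k\<bar>)) UNIV"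
        by (rule sums_nonneg_imp_has_sum) (use sqrt_coeff_summable in auto)
      show "(\<lambda>(i, j). \<bar>sqrt_coeff i\<bar> * (\<bar>sqrt_coeff j\<bar> * norm x)) summable_on UNIV \<times> UNIV"
      proof (rule summable_on_SigmaI)
        show "((\<lambda>j. case (i, j) of (i, j) \<Rightarrow> \<bar>sqrt_coeff i\<bar> * (\<bar>sqrt_coeff j\<bar> * norm x)) has_sum
          \<bar>sqrt_coeff i\<bar> * ((\<Sum>k. \<bar>sqrt_coeff k\<bar>) * norm x)) UNIV" for i
          unfolding prod.case by (intro has_sum_cmult_right has_sum_cmult_left c)
        show "(\<lambda>i. \<bar>sqrt_coeff i\<bar> * ((\<Sum>k. \<bar>sqrt_coeff k\<bar>) * norm x)) summable_on UNIV"
          by (intro summable_on_cmult_left has_sum_imp_summable[OF c])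
      qed auto
      fix p :: "nat \<times> nat"
      obtain i j where p: "p = (i, j)" by (cases p)
      show "norm (f p) \<le> (case p of (i, j) \<Rightarrow> \<bar>sqrt_coeff i\<bar> * (\<bar>sqrt_coeff j\<bar> * norm x))"
        unfolding p f_def prod.case norm_scaleR abs_mult mult.assoc
        by (intro mult_left_mono contraction_funpow X(2)) auto
    qed simp
    have "(f has_sum Q (Q x)) (UNIV \<times> UNIV)"
      by (rule has_sum_SigmaI[OF inner hs[of "Q x"] abs_summable_summable[OF abs]])
    moreover have "bij_betw (\<lambda>(n, i). (i, n - i)) (SIGMA n:UNIV. {..n}) (UNIV \<times> (UNIV :: nat set))"
      by (rule bij_betwI[where g = "\<lambda>(i, j). (i + j, i)"]) auto
    ultimately have "((\<lambda>p. f ((\<lambda>(n, i). (i, n - i)) p)) has_sum Q (Q x)) (SIGMA n:UNIV. {..n})"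
      using has_sum_reindex_bij_betw by blast
    then have "((\<lambda>n. \<Sum>i\<le>n. f (i, n - i)) has_sum Q (Q x)) UNIV"
      by (rule has_sum_SigmaD) (auto intro!: has_sum_finiteI)
    also have "(\<lambda>n. \<Sum>i\<le>n. f (i, n - i)) =
        (\<lambda>n. (if n = 0 then 1 else if n = 1 then - 1 else 0) *\<^sub>R (X ^^ n) x)"
      unfolding sqrt_coeff_convolution[symmetric] scaleR_sum_left by (simp add: f_def fun_eq_iff)
    finally have "((\<lambda>n. (if n = 0 then 1 else if n = 1 then - 1 else 0) *\<^sub>R (X ^^ n) x) has_sum Q (Q x)) UNIV" .
    moreover have "((\<lambda>n. (if n = 0 then 1 else if n = 1 then - 1 else 0) *\<^sub>R (X ^^ n) x) has_sum (x - X x)) UNIV"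
      by (rule has_sum_finite_neutralI[where B = "{0, 1}"]) auto
    ultimately show ?thesis by (rule has_sum_unique)
  qed
  show ?thesis using that Q sym QQ by blast
qed

text \<open>Writes \<open>P\<close> as \<open>K\<close> times \<open>1 - X\<close> with
  \<open>X\<close> a positive contraction, the setting in which power series in \<open>X\<close>
  apply.\<close>

lemma positive_op_contraction_compl:
  assumes P: "positive_op P"
  obtains K where "K > 0" "positive_op (\<lambda>x. x - (1 / K) *\<^sub>R P x)" "\<And>x. norm (x - (1 / K) *\<^sub>R P x) \<le> norm x"
proof -
  have b: "bounded_op P" using P by (rule positive_op_bounded)
  obtain K where K: "K > 0" "\<And>x. norm (P x) \<le> K * norm x" by (rule bounded_op_norm_bound[OF b]) blast
  define X where "X = (\<lambda>x. x - (1 / K) *\<^sub>R P x)"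
  have bX: "bounded_op X"
    unfolding X_def using bounded_op_diff[OF bounded_op_id bounded_op_scaleC[OF b, of "complex_of_real (1 / K)"]]
    by (simp only: scaleC_of_real id_apply)
  have form: "cinner x (X x) = complex_of_real ((norm x)\<^sup>2 - Re (cinner x (P x)) / K)" for x
    unfolding X_def cinner_diff_right cinner.scaleR_right cinner_self
    by (subst positive_op_cinner_real[OF P]) (simp add: scaleR_conv_of_real)
  have le: "Re (cinner x (P x)) \<le> K * (norm x)\<^sup>2" for x
  proof -
    have "Re (cinner x (P x)) \<le> cmod (cinner x (P x))" by (rule complex_Re_le_cmod)
    also have "\<dots> \<le> norm x * (K * norm x)"
      using order_trans[OF cmod_cinner_le mult_left_mono[OF K(2)]] by simp
    finally show ?thesis by (simp add: power2_eq_square algebra_simps)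
  qed
  have pX: "positive_op X"
    unfolding positive_op_def form using bX le K(1)
    by (simp add: nonneg_Reals_complex_iff divide_le_eq mult.commute)
  moreover have "norm (X x) \<le> norm x" for x
    using positive_op_norm_le[OF pX, of 1 x] positive_op_Re_nonneg[OF P] K(1)
    by (simp add: form)
  ultimately show ?thesis using that[OF K(1)] unfolding X_def by blast
qed

lemma positive_op_sqrt:
  fixes P :: "'a::complex_hilbert \<Rightarrow> 'a"
  assumes P: "positive_op P"
  obtains Q where "bounded_op Q" "\<And>x y. cinner (Q x) y = cinner x (Q y)" "\<And>x. Q (Q x) = P x"
proof -
  obtain K where K: "K > 0" "positive_op (\<lambda>x. x - (1 / K) *\<^sub>R P x)" "\<And>x. norm (x - (1 / K) *\<^sub>R P x) \<le> norm x"
    by (rule positive_op_contraction_compl[OF P]) blast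
  obtain Q where Q: "bounded_op Q" "\<And>x y. cinner (Q x) y = cinner x (Q y)"
    "\<And>x. Q (Q x) = x - (x - (1 / K) *\<^sub>R P x)"
    by (rule sqrt_contraction[OF positive_op_bounded[OF K(2)] K(3)])
      (auto simp: positive_op_symmetric[OF K(2)])
  have "bounded_op (\<lambda>x. sqrt K *\<^sub>R Q x)"
    using bounded_op_scaleC[OF Q(1), of "complex_of_real (sqrt K)"] by (simp only: scaleC_of_real)
  moreover have "cinner (sqrt K *\<^sub>R Q x) y = cinner x (sqrt K *\<^sub>R Q y)" for x y
    by (simp add: cinner.scaleR_left cinner.scaleR_right Q(2))
  moreover have "sqrt K *\<^sub>R Q (sqrt K *\<^sub>R Q x) = P x" for x
    using K(1) by (simp add: bounded_op_simps[OF Q(1)] Q(3))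
  ultimately show ?thesis using that by blast
qed

section \<open>Trace class operators\<close>

text \<open>Both sums are iterated sums of the squared moduli of \<open>cinner f (A e)\<close>, by
  Parseval in one index or the other. For symmetric operators this gives independence of the
  basis.\<close>

lemma hilbert_schmidt_adj:
  assumes A: "bounded_op A" and E: "is_onb E" "is_onb F"
    and s: "((\<lambda>e. (norm (A e))\<^sup>2) has_sum s) E"
  shows "((\<lambda>f. (norm (adj A f))\<^sup>2) has_sum s) F"
proof -
  define g where "g = (\<lambda>(e, f). (cmod (cinner f (A e)))\<^sup>2)"
  have 1: "((\<lambda>f. g (e, f)) has_sum (norm (A e))\<^sup>2) F" for e
    unfolding g_def prod.case by (rule parseval_norm[OF E(2)])
  have "g summable_on E \<times> F"
    by (rule summable_on_SigmaI[OF 1 has_sum_imp_summable[OF s]]) (auto simp: g_def)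
  then have "(g has_sum s) (E \<times> F)" by (rule has_sum_SigmaI[OF 1 s])
  then have "((\<lambda>(f, e). g (e, f)) has_sum s) (F \<times> E)" by (subst (asm) has_sum_swap) (simp add: case_prod_unfold)
  moreover have "((\<lambda>e. (\<lambda>(f, e). g (e, f)) (f, e)) has_sum (norm (adj A f))\<^sup>2) E" for f
  proof -
    have "cmod (cinner f (A e)) = cmod (cinner e (adj A f))" for e
      by (metis A cinner_adj_left cinner_commute complex_mod_cnj)
    then show ?thesis using parseval_norm[OF E(1), of "adj A f"] by (simp add: g_def)
  qed
  ultimately show ?thesis by (rule has_sum_SigmaD)
qed

lemma symmetric_adj: "bounded_op Q \<Longrightarrow> (\<And>x y. cinner (Q x) y = cinner x (Q y)) \<Longrightarrow> adj Q = Q"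
  by (rule adj_eqI)

text \<open>The diagonal sums of \<open>Q Q B\<close> in one basis and of \<open>Q B Q\<close> in
  the other are the two iterated sums of the family
  \<open>cinner (Q e) f * cinner f (Q (B e))\<close>. This replaces cyclicity of the trace.\<close>

lemma trace_square_has_sum:
  assumes Q: "bounded_op Q" "\<And>x y. cinner (Q x) y = cinner x (Q y)"
    and E: "is_onb E" "is_onb F"
    and s: "((\<lambda>e. (norm (Q e))\<^sup>2) has_sum s) F" and B: "bounded_op B"
  obtains t where "((\<lambda>e. cinner e (Q (Q (B e)))) has_sum t) E" "((\<lambda>f. cinner (Q f) (B (Q f))) has_sum t) F"
proof -
  \<comment> \<open>Moving \<open>Q \<circ> B\<close> to the other side makes
    \<open>C = adj B \<circ> Q\<close>, so boundedness of \<open>B\<close> keeps \<open>C\<close>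
    Hilbert-Schmidt.\<close>
  define C where "C = adj (Q \<circ> B)"
  have QB: "bounded_op (Q \<circ> B)" by (rule bounded_op_comp[OF Q(1) B])
  have C: "C x = adj B (Q x)" for x
    using adj_comp[OF Q(1) B] symmetric_adj[OF Q(1,2)] by (simp add: C_def)
  have Cc: "cinner (C x) y = cinner x (Q (B y))" for x y
    using cinner_adj_left[OF QB, of x y] by (simp add: C_def)
  define g where "g = (\<lambda>(e, f). cinner (Q e) f * cinner f (Q (B e)))"
  have sE: "((\<lambda>e. (norm (Q e))\<^sup>2) has_sum s) E"
    using hilbert_schmidt_adj[OF Q(1) E(2,1) s] symmetric_adj[OF Q(1,2)] by simp
  obtain K where K: "K > 0" "\<And>x. norm (B x) \<le> K * norm x" by (rule bounded_op_norm_bound[OF B]) blast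
  \<comment> \<open>The product is dominated by the sum of two squares; the first is summed over
    \<open>f\<close> before \<open>e\<close>, the second in the opposite order.\<close>
  have "(\<lambda>p. norm (g p)) summable_on E \<times> F"
  proof (rule summable_on_comparison_test)
    have 1: "(\<lambda>(e, f). (cmod (cinner f (Q e)))\<^sup>2) summable_on E \<times> F"
      by (rule summable_on_SigmaI[OF _ has_sum_imp_summable[OF sE]])
        (auto intro: parseval_norm[OF E(2)])
    have 2: "(\<lambda>(f, e). (cmod (cinner e (C f)))\<^sup>2) summable_on F \<times> E"
    proof (rule summable_on_SigmaI)
      show "((\<lambda>e. case (f, e) of (f, e) \<Rightarrow> (cmod (cinner e (C f)))\<^sup>2) has_sum (norm (C f))\<^sup>2) E" for f
        by (simp add: parseval_norm[OF E(1)])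
      show "(\<lambda>f. (norm (C f))\<^sup>2) summable_on F"
      proof (rule summable_on_comparison_test)
        show "(\<lambda>f. K\<^sup>2 * (norm (Q f))\<^sup>2) summable_on F"
          by (intro summable_on_cmult_right has_sum_imp_summable[OF s])
        show "(norm (C f))\<^sup>2 \<le> K\<^sup>2 * (norm (Q f))\<^sup>2" for f
          unfolding power_mult_distrib[symmetric] C
          by (intro power_mono norm_adj_le[OF B K(2)]) (use K(1) in auto)
      qed auto
    qed auto
    then have "(\<lambda>(e, f). (cmod (cinner e (C f)))\<^sup>2) summable_on E \<times> F"
      by (subst (asm) summable_on_swap) (simp add: case_prod_unfold)
    from summable_on_add[OF 1 this]
    show "(\<lambda>(e, f). (cmod (cinner f (Q e)))\<^sup>2 + (cmod (cinner e (C f)))\<^sup>2) summable_on E \<times> F"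
      by (simp add: case_prod_unfold)
    fix p :: "'a \<times> 'a"
    obtain e f where p: "p = (e, f)" by (cases p)
    have "norm (g p) = cmod (cinner f (Q e)) * cmod (cinner e (C f))"
      unfolding p g_def prod.case norm_mult Cc[symmetric]
      by (metis cinner_commute complex_mod_cnj)
    also have "\<dots> \<le> (cmod (cinner f (Q e)))\<^sup>2 + (cmod (cinner e (C f)))\<^sup>2"
      using sum_squares_bound[of "cmod (cinner f (Q e))" "cmod (cinner e (C f))"]
        mult_nonneg_nonneg[OF norm_ge_zero norm_ge_zero, of "cinner f (Q e)" "cinner e (C f)"] by linarith
    finally show "norm (g p) \<le> (case p of (e, f) \<Rightarrow> (cmod (cinner f (Q e)))\<^sup>2 + (cmod (cinner e (C f)))\<^sup>2)"
      by (simp add: p)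
  qed simp
  then obtain t where t: "(g has_sum t) (E \<times> F)"
    using abs_summable_summable by (auto simp: summable_on_def)
  have "((\<lambda>e. cinner e (Q (Q (B e)))) has_sum t) E"
  proof (rule has_sum_SigmaD[OF t])
    show "((\<lambda>f. g (e, f)) has_sum cinner e (Q (Q (B e)))) F" for e
      using parseval[OF E(2), of "Q e" "Q (B e)"] by (simp add: g_def Q(2)[of e])
  qed
  moreover have "((\<lambda>f. cinner (Q f) (B (Q f))) has_sum t) F"
  proof (rule has_sum_SigmaD)
    show "((\<lambda>(f, e). g (e, f)) has_sum t) (F \<times> E)"
      using t by (subst (asm) has_sum_swap) (simp add: case_prod_unfold)
    show "((\<lambda>e. (\<lambda>(f, e). g (e, f)) (f, e)) has_sum cinner (Q f) (B (Q f))) E" for f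
      using parseval[OF E(1), of "C f" "Q f"]
      by (simp add: g_def Cc Q(2) mult.commute)
  qed
  ultimately show ?thesis using that by blast
qed

text \<open>The moments \<open>c n\<close> of \<open>X\<close> at \<open>x\<close> are nonnegative
  and decreasing, hence convergent, and the squared norm of the difference is the second difference
  of \<open>c\<close> at \<open>2 * n\<close>.\<close>

lemma contraction_diff_tendsto_0:
  fixes X :: "'a::complex_hilbert \<Rightarrow> 'a"
  assumes X: "positive_op X" "\<And>x. norm (X x) \<le> norm x"
  shows "(\<lambda>n. (X ^^ n) x - (X ^^ Suc n) x) \<longlonglongrightarrow> 0"
proof -
  note sym = positive_op_symmetric[OF X(1)]
  define c where "c n = Re (cinner x ((X ^^ n) x))" for n
  have c2: "cinner ((X ^^ m) x) ((X ^^ n) x) = cinner x ((X ^^ (m + n)) x)" for m n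
    by (simp add: symmetric_funpow[OF sym] funpow_add)
  have even: "c (2 * m) = (norm ((X ^^ m) x))\<^sup>2" for m
    using c2[of m m] by (simp add: c_def mult_2 cinner_self flip: c2)
  have odd: "c (2 * m + 1) = Re (cinner ((X ^^ m) x) (X ((X ^^ m) x)))" for m
    using c2[of m "Suc m"] by (simp add: c_def mult_2)
  have dec1: "c (2 * m + 1) \<le> c (2 * m)" for m
  proof -
    have "c (2 * m + 1) \<le> cmod (cinner ((X ^^ m) x) (X ((X ^^ m) x)))"
      unfolding odd by (rule complex_Re_le_cmod)
    also have "\<dots> \<le> norm ((X ^^ m) x) * norm ((X ^^ m) x)"
      using order_trans[OF cmod_cinner_le mult_left_mono[OF X(2)]] by simp
    finally show ?thesis unfolding even by (simp add: power2_eq_square)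
  qed
  have dec2: "c (2 * m + 2) \<le> c (2 * m + 1)" for m
  proof -
    define y where "y = (X ^^ m) x"
    have "c (2 * m + 2) = (norm (X y))\<^sup>2" using even[of "m + 1"] by (simp add: y_def)
    \<comment> \<open>The square of a positive contraction lies below it, by Cauchy-Schwarz for the
      form of \<open>X\<close> at \<open>X y\<close> and \<open>y\<close>.\<close>
    also have "\<dots> \<le> Re (cinner y (X y))"
    proof -
      have "(cmod (cinner (X y) (X y)))\<^sup>2 \<le> Re (cinner (X y) (X (X y))) * Re (cinner y (X y))"
        by (rule positive_op_form(2)[OF X(1)])
      also have "\<dots> \<le> (norm (X y))\<^sup>2 * Re (cinner y (X y))"
      proof (intro mult_right_mono positive_op_Re_nonneg[OF X(1)])
        have "Re (cinner (X y) (X (X y))) \<le> norm (X y) * norm (X (X y))"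
          using order_trans[OF complex_Re_le_cmod cmod_cinner_le] .
        also have "\<dots> \<le> norm (X y) * norm (X y)" by (intro mult_left_mono X(2)) auto
        finally show "Re (cinner (X y) (X (X y))) \<le> (norm (X y))\<^sup>2" by (simp add: power2_eq_square)
      qed
      finally have "(norm (X y))\<^sup>2 * (norm (X y))\<^sup>2 \<le> (norm (X y))\<^sup>2 * Re (cinner y (X y))"
        unfolding cinner_self norm_of_real abs_power2 by (simp add: power2_eq_square)
      then show ?thesis using positive_op_Re_nonneg[OF X(1), of y]
        mult_left_le_imp_le[of "(norm (X y))\<^sup>2" "(norm (X y))\<^sup>2" "Re (cinner y (X y))"]
        by (cases "X y = 0") simp_all
    qed
    finally show ?thesis unfolding odd y_def .
  qed
  have "c (Suc n) \<le> c n" for n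
  proof (cases "even n")
    case True
    then obtain m where "n = 2 * m" by (rule evenE)
    then show ?thesis using dec1[of m] by simp
  next
    case False
    then obtain m where "n = 2 * m + 1" by (rule oddE)
    then show ?thesis using dec2[of m] by simp
  qed
  then have "decseq c" by (rule decseq_SucI)
  moreover have "0 \<le> c n" for n
  proof (cases "even n")
    case True
    then obtain m where "n = 2 * m" by (rule evenE)
    then show ?thesis using even[of m] by simp
  next
    case False
    then obtain m where "n = 2 * m + 1" by (rule oddE)
    then show ?thesis using odd[of m] positive_op_Re_nonneg[OF X(1)] by simp
  qed
  ultimately obtain l where l: "c \<longlonglongrightarrow> l" using decseq_convergent[of c 0] by blast
  have sub: "(\<lambda>n. c (2 * n + k)) \<longlonglongrightarrow> l" for k
    using LIMSEQ_subseq_LIMSEQ[OF l, of "\<lambda>n. 2 * n + k"] by (simp add: strict_mono_def o_def)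
  have "(norm ((X ^^ n) x - (X ^^ Suc n) x))\<^sup>2 = c (2 * n + 0) - 2 * c (2 * n + 1) + c (2 * n + 2)" for n
  proof -
    have "complex_of_real ((norm ((X ^^ n) x - (X ^^ Suc n) x))\<^sup>2) = cinner x ((X ^^ (n + n)) x) - cinner x ((X ^^ (n + Suc n)) x)
       - cinner x ((X ^^ (Suc n + n)) x) + cinner x ((X ^^ (Suc n + Suc n)) x)"
      unfolding cinner_self[symmetric] cinner_diff_left cinner_diff_right c2 by simp
    then have "(norm ((X ^^ n) x - (X ^^ Suc n) x))\<^sup>2 = c (n + n) - c (n + Suc n) - c (Suc n + n) + c (Suc n + Suc n)"
      unfolding c_def by (metis Re_complex_of_real minus_complex.simps(1) plus_complex.simps(1))
    moreover have "n + n = 2 * n + 0" "n + Suc n = 2 * n + 1" "Suc n + n = 2 * n + 1" "Suc n + Suc n = 2 * n + 2"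
      by simp_all
    ultimately show ?thesis by (simp only:)
  qed
  moreover have "(\<lambda>n. c (2 * n + 0) - 2 * c (2 * n + 1) + c (2 * n + 2)) \<longlonglongrightarrow> l - 2 * l + l"
    by (intro tendsto_intros sub)
  ultimately have "(\<lambda>n. (norm ((X ^^ n) x - (X ^^ Suc n) x))\<^sup>2) \<longlonglongrightarrow> 0" by simp
  then have "(\<lambda>n. sqrt ((norm ((X ^^ n) x - (X ^^ Suc n) x))\<^sup>2)) \<longlonglongrightarrow> sqrt 0" by (rule tendsto_real_sqrt)
  then show ?thesis by (simp add: tendsto_norm_zero_iff)
qed

text \<open>Without a polar decomposition: \<open>A\<close> is the strong limit of \<open>V\<^sub>n P\<close> with \<open>P\<close> the modulus and
  \<open>V\<^sub>n = A S\<^sub>n\<close> uniformly bounded, where \<open>S\<^sub>n\<close> is a partial Neumann series for the inverse of \<open>P\<close>.\<close>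

lemma trace_class_summable:
  fixes A :: "'a::complex_hilbert \<Rightarrow> 'a"
  assumes A: "trace_class A" and E: "is_onb E"
  shows "(\<lambda>e. cinner e (A e)) summable_on E"
proof -
  obtain P F where P: "positive_op P" "P \<circ> P = adj A \<circ> A" "is_onb F" "(\<lambda>e. Re (cinner e (P e))) summable_on F"
    and bA: "bounded_op A"
    using A by (auto simp: trace_class_def)
  obtain Q where Q: "bounded_op Q" "\<And>x y. cinner (Q x) y = cinner x (Q y)" "\<And>x. Q (Q x) = P x"
    by (rule positive_op_sqrt[OF P(1)]) blast
  have adjQ: "adj Q = Q" by (rule symmetric_adj[OF Q(1,2)])
  have Pnorm: "Re (cinner x (P x)) = (norm (Q x))\<^sup>2" for x
    by (simp add: Q(3)[symmetric] Q(2)[symmetric] cinner_self)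
  obtain s where s: "((\<lambda>e. (norm (Q e))\<^sup>2) has_sum s) F"
    using P(4) unfolding Pnorm by (auto simp: summable_on_def)
  have sE: "((\<lambda>e. (norm (Q e))\<^sup>2) has_sum s) E"
    using hilbert_schmidt_adj[OF Q(1) P(3) E s] by (simp add: adjQ)
  have nAP: "norm (A x) = norm (P x)" for x
  proof -
    have "complex_of_real ((norm (A x))\<^sup>2) = complex_of_real ((norm (P x))\<^sup>2)"
      unfolding cinner_adj_comp[OF bA, symmetric] P(2)[symmetric]
      by (simp add: positive_op_symmetric[OF P(1), symmetric] cinner_self)
    then have "(norm (A x))\<^sup>2 = (norm (P x))\<^sup>2" by (simp only: of_real_eq_iff)
    then show ?thesis by simp
  qed
  obtain K where K: "K > 0" "positive_op (\<lambda>x. x - (1 / K) *\<^sub>R P x)" "\<And>x. norm (x - (1 / K) *\<^sub>R P x) \<le> norm x"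
    by (rule positive_op_contraction_compl[OF P(1)]) blast
  define X where "X = (\<lambda>x. x - (1 / K) *\<^sub>R P x)"
  have X: "positive_op X" "\<And>x. norm (X x) \<le> norm x" using K by (auto simp: X_def)
  have bXn: "bounded_op (X ^^ n)" for n by (rule bounded_op_funpow[OF positive_op_bounded[OF X(1)]])
  have PX: "P x = K *\<^sub>R (x - X x)" for x using K(1) by (simp add: X_def)
  define S where "S n = (\<lambda>x. complex_of_real (1 / K) *\<^sub>C (\<Sum>k<n. (X ^^ k) x))" for n
  have bS: "bounded_op (S n)" for n
    unfolding S_def by (intro bounded_op_scaleC bounded_op_sum bXn)
  have bX: "bounded_op X" by (rule positive_op_bounded[OF X(1)])
  \<comment> \<open>The partial Neumann series times \<open>1 - X\<close>, which is
    \<open>P / K\<close>, telescopes to \<open>1\<close> minus a power of \<open>X\<close>.\<close>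
  have tele: "(\<Sum>k<n. (X ^^ k) x) - (\<Sum>k<n. (X ^^ Suc k) x) = x - (X ^^ n) x" for n x
    by (induction n) (auto simp: algebra_simps)
  have PS: "P (S n x) = x - (X ^^ n) x" for n x
    unfolding PX S_def scaleC_of_real bounded_op_simps[OF bX] scaleR_diff_right[symmetric]
    using tele[of x n] K(1) by (simp add: sum_subtractf)
  have SP: "S n (P x) = x - (X ^^ n) x" for n x
    unfolding PX S_def scaleC_of_real bounded_op_simps[OF bXn] scaleR_diff_right[symmetric] sum_subtractf scaleR_sum_right[symmetric]
    using tele[of x n] K(1) by (simp add: funpow_swap1 scaleR_sum_right sum_subtractf flip: scaleR_diff_right)
  define V where "V n = A \<circ> S n" for n
  have bV: "bounded_op (V n)" for n unfolding V_def by (intro bounded_op_comp bA bS)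
  have nV: "norm (V n x) \<le> 2 * norm x" for n x
  proof -
    have "norm (V n x) = norm (x - (X ^^ n) x)" by (simp add: V_def nAP PS)
    also have "\<dots> \<le> norm x + norm ((X ^^ n) x)" by (rule norm_triangle_ineq4)
    also have "\<dots> \<le> 2 * norm x" using contraction_funpow[OF X(2), of n x] by simp
    finally show ?thesis .
  qed
  have VP: "(\<lambda>n. V n (P x)) \<longlonglongrightarrow> A x" for x
  proof -
    \<comment> \<open>The error \<open>A x - V n (P x)\<close> is \<open>A\<close> applied to the
      \<open>n\<close>-th iterate. Since \<open>A\<close> has the norms of its modulus
      \<open>P\<close>, this is \<open>K\<close> times a difference of consecutive iterates.\<close>
    have "norm (A ((X ^^ n) x)) = K * norm ((X ^^ n) x - (X ^^ Suc n) x)" for n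
      using K(1) by (simp add: nAP PX)
    moreover have "(\<lambda>n. K * norm ((X ^^ n) x - (X ^^ Suc n) x)) \<longlonglongrightarrow> K * 0"
      by (intro tendsto_intros tendsto_norm_zero contraction_diff_tendsto_0 X)
    ultimately have "(\<lambda>n. norm (A ((X ^^ n) x))) \<longlonglongrightarrow> 0" by (simp only: mult_zero_right)
    then have "(\<lambda>n. A ((X ^^ n) x)) \<longlonglongrightarrow> 0" by (rule tendsto_norm_zero_cancel)
    then have "(\<lambda>n. A x - A ((X ^^ n) x)) \<longlonglongrightarrow> A x - 0" by (intro tendsto_intros)
    then show ?thesis by (simp add: V_def SP bounded_op_simps[OF bA])
  qed
  \<comment> \<open>\<open>Q \<circ> adj (V n)\<close> is the adjoint of
    \<open>V n \<circ> Q\<close>, whose Hilbert-Schmidt sum is at most \<open>4 * s\<close> because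
    \<open>V n\<close> has norm at most \<open>2\<close>.\<close>
  have QV: "(\<Sum>e\<in>G. (norm (Q (adj (V n) e)))\<^sup>2) \<le> 4 * s" if G: "finite G" "G \<subseteq> E" for G n
  proof -
    have le: "(norm (V n (Q f)))\<^sup>2 \<le> 4 * (norm (Q f))\<^sup>2" for f
      using power_mono[OF nV[of n "Q f"], of 2] by (simp add: power_mult_distrib)
    have "(\<lambda>f. (norm ((V n \<circ> Q) f))\<^sup>2) summable_on F"
      by (rule summable_on_comparison_test[OF summable_on_cmult_right[OF has_sum_imp_summable[OF s], of 4]])
        (use le in auto)
    then obtain s' where s': "((\<lambda>f. (norm ((V n \<circ> Q) f))\<^sup>2) has_sum s') F" by (auto simp: summable_on_def)
    have "s' \<le> 4 * s"
      by (rule has_sum_mono[OF s' has_sum_cmult_right[OF s]]) (use le in auto)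
    moreover have "((\<lambda>e. (norm (adj (V n \<circ> Q) e))\<^sup>2) has_sum s') E"
      by (rule hilbert_schmidt_adj[OF bounded_op_comp[OF bV Q(1)] P(3) E s'])
    then have "((\<lambda>e. (norm (Q (adj (V n) e)))\<^sup>2) has_sum s') E"
      by (simp add: adj_comp[OF bV Q(1)] adjQ)
    then have "(\<Sum>e\<in>G. (norm (Q (adj (V n) e)))\<^sup>2) \<le> s'"
      by (rule finite_sum_le_has_sum) (use G in auto)
    ultimately show ?thesis by simp
  qed
  \<comment> \<open>Splitting \<open>P\<close> as \<open>Q Q\<close> pairs
    \<open>Q (adj (V n) e)\<close> with \<open>Q e\<close>. Their squares contribute
    \<open>4 * s\<close> and \<open>s\<close>, a bound that survives the limit in
    \<open>n\<close>.\<close>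
  have bound: "(\<Sum>e\<in>G. cmod (cinner e (A e))) \<le> 5 * s" if G: "finite G" "G \<subseteq> E" for G
  proof (rule LIMSEQ_le_const2)
    show "(\<lambda>n. \<Sum>e\<in>G. cmod (cinner e (V n (P e)))) \<longlonglongrightarrow> (\<Sum>e\<in>G. cmod (cinner e (A e)))"
      by (intro tendsto_intros cinner.tendsto VP)
    have "(\<Sum>e\<in>G. cmod (cinner e (V n (P e)))) \<le> 5 * s" for n
    proof -
      have "cmod (cinner e (V n (P e))) \<le> (norm (Q (adj (V n) e)))\<^sup>2 + (norm (Q e))\<^sup>2" for e
      proof -
        have "cinner e (V n (P e)) = cinner (Q (adj (V n) e)) (Q e)"
          by (simp add: cinner_adj_left[OF bV, symmetric] Q(2) Q(3))
        then have "cmod (cinner e (V n (P e))) \<le> norm (Q (adj (V n) e)) * norm (Q e)"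
          using cmod_cinner_le by metis
        then show ?thesis
          using sum_squares_bound[of "norm (Q (adj (V n) e))" "norm (Q e)"]
            mult_nonneg_nonneg[OF norm_ge_zero norm_ge_zero, of "Q (adj (V n) e)" "Q e"] by linarith
      qed
      then have "(\<Sum>e\<in>G. cmod (cinner e (V n (P e)))) \<le> (\<Sum>e\<in>G. (norm (Q (adj (V n) e)))\<^sup>2 + (norm (Q e))\<^sup>2)"
        by (intro sum_mono) auto
      also have "\<dots> \<le> 4 * s + s"
        unfolding sum.distrib
        by (intro add_mono QV G finite_sum_le_has_sum[OF sE]) auto
      finally show ?thesis by simp
    qed
    then show "\<exists>N. \<forall>n\<ge>N. (\<Sum>e\<in>G. cmod (cinner e (V n (P e)))) \<le> 5 * s" by blast
  qed
  have "(\<lambda>e. norm (cinner e (A e))) summable_on E"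
    by (rule nonneg_bdd_above_summable_on) (use bound in \<open>auto intro!: bdd_aboveI[of _ "5 * s"]\<close>)
  then show ?thesis by (rule abs_summable_summable)
qed

lemma trace_op_onb0: "trace_op A = (\<Sum>\<^sub>\<infinity>e\<in>onb0. cinner e (A e))"
  by (simp add: trace_op_def onb0_def)

lemma bounded_op_ident [simp]: "bounded_op (\<lambda>x. x)"
  using bounded_op_id by (simp add: id_def)

lemma onb_total: "is_onb E \<Longrightarrow> (\<And>e. e \<in> E \<Longrightarrow> cinner e x = 0) \<Longrightarrow> x = 0"
  unfolding is_onb_def by blast

section \<open>Density operators\<close>

lemma density_op_positive: "density_op \<rho> \<Longrightarrow> positive_op \<rho>"
  by (simp add: density_op_def)

lemma density_op_bounded: "density_op \<rho> \<Longrightarrow> bounded_op \<rho>"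
  by (simp add: density_op_def positive_op_def)

lemma density_op_trace_class: "density_op \<rho> \<Longrightarrow> trace_class \<rho>"
  by (simp add: density_op_def)

text \<open>A density is the square of a Hilbert-Schmidt operator, which frees its traces from the
  chosen basis. In the form \<open>cinner (Q e) (B (Q e))\<close> they are visibly linear and
  positive in \<open>B\<close>.\<close>

lemma density_opE:
  fixes \<rho> :: "'a::complex_hilbert \<Rightarrow> 'a"
  assumes \<rho>: "density_op \<rho>"
  obtains Q where "bounded_op Q" "\<And>x y. cinner (Q x) y = cinner x (Q y)" "\<And>x. Q (Q x) = \<rho> x"
    "\<And>E. is_onb E \<Longrightarrow> ((\<lambda>e. (norm (Q e))\<^sup>2) has_sum 1) E"
    "\<And>E B. is_onb E \<Longrightarrow> bounded_op B \<Longrightarrow> ((\<lambda>e. cinner e (\<rho> (B e))) has_sum trace_op (\<rho> \<circ> B)) E"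
    "\<And>E B. is_onb E \<Longrightarrow> bounded_op B \<Longrightarrow> ((\<lambda>e. cinner (Q e) (B (Q e))) has_sum trace_op (\<rho> \<circ> B)) E"
proof -
  have pos: "positive_op \<rho>" and tc: "trace_class \<rho>" and tr: "trace_op \<rho> = 1"
    using \<rho> by (auto simp: density_op_def)
  obtain Q where Q: "bounded_op Q" "\<And>x y. cinner (Q x) y = cinner x (Q y)" "\<And>x. Q (Q x) = \<rho> x"
    by (rule positive_op_sqrt[OF pos]) blast
  have form: "cinner e (\<rho> e) = complex_of_real ((norm (Q e))\<^sup>2)" for e
    by (simp add: Q(3)[symmetric] Q(2)[symmetric] cinner_self)
  have "((\<lambda>e. cinner e (\<rho> e)) has_sum 1) onb0"
    using trace_class_summable[OF tc is_onb_onb0] tr unfolding trace_op_onb0 has_sum_iff by blast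
  from has_sum_Re[OF this] have s0: "((\<lambda>e. (norm (Q e))\<^sup>2) has_sum 1) onb0"
    unfolding form by simp
  have s: "((\<lambda>e. (norm (Q e))\<^sup>2) has_sum 1) E" if "is_onb E" for E
    using hilbert_schmidt_adj[OF Q(1) is_onb_onb0 that s0] by (simp add: symmetric_adj[OF Q(1,2)])
  have t: "((\<lambda>e. cinner e (\<rho> (B e))) has_sum trace_op (\<rho> \<circ> B)) E \<and>
      ((\<lambda>e. cinner (Q e) (B (Q e))) has_sum trace_op (\<rho> \<circ> B)) F"
    if E: "is_onb E" "is_onb F" and B: "bounded_op B" for E F B
  proof -
    obtain t0 where t0: "((\<lambda>e. cinner e (Q (Q (B e)))) has_sum t0) onb0" "((\<lambda>f. cinner (Q f) (B (Q f))) has_sum t0) F"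
      by (rule trace_square_has_sum[OF Q(1,2) is_onb_onb0 E(2) s[OF E(2)] B])
    obtain t where t: "((\<lambda>e. cinner e (Q (Q (B e)))) has_sum t) E" "((\<lambda>f. cinner (Q f) (B (Q f))) has_sum t) F"
      by (rule trace_square_has_sum[OF Q(1,2) E s[OF E(2)] B])
    have "t = t0" by (rule has_sum_unique[OF t(2) t0(2)])
    moreover have "trace_op (\<rho> \<circ> B) = t0"
      using infsumI[OF t0(1)] by (simp add: trace_op_onb0 Q(3))
    ultimately show ?thesis using t by (simp add: Q(3))
  qed
  show ?thesis using that[OF Q s] t by blast
qed

text \<open>A positive operator is its own modulus, so one convergent diagonal sum makes it trace
  class; its root transfers the sum to the chosen basis.\<close>

lemma density_opI:
  assumes pos: "positive_op \<rho>" and E: "is_onb E" and s: "((\<lambda>e. cinner e (\<rho> e)) has_sum 1) E"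
  shows "density_op \<rho>"
proof -
  obtain Q where Q: "bounded_op Q" "\<And>x y. cinner (Q x) y = cinner x (Q y)" "\<And>x. Q (Q x) = \<rho> x"
    by (rule positive_op_sqrt[OF pos]) blast
  have form: "cinner e (\<rho> e) = complex_of_real ((norm (Q e))\<^sup>2)" for e
    by (simp add: Q(3)[symmetric] Q(2)[symmetric] cinner_self)
  have sE: "((\<lambda>e. (norm (Q e))\<^sup>2) has_sum 1) E"
    using has_sum_Re[OF s] unfolding form by simp
  have "((\<lambda>e. (norm (Q e))\<^sup>2) has_sum 1) onb0"
    using hilbert_schmidt_adj[OF Q(1) E is_onb_onb0 sE] by (simp add: symmetric_adj[OF Q(1,2)])
  from has_sum_of_real[OF this] have "trace_op \<rho> = 1"
    unfolding trace_op_onb0 form by (intro infsumI) simp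
  moreover have "trace_class \<rho>"
    unfolding trace_class_def
  proof (intro conjI exI)
    show "\<rho> \<circ> \<rho> = adj \<rho> \<circ> \<rho>" by (simp add: positive_op_adj[OF pos])
    show "(\<lambda>e. Re (cinner e (\<rho> e))) summable_on E" using has_sum_Re[OF s] by (rule has_sum_imp_summable)
  qed (use pos E positive_op_bounded in auto)
  ultimately show ?thesis using pos by (simp add: density_op_def)
qed

lemma trace_op_rank1:
  assumes "bounded_op A" shows "trace_op (A \<circ> rank1 y x) = cinner x (A y)"
  using infsumI[OF parseval[OF is_onb_onb0, of x "A y"]]
  by (simp add: trace_op_onb0 rank1_comp_left[OF assms] cinner_rank1)

lemma trace_op_rank1':
  assumes B: "bounded_op B" shows "trace_op (rank1 y x \<circ> B) = cinner x (B y)"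
proof -
  have "((\<lambda>e. cinner (adj B x) e * cinner e y) has_sum cinner (adj B x) y) onb0"
    by (rule parseval[OF is_onb_onb0])
  then show ?thesis
    by (simp add: trace_op_onb0 cinner_rank1 cinner_adj_left[OF B] infsumI)
qed

text \<open>Testing with operators of rank one recovers all matrix elements. This is the uniqueness
  behind the definite description \<open>predual\<close>.\<close>

lemma trace_op_eqD:
  assumes "bounded_op \<eta>" "bounded_op \<eta>'" "\<And>A. bounded_op A \<Longrightarrow> trace_op (\<eta> \<circ> A) = trace_op (\<eta>' \<circ> A)"
  shows "\<eta> = \<eta>'"
proof (intro ext cinner_eqI)
  fix x y
  show "cinner x (\<eta> y) = cinner x (\<eta>' y)"
    using assms(3)[of "rank1 y x"] by (simp add: trace_op_rank1 assms(1,2))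
qed

lemma density_op_rank1:
  assumes "norm v = 1" shows "density_op (rank1 v v)"
proof (rule density_opI[OF positive_op_rank1 is_onb_onb0])
  have "((\<lambda>e. (cmod (cinner e v))\<^sup>2) has_sum 1) onb0"
    using parseval_norm[OF is_onb_onb0, of v] assms by simp
  from has_sum_of_real[OF this] show "((\<lambda>e. cinner e (rank1 v v e)) has_sum 1) onb0"
    unfolding cinner_rank1_self by (simp add: cinner_commute[of v])
qed

section \<open>States on the bounded operators\<close>

text \<open>A state without a normality condition, so that limits of averages are still covered.
  Only values on bounded operators are constrained.\<close>

definition op_state :: "(('a::complex_hilbert \<Rightarrow> 'a) \<Rightarrow> complex) \<Rightarrow> bool" where
  "op_state f \<longleftrightarrow> (\<forall>A B a b. bounded_op A \<longrightarrow> bounded_op B \<longrightarrow>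
       f (\<lambda>x. a *\<^sub>C A x + b *\<^sub>C B x) = a * f A + b * f B) \<and>
     (\<forall>A. positive_op A \<longrightarrow> f A \<in> \<real>\<^sub>\<ge>\<^sub>0) \<and> f id = 1"

lemma op_state_lincomb:
  "op_state f \<Longrightarrow> bounded_op A \<Longrightarrow> bounded_op B \<Longrightarrow> f (\<lambda>x. a *\<^sub>C A x + b *\<^sub>C B x) = a * f A + b * f B"
  by (simp add: op_state_def)

lemma op_state_simps:
  assumes "op_state f" "bounded_op A" "bounded_op B"
  shows "f (\<lambda>x. A x + B x) = f A + f B" "f (\<lambda>x. A x - B x) = f A - f B" "f (\<lambda>x. c *\<^sub>C A x) = c * f A"
  using op_state_lincomb[OF assms, of 1 1] op_state_lincomb[OF assms, of 1 "-1"]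
    op_state_lincomb[OF assms(1,2,2), of c 0] by (simp_all add: scaleC_minus1)

lemma op_state_zero: "op_state f \<Longrightarrow> f (\<lambda>x. 0) = 0"
  using op_state_lincomb[of f id id 0 0] by simp

lemma op_state_sum:
  assumes "op_state f" "\<And>i. i \<in> I \<Longrightarrow> bounded_op (A i)"
  shows "f (\<lambda>x. \<Sum>i\<in>I. A i x) = (\<Sum>i\<in>I. f (A i))"
  using assms(2)
  by (induction I rule: infinite_finite_induct)
    (auto simp: op_state_zero[OF assms(1)] op_state_simps[OF assms(1)] bounded_op_sum)

lemma op_state_positive: "op_state f \<Longrightarrow> positive_op A \<Longrightarrow> f A \<in> \<real>\<^sub>\<ge>\<^sub>0"
  by (simp add: op_state_def)

lemma op_state_id: "op_state f \<Longrightarrow> f id = 1"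
  by (simp add: op_state_def)

text \<open>The value of \<open>f\<close> at the positive operator \<open>adj C \<circ> C\<close>,
  for \<open>C\<close> the combination of \<open>A\<close> and \<open>B\<close> with coefficients
  \<open>1\<close> and \<open>l\<close>, is the form required by
  \<open>psd_form_cauchy_schwarz\<close>.\<close>

lemma op_state_form:
  assumes f: "op_state f" and A: "bounded_op A" and B: "bounded_op B"
  shows "f (adj B \<circ> A) = cnj (f (adj A \<circ> B))"
    "(cmod (f (adj A \<circ> B)))\<^sup>2 \<le> Re (f (adj A \<circ> A)) * Re (f (adj B \<circ> B))"
proof -
  note [simp] = bounded_op_comp bounded_op_adj A B bounded_op_lincomb
  have "f (adj A \<circ> A) + l * f (adj A \<circ> B) + cnj l * f (adj B \<circ> A) + l * cnj l * f (adj B \<circ> B) \<in> \<real>\<^sub>\<ge>\<^sub>0" for l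
  proof -
    define C where "C = (\<lambda>x. 1 *\<^sub>C A x + l *\<^sub>C B x)"
    have bC: "bounded_op C" by (simp only: C_def bounded_op_lincomb A B)
    have aC: "adj C = (\<lambda>x. 1 *\<^sub>C adj A x + cnj l *\<^sub>C adj B x)"
      by (rule adj_eqI[OF bC]) (simp add: C_def cinner_simps cinner_adj_right)
    have "adj C \<circ> C = (\<lambda>x. 1 *\<^sub>C (\<lambda>x. 1 *\<^sub>C (adj A \<circ> A) x + l *\<^sub>C (adj A \<circ> B) x) x +
       cnj l *\<^sub>C (\<lambda>x. 1 *\<^sub>C (adj B \<circ> A) x + l *\<^sub>C (adj B \<circ> B) x) x)"
      unfolding aC by (simp add: C_def fun_eq_iff bounded_op_simps[of "adj A"] bounded_op_simps[of "adj B"])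
    then have "f (adj C \<circ> C) = f (adj A \<circ> A) + l * f (adj A \<circ> B) + cnj l * f (adj B \<circ> A) + l * cnj l * f (adj B \<circ> B)"
      by (simp only: op_state_lincomb[OF f] bounded_op_lincomb bounded_op_comp bounded_op_adj A B)
        (simp add: algebra_simps del: o_apply)
    then show ?thesis using op_state_positive[OF f positive_op_adj_comp[OF bC]] by simp
  qed
  from psd_form_cauchy_schwarz[OF this]
  show "f (adj B \<circ> A) = cnj (f (adj A \<circ> B))"
    "(cmod (f (adj A \<circ> B)))\<^sup>2 \<le> Re (f (adj A \<circ> A)) * Re (f (adj B \<circ> B))"
    using op_state_positive[OF f positive_op_adj_comp[OF A]] op_state_positive[OF f positive_op_adj_comp[OF B]] by auto
qed

lemma op_state_mono:
  assumes f: "op_state f" and A: "bounded_op A" "bounded_op B" and pos: "positive_op (\<lambda>x. B x - A x)"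
  shows "Re (f A) \<le> Re (f B)"
  using op_state_positive[OF f pos] by (simp add: op_state_simps[OF f A(2,1)] nonneg_Reals_complex_iff)

lemma adj_id: "adj (id :: 'a::complex_hilbert \<Rightarrow> 'a) = id"
  by (rule adj_eqI[OF bounded_op_id]) simp

lemma op_state_adj_comp_le:
  assumes f: "op_state f" and A: "bounded_op A" and K: "\<And>x. norm (A x) \<le> K * norm x"
  shows "Re (f (adj A \<circ> A)) \<le> K\<^sup>2"
proof -
  have b: "bounded_op (\<lambda>x. complex_of_real (K\<^sup>2) *\<^sub>C id x)" by (rule bounded_op_scaleC) simp
  have b2: "bounded_op (adj A \<circ> A)" by (intro bounded_op_comp bounded_op_adj A)
  have "cinner x (complex_of_real (K\<^sup>2) *\<^sub>C id x - (adj A \<circ> A) x) =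
      complex_of_real ((K * norm x)\<^sup>2 - (norm (A x))\<^sup>2)" for x
    unfolding cinner_diff_right cinner_adj_comp[OF A] cinner_scaleC_right id_apply cinner_self
    by (simp add: power_mult_distrib)
  moreover have "(norm (A x))\<^sup>2 \<le> (K * norm x)\<^sup>2" for x by (rule power_mono[OF K]) simp
  ultimately have "positive_op (\<lambda>x. complex_of_real (K\<^sup>2) *\<^sub>C id x - (adj A \<circ> A) x)"
    using bounded_op_diff[OF b b2] by (simp add: positive_op_def nonneg_Reals_complex_iff del: o_apply id_apply)
  from op_state_mono[OF f b2 b this]
  show ?thesis unfolding op_state_simps(3)[OF f bounded_op_id bounded_op_id] by (simp add: op_state_id[OF f] del: o_apply)
qed

lemma op_state_norm_le:
  assumes f: "op_state f" and A: "bounded_op A" and K: "\<And>x. norm (A x) \<le> K * norm x" "0 \<le> K"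
  shows "cmod (f A) \<le> K"
proof -
  have "(cmod (f (adj id \<circ> A)))\<^sup>2 \<le> Re (f (adj id \<circ> id)) * Re (f (adj A \<circ> A))"
    by (rule op_state_form(2)[OF f bounded_op_id A])
  also have "\<dots> \<le> K\<^sup>2" using op_state_adj_comp_le[OF f A K(1)] by (simp add: adj_id op_state_id[OF f])
  finally have "(cmod (f A))\<^sup>2 \<le> K\<^sup>2" by (simp add: adj_id)
  then show ?thesis using K(2) by (rule power2_le_imp_le)
qed

lemma op_state_density:
  assumes \<rho>: "density_op \<rho>" shows "op_state (\<lambda>A. trace_op (\<rho> \<circ> A))"
proof -
  obtain Q where Q: "bounded_op Q" "\<And>x y. cinner (Q x) y = cinner x (Q y)" "\<And>x. Q (Q x) = \<rho> x"
    "\<And>E B. is_onb E \<Longrightarrow> bounded_op B \<Longrightarrow> ((\<lambda>e. cinner (Q e) (B (Q e))) has_sum trace_op (\<rho> \<circ> B)) E"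
    by (rule density_opE[OF \<rho>]) blast
  note tr = Q(4)[OF is_onb_onb0]
  have "trace_op (\<rho> \<circ> (\<lambda>x. a *\<^sub>C A x + b *\<^sub>C B x)) = a * trace_op (\<rho> \<circ> A) + b * trace_op (\<rho> \<circ> B)"
    if A: "bounded_op A" "bounded_op B" for A B a b
  proof (rule has_sum_unique[OF tr[OF bounded_op_lincomb[OF A]]])
    show "((\<lambda>e. cinner (Q e) (a *\<^sub>C A (Q e) + b *\<^sub>C B (Q e))) has_sum
        a * trace_op (\<rho> \<circ> A) + b * trace_op (\<rho> \<circ> B)) onb0"
      unfolding cinner_add_right cinner_scaleC_right by (intro has_sum_add has_sum_cmult_right tr A)
  qed
  moreover have "trace_op (\<rho> \<circ> A) \<in> \<real>\<^sub>\<ge>\<^sub>0" if A: "positive_op A" for A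
  proof -
    have t: "((\<lambda>e. cinner (Q e) (A (Q e))) has_sum trace_op (\<rho> \<circ> A)) onb0"
      by (rule tr[OF positive_op_bounded[OF A]])
    have p: "cinner (Q e) (A (Q e)) \<in> \<real>\<^sub>\<ge>\<^sub>0" for e using A by (simp add: positive_op_def)
    have "0 \<le> Re (trace_op (\<rho> \<circ> A))"
      by (rule has_sum_nonneg[OF has_sum_Re[OF t]]) (use p in \<open>auto simp: nonneg_Reals_complex_iff\<close>)
    moreover have "Im (trace_op (\<rho> \<circ> A)) = 0"
      using has_sum_unique[OF has_sum_Im[OF t] has_sum_0] p by (auto simp: nonneg_Reals_complex_iff)
    ultimately show ?thesis by (simp add: nonneg_Reals_complex_iff)
  qed
  moreover have "trace_op (\<rho> \<circ> id) = 1" using \<rho> by (simp add: density_op_def)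
  ultimately show ?thesis by (simp add: op_state_def)
qed

text \<open>The trace is a sum of nonnegative terms \<open>cinner (Q e) (A (Q e))\<close>, so each
  vanishes. Hence \<open>A\<close> kills \<open>Q e\<close> on a basis, and thus the range of
  \<open>Q\<close>, which contains that of \<open>\<rho>\<close>.\<close>

lemma trace_op_positive_eq_0:
  assumes \<rho>: "density_op \<rho>" and A: "positive_op A" and 0: "Re (trace_op (\<rho> \<circ> A)) = 0"
  shows "A (\<rho> x) = 0"
proof -
  obtain Q where Q: "bounded_op Q" "\<And>x y. cinner (Q x) y = cinner x (Q y)" "\<And>x. Q (Q x) = \<rho> x"
    "\<And>E B. is_onb E \<Longrightarrow> bounded_op B \<Longrightarrow> ((\<lambda>e. cinner (Q e) (B (Q e))) has_sum trace_op (\<rho> \<circ> B)) E"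
    by (rule density_opE[OF \<rho>]) blast
  have "((\<lambda>e. Re (cinner (Q e) (A (Q e)))) has_sum 0) onb0"
    using has_sum_Re[OF Q(4)[OF is_onb_onb0 positive_op_bounded[OF A]]] 0 by simp
  then have "Re (cinner (Q e) (A (Q e))) = 0" if "e \<in> onb0" for e
    using nonneg_has_sum_le_0D[where f = "\<lambda>e. Re (cinner (Q e) (A (Q e)))" and A = onb0 and x = e] that positive_op_Re_nonneg[OF A] by simp
  then have "A (Q e) = 0" if "e \<in> onb0" for e using positive_op_kernel[OF A] that by blast
  then have sub: "onb0 \<subseteq> {x. (A \<circ> Q) x = 0}" by auto
  have "{x. (A \<circ> Q) x = 0} = UNIV"
    by (rule total_subset_UNIV[OF onb_total[OF is_onb_onb0] closed_csubspace_ker[OF bounded_op_comp[OF positive_op_bounded[OF A] Q(1)]] sub])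
  then have "(A \<circ> Q) (Q x) = 0" by blast
  then show ?thesis by (simp add: Q(3))
qed

section \<open>Positive maps acting on states, and the criterion for normality\<close>

lemma completely_positive_linear:
  assumes "completely_positive \<Phi>"
  shows "bounded_op A \<Longrightarrow> bounded_op (\<Phi> A)"
    "bounded_op A \<Longrightarrow> bounded_op B \<Longrightarrow> \<Phi> (\<lambda>x. a *\<^sub>C A x + b *\<^sub>C B x) = (\<lambda>x. a *\<^sub>C \<Phi> A x + b *\<^sub>C \<Phi> B x)"
  using assms unfolding completely_positive_def op_linear_def by blast+

lemma completely_positive_positive:
  assumes \<Phi>: "completely_positive \<Phi>" and A: "positive_op A" shows "positive_op (\<Phi> A)"
proof -
  have "positive_op_matrix 1 (\<lambda>i j. A)"
    using A by (auto simp: positive_op_matrix_def positive_op_def)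
  then have "positive_op_matrix 1 (\<lambda>i j. \<Phi> A)"
    using \<Phi> by (simp add: completely_positive_def)
  then have pos: "bounded_op (\<Phi> A)" "\<And>u :: nat \<Rightarrow> 'a. cinner (u 0) (\<Phi> A (u 0)) \<in> \<real>\<^sub>\<ge>\<^sub>0"
    by (auto simp: positive_op_matrix_def)
  show ?thesis using pos(1) pos(2)[of "\<lambda>_. _"] by (simp add: positive_op_def)
qed

lemma op_state_comp:
  assumes f: "op_state f" and \<Phi>: "completely_positive \<Phi>" "\<Phi> id = id"
  shows "op_state (\<lambda>A. f (\<Phi> A))"
  unfolding op_state_def
proof (intro conjI allI impI)
  fix A B :: "'a \<Rightarrow> 'a" and a b assume AB: "bounded_op A" "bounded_op B"
  show "f (\<Phi> (\<lambda>x. a *\<^sub>C A x + b *\<^sub>C B x)) = a * f (\<Phi> A) + b * f (\<Phi> B)"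
    unfolding completely_positive_linear(2)[OF \<Phi>(1) AB]
    by (rule op_state_lincomb[OF f completely_positive_linear(1)[OF \<Phi>(1) AB(1)] completely_positive_linear(1)[OF \<Phi>(1) AB(2)]])
next
  fix A :: "'a \<Rightarrow> 'a" assume "positive_op A"
  then show "f (\<Phi> A) \<in> \<real>\<^sub>\<ge>\<^sub>0" by (rule op_state_positive[OF f completely_positive_positive[OF \<Phi>(1)]])
qed (simp add: \<Phi>(2) op_state_id[OF f])

text \<open>The density is read off from the values on operators of rank one. Tightness makes the
  partial traces converge: the remainder \<open>f (A \<circ> N)\<close>, with \<open>N\<close> the
  complement of a basis projection, is bounded by Cauchy-Schwarz through the small mass
  \<open>f N\<close>.\<close>

lemma op_state_normal:
  fixes f :: "('a::complex_hilbert \<Rightarrow> 'a) \<Rightarrow> complex"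
  assumes f: "op_state f"
    and tight: "\<And>\<epsilon>. \<epsilon> > 0 \<Longrightarrow> \<exists>F. finite F \<and> F \<subseteq> onb0 \<and> 1 - \<epsilon> \<le> Re (f (fproj F))"
  obtains \<eta> where "density_op \<eta>" "\<And>A. bounded_op A \<Longrightarrow> trace_op (\<eta> \<circ> A) = f A"
proof -
  have on: "orthonormal (onb0 :: 'a set)" by (rule orthonormal_onb[OF is_onb_onb0])
  have lin: "f (rank1 (a *\<^sub>C y + b *\<^sub>C z) x) = a * f (rank1 y x) + b * f (rank1 z x)" for a b x y z
    unfolding op_state_lincomb[OF f bounded_op_rank1 bounded_op_rank1, symmetric]
    by (rule arg_cong[of _ _ f]) (simp add: rank1_def fun_eq_iff scaleC_add_right scaleC_scaleC mult.commute)
  have bd: "cmod (f (rank1 y x)) \<le> norm y * norm x" for x y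
    by (rule op_state_norm_le[OF f bounded_op_rank1 norm_rank1_le]) simp
  \<comment> \<open>If \<open>f\<close> is the trace against \<open>\<eta>\<close>, then
    \<open>f (rank1 y x)\<close> must be \<open>cinner x (\<eta> y)\<close>. The bound on operators
    of rank one permits a Riesz representation in \<open>y\<close>.\<close>
  have "\<exists>z. \<forall>y. f (rank1 y x) = cinner z y" for x
  proof (rule riesz_representation[of "\<lambda>y. f (rank1 y x)"])
    show "bounded_linear (\<lambda>y. f (rank1 y x))"
    proof (rule bounded_linear_intro[where K = "norm x"])
      show "f (rank1 (y + z) x) = f (rank1 y x) + f (rank1 z x)" for y z using lin[of 1 y 1 z x] by simp
      show "f (rank1 (r *\<^sub>R y) x) = r *\<^sub>R f (rank1 y x)" for r y
        using lin[of "complex_of_real r" y 0 0 x] by (simp add: scaleC_of_real scaleR_conv_of_real)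
    qed (rule bd)
    show "f (rank1 (c *\<^sub>C y) x) = c * f (rank1 y x)" for c y using lin[of c y 0 0 x] by simp
  qed blast
  then obtain \<eta> where \<eta>: "\<And>x y. f (rank1 y x) = cinner (\<eta> x) y" by metis
  have herm: "f (rank1 x y) = cnj (f (rank1 y x))" for x y
  proof (cases "x = 0")
    case True then show ?thesis by (simp add: rank1_def op_state_zero[OF f])
  next
    case False
    have a: "adj (rank1 y x) = rank1 x y" for x y :: 'a
    proof (rule adj_eqI)
      show "cinner (rank1 y x a) b = cinner a (rank1 x y b)" for a b
        using cinner_commute[of a x] by (simp add: rank1_def cinner_simps)
    qed simp
    have "f (adj (rank1 y x) \<circ> id) = cnj (f (adj id \<circ> rank1 y x))"
      by (rule op_state_form(1)[OF f]) simp_all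
    then show ?thesis by (simp add: a adj_id)
  qed
  have \<eta>': "cinner x (\<eta> y) = f (rank1 y x)" for x y
    unfolding herm[of y x] unfolding \<eta> by (rule cinner_commute)
  have b\<eta>: "bounded_op \<eta>"
  proof (rule bounded_opI[where K = 1])
    show "\<eta> (x + y) = \<eta> x + \<eta> y" for x y
      by (rule cinner_eqI) (use lin[of 1 x 1 y] in \<open>simp add: \<eta>' cinner_simps\<close>)
    show "\<eta> (c *\<^sub>C x) = c *\<^sub>C \<eta> x" for c x
      by (rule cinner_eqI) (use lin[of c x 0 0] in \<open>simp add: \<eta>' cinner_simps\<close>)
    show "norm (\<eta> x) \<le> 1 * norm x" for x
    proof -
      have "(norm (\<eta> x))\<^sup>2 = cmod (cinner (\<eta> x) (\<eta> x))" by (simp only: cinner_self norm_of_real abs_power2)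
      also have "\<dots> \<le> norm (\<eta> x) * norm x" unfolding \<eta>[symmetric] by (rule bd)
      finally show ?thesis by (cases "norm (\<eta> x) = 0") (auto simp: power2_eq_square)
    qed
  qed
  have pos: "positive_op \<eta>"
    using b\<eta> op_state_positive[OF f positive_op_rank1] by (simp add: positive_op_def \<eta>')
  have fsum: "(\<Sum>e\<in>F. cinner e (\<eta> (A e))) = f (A \<circ> fproj F)" if A: "bounded_op A" for A F
  proof -
    have "A \<circ> fproj F = (\<lambda>x. \<Sum>e\<in>F. rank1 (A e) e x)"
      unfolding rank1_comp_left[OF A, symmetric] by (simp add: fproj_def fun_eq_iff bounded_op_simps[OF A])
    then show ?thesis using op_state_sum[OF f, of F "\<lambda>e. rank1 (A e) e"] by (simp add: \<eta>')
  qed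
  have hs: "((\<lambda>e. cinner e (\<eta> (A e))) has_sum f A) onb0" if A: "bounded_op A" for A
    unfolding has_sum_def tendsto_iff
  proof (intro allI impI)
    fix r :: real assume r: "0 < r"
    obtain K where K: "K > 0" "\<And>x. norm (adj A x) \<le> K * norm x" by (rule bounded_op_norm_bound[OF bounded_op_adj[OF A]]) blast
    \<comment> \<open>The tolerance is such that \<open>K\<^sup>2\<close> times it equals
      \<open>(r / 2)\<^sup>2\<close> in the estimate below.\<close>
    obtain F0 where F0: "finite F0" "F0 \<subseteq> onb0" "1 - (r / (2 * K))\<^sup>2 \<le> Re (f (fproj F0))"
      using tight[of "(r / (2 * K))\<^sup>2"] r K(1) by auto
    have est: "dist (\<Sum>e\<in>F. cinner e (\<eta> (A e))) (f A) < r" if F: "finite F" "F0 \<subseteq> F" "F \<subseteq> onb0" for F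
    proof -
      have onF: "orthonormal F" using F on orthonormal_subset by blast
      have pr: "projection (fproj F)" by (rule projection_fproj[OF F(1) onF])
      define N where "N = (\<lambda>x. x - fproj F x)"
      have pN: "positive_op N" unfolding N_def by (rule positive_op_projection_compl[OF pr])
      have bN: "bounded_op N" by (rule positive_op_bounded[OF pN])
      \<comment> \<open>As \<open>N\<close> is a projection, the second Cauchy-Schwarz factor is
        just the mass missed by \<open>F\<close>.\<close>
      have NN: "adj N \<circ> N = N"
        unfolding positive_op_adj[OF pN]
        by (simp add: N_def fun_eq_iff bounded_op_simps[OF bounded_op_fproj] fproj_idem[OF F(1) onF])
      have "fproj F = (\<lambda>x. (\<Sum>e\<in>F0. rank1 e e x) + (\<Sum>e\<in>F - F0. rank1 e e x))"
        unfolding fproj_def fun_eq_iff using F by (auto simp: sum.subset_diff add.commute)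
      then have "(\<lambda>x. fproj F x - fproj F0 x) = fproj (F - F0)" by (simp add: fproj_def)
      then have "Re (f (fproj F0)) \<le> Re (f (fproj F))"
        using op_state_mono[OF f, of "fproj F0" "fproj F"] positive_op_fproj[of "F - F0"] by simp
      moreover have "f N = 1 - f (fproj F)"
        unfolding N_def using op_state_simps(2)[OF f bounded_op_id bounded_op_fproj, of F] op_state_id[OF f] by simp
      ultimately have small: "Re (f N) \<le> (r / (2 * K))\<^sup>2" using F0(3) by simp
      have "f (A \<circ> fproj F) - f A = - f (adj (adj A) \<circ> N)"
      proof -
        have "(\<lambda>x. A x - (A \<circ> fproj F) x) = adj (adj A) \<circ> N"
          by (simp add: adj_adj[OF A] N_def fun_eq_iff bounded_op_simps[OF A])
        then show ?thesis
          using op_state_simps(2)[OF f A bounded_op_comp[OF A bounded_op_fproj], of F] by simp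
      qed
      then have "(dist (f (A \<circ> fproj F)) (f A))\<^sup>2 = (cmod (f (adj (adj A) \<circ> N)))\<^sup>2"
        by (simp add: dist_norm)
      also have "\<dots> \<le> Re (f (adj (adj A) \<circ> adj A)) * Re (f (adj N \<circ> N))"
        by (rule op_state_form(2)[OF f bounded_op_adj[OF A] bN])
      also have "\<dots> \<le> K\<^sup>2 * (r / (2 * K))\<^sup>2"
        unfolding NN
        by (intro mult_mono small op_state_adj_comp_le[OF f bounded_op_adj[OF A] K(2)])
          (use op_state_positive[OF f pN] in \<open>auto simp: nonneg_Reals_complex_iff\<close>)
      also have "\<dots> = (r / 2)\<^sup>2" unfolding power_mult_distrib[symmetric] using K(1) by simp
      finally have "dist (f (A \<circ> fproj F)) (f A) \<le> r / 2" by (rule power2_le_imp_le) (use r in simp)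
      then show ?thesis unfolding fsum[OF A] using r by simp
    qed
    show "\<forall>\<^sub>F F in finite_subsets_at_top onb0. dist (\<Sum>e\<in>F. cinner e (\<eta> (A e))) (f A) < r"
      unfolding eventually_finite_subsets_at_top using F0 est by blast
  qed
  have "density_op \<eta>"
    using density_opI[OF pos is_onb_onb0] hs[OF bounded_op_id] op_state_id[OF f] by simp
  moreover have "trace_op (\<eta> \<circ> A) = f A" if "bounded_op A" for A
    using infsumI[OF hs[OF that]] by (simp add: trace_op_onb0)
  ultimately show ?thesis using that by blast
qed

text \<open>Transfers mass from a finite-rank operator \<open>G\<close> below the identity to basis
  projections \<open>P\<close>: the compression \<open>P G P\<close> lies below \<open>P\<close>,
  and \<open>f (P G P)\<close> tends to \<open>f G\<close>, because \<open>f (rank1 y x)\<close>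
  depends continuously on both vectors.\<close>

lemma op_state_finite_rank_tight:
  fixes s :: "'i \<Rightarrow> 'a::complex_hilbert"
  assumes f: "op_state f" and I: "finite I"
    and le: "positive_op (\<lambda>x. x - (\<Sum>i\<in>I. rank1 (s i) (s i) x))"
    and c: "c < Re (f (\<lambda>x. \<Sum>i\<in>I. rank1 (s i) (s i) x))"
  shows "\<exists>F. finite F \<and> F \<subseteq> onb0 \<and> c \<le> Re (f (fproj F))"
proof -
  have on: "orthonormal (onb0 :: 'a set)" by (rule orthonormal_onb[OF is_onb_onb0])
  have bb: "bounded_bilinear (\<lambda>y x. f (rank1 y x))"
  proof
    fix a b x y :: 'a and r
    show "f (rank1 (a + b) x) = f (rank1 a x) + f (rank1 b x)"
      using op_state_simps(1)[OF f bounded_op_rank1 bounded_op_rank1, of a x b x]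
      by (simp add: rank1_def scaleC_add_right)
    show "f (rank1 x (a + b)) = f (rank1 x a) + f (rank1 x b)"
      using op_state_simps(1)[OF f bounded_op_rank1 bounded_op_rank1, of x a x b]
      by (simp add: rank1_def scaleC_add_left cinner_add_left)
    have "rank1 (r *\<^sub>R a) x = (\<lambda>u. complex_of_real r *\<^sub>C rank1 a x u)" "rank1 x (r *\<^sub>R a) = (\<lambda>u. complex_of_real r *\<^sub>C rank1 x a u)"
      by (simp_all add: rank1_def cinner.scaleR_left scaleC.scaleR_right scaleC.scaleR_left scaleC_of_real fun_eq_iff)
    then show "f (rank1 (r *\<^sub>R a) x) = r *\<^sub>R f (rank1 a x)" "f (rank1 x (r *\<^sub>R a)) = r *\<^sub>R f (rank1 x a)"
      by (simp_all add: op_state_simps(3)[OF f bounded_op_rank1 bounded_op_rank1] scaleR_conv_of_real)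
    show "\<exists>K. \<forall>a b. norm (f (rank1 a b)) \<le> norm a * norm b * K"
      by (rule exI[of _ 1]) (use op_state_norm_le[OF f bounded_op_rank1 norm_rank1_le] in auto)
  qed
  let ?G = "\<lambda>x. \<Sum>i\<in>I. rank1 (s i) (s i) x"
  have "((\<lambda>F. \<Sum>i\<in>I. f (rank1 (fproj F (s i)) (fproj F (s i)))) \<longlongrightarrow> (\<Sum>i\<in>I. f (rank1 (s i) (s i)))) (finite_subsets_at_top onb0)"
    by (intro tendsto_intros bounded_bilinear.tendsto[OF bb] fproj_tendsto[OF is_onb_onb0])
  then have "((\<lambda>F. Re (\<Sum>i\<in>I. f (rank1 (fproj F (s i)) (fproj F (s i))))) \<longlongrightarrow> Re (\<Sum>i\<in>I. f (rank1 (s i) (s i)))) (finite_subsets_at_top onb0)"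
    by (rule tendsto_Re)
  moreover have fs: "f (\<lambda>x. \<Sum>i\<in>I. rank1 (u i) (u i) x) = (\<Sum>i\<in>I. f (rank1 (u i) (u i)))" for u
    by (rule op_state_sum[OF f]) simp
  have "c < Re (\<Sum>i\<in>I. f (rank1 (s i) (s i)))"
    using c unfolding fs .
  ultimately have "eventually (\<lambda>F. c < Re (\<Sum>i\<in>I. f (rank1 (fproj F (s i)) (fproj F (s i))))) (finite_subsets_at_top onb0)"
    by (rule order_tendstoD(1))
  then obtain F where F: "finite F" "F \<subseteq> onb0" "c < Re (\<Sum>i\<in>I. f (rank1 (fproj F (s i)) (fproj F (s i))))"
    unfolding eventually_finite_subsets_at_top by blast
  have onF: "orthonormal F" using F on orthonormal_subset by blast
  have bP: "bounded_op (fproj F)" by simp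
  have symP: "cinner (fproj F x) y = cinner x (fproj F y)" for x y
    by (rule positive_op_symmetric[OF positive_op_fproj])
  have "positive_op (\<lambda>x. fproj F x - (\<Sum>i\<in>I. rank1 (fproj F (s i)) (fproj F (s i)) x))"
  proof -
    have "cinner x (fproj F x - (\<Sum>i\<in>I. rank1 (fproj F (s i)) (fproj F (s i)) x)) =
        cinner (fproj F x) (fproj F x - ?G (fproj F x))" for x
      by (simp add: cinner_diff_right cinner.sum_right cinner_rank1 symP fproj_idem[OF F(1) onF])
    then show ?thesis
      using le bounded_op_diff[OF bP bounded_op_sum, of I "\<lambda>i. rank1 (fproj F (s i)) (fproj F (s i))"]
      by (auto simp: positive_op_def)
  qed
  from op_state_mono[OF f bounded_op_sum bP this]
  have "Re (\<Sum>i\<in>I. f (rank1 (fproj F (s i)) (fproj F (s i)))) \<le> Re (f (fproj F))"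
    unfolding fs by simp
  then show ?thesis using F by (meson less_imp_le less_le_trans)
qed

section \<open>Normality and the predual map\<close>

lemma continuous_map_trace_op:
  assumes "trace_class \<tau>"
  shows "continuous_map weak_star euclidean (\<lambda>A. trace_op (\<tau> \<circ> A))"
  unfolding continuous_map_def
proof (intro conjI allI impI)
  fix U :: "complex set" assume "openin euclidean U"
  then have U: "open U" by simp
  have b: "bounded_op A" if "A \<in> topspace weak_star" for A :: "'a \<Rightarrow> 'a"
    using that unfolding weak_star_def topology_generated_by_topspace by blast
  have o: "openin weak_star {A. bounded_op A \<and> trace_op (\<tau> \<circ> A) \<in> U}"
    unfolding weak_star_def by (rule topology_generated_by_Basis) (use U assms in blast)
  have "{A \<in> topspace weak_star. trace_op (\<tau> \<circ> A) \<in> U} = {A. bounded_op A \<and> trace_op (\<tau> \<circ> A) \<in> U}"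
    using b openin_subset[OF o] by auto
  then show "openin weak_star {A \<in> topspace weak_star. trace_op (\<tau> \<circ> A) \<in> U}" using o by simp
qed simp

lemma trace_op_fproj_tendsto:
  fixes \<tau> :: "'a::complex_hilbert \<Rightarrow> 'a"
  assumes "trace_class \<tau>"
  shows "((\<lambda>F. trace_op (\<tau> \<circ> fproj F)) \<longlongrightarrow> trace_op \<tau>) (finite_subsets_at_top onb0)"
proof -
  have on: "orthonormal (onb0 :: 'a set)" by (rule orthonormal_onb[OF is_onb_onb0])
  have b\<tau>: "bounded_op \<tau>" using assms by (simp add: trace_class_def)
  have "((\<lambda>e. cinner e (\<tau> e)) has_sum trace_op \<tau>) onb0"
    unfolding trace_op_onb0 using trace_class_summable[OF assms is_onb_onb0] by simp
  moreover have "(\<Sum>e\<in>F. cinner e (\<tau> e)) = trace_op (\<tau> \<circ> fproj F)" if F: "finite F" "F \<subseteq> onb0" for F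
  proof -
    have "((\<lambda>e. cinner e (\<tau> (fproj F e))) has_sum (\<Sum>e\<in>F. cinner e (\<tau> e))) onb0"
    proof (rule has_sum_finite_neutralI[where B = F])
      show "cinner e (\<tau> (fproj F e)) = 0" if "e \<in> onb0 - F" for e
        using fproj_notin[OF on F(2)] that bounded_op_simps(4)[OF b\<tau>] by simp
      show "(\<Sum>e\<in>F. cinner e (\<tau> e)) = (\<Sum>e\<in>F. cinner e (\<tau> (fproj F e)))"
        by (intro sum.cong) (use fproj_in[OF F(1) orthonormal_subset[OF on F(2)]] in auto)
    qed (use F in auto)
    then show ?thesis by (simp add: trace_op_onb0 infsumI)
  qed
  then have "\<forall>\<^sub>F F in finite_subsets_at_top onb0. (\<Sum>e\<in>F. cinner e (\<tau> e)) = trace_op (\<tau> \<circ> fproj F)"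
    by (intro eventually_finite_subsets_at_top_weakI)
  ultimately show ?thesis
    unfolding has_sum_def by (rule Lim_transform_eventually)
qed

text \<open>Weak* convergence of the finite basis projections to the identity. As the topology is
  given by a subbasis, the proof is by induction over the generation of the open set.\<close>

lemma eventually_fproj_in_weak_star:
  assumes "openin weak_star U" "id \<in> U"
  shows "\<forall>\<^sub>F F in finite_subsets_at_top onb0. fproj F \<in> U"
proof -
  have "generate_topology_on {{A. bounded_op A \<and> trace_op (\<rho> \<circ> A) \<in> U} | \<rho> U. trace_class \<rho> \<and> open U} U"
    using assms(1) unfolding weak_star_def by (simp add: openin_topology_generated_by_iff)
  then show ?thesis using assms(2)
  proof (induction U)
    case (Int a b) then show ?case by (auto intro: eventually_conj)
  next
    case (UN K)
    then obtain k where k: "k \<in> K" "id \<in> k" by blast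
    from UN.IH[OF this] show ?case by (rule eventually_mono) (use k in blast)
  next
    case (Basis s)
    then obtain \<tau> V where s: "s = {A. bounded_op A \<and> trace_op (\<tau> \<circ> A) \<in> V}" "trace_class \<tau>" "open V" by blast
    have "trace_op (\<tau> \<circ> id) \<in> V" using Basis.prems unfolding s(1) by blast
    then have "trace_op \<tau> \<in> V" by simp
    then have "\<forall>\<^sub>F F in finite_subsets_at_top onb0. trace_op (\<tau> \<circ> fproj F) \<in> V"
      using trace_op_fproj_tendsto[OF s(2)] s(3) by (simp add: tendsto_def)
    then show ?case unfolding s(1) by (rule eventually_mono) simp
  qed simp
qed

text \<open>The functional \<open>trace_op (\<rho> \<circ> \<Phi> A)\<close> of \<open>A\<close> is
  a state and, \<open>\<Phi>\<close> being normal, weak* continuous. Its values at the finite basis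
  projections therefore approach \<open>1\<close>, which is the tightness that yields a
  density.\<close>

lemma predual_density:
  fixes \<rho> :: "'a::complex_hilbert \<Rightarrow> 'a"
  assumes \<rho>: "density_op \<rho>" and \<Phi>: "completely_positive \<Phi>" "normal_map \<Phi>" "\<Phi> id = id"
  shows "density_op (predual \<Phi> \<rho>)"
    "\<And>A. bounded_op A \<Longrightarrow> trace_op (predual \<Phi> \<rho> \<circ> A) = trace_op (\<rho> \<circ> \<Phi> A)"
proof -
  define f where "f = (\<lambda>A. trace_op (\<rho> \<circ> \<Phi> A))"
  have f: "op_state f" unfolding f_def by (rule op_state_comp[OF op_state_density[OF \<rho>] \<Phi>(1,3)])
  have cm: "continuous_map weak_star euclidean f"
    using continuous_map_compose[OF \<Phi>(2)[unfolded normal_map_def] continuous_map_trace_op[OF density_op_trace_class[OF \<rho>]]]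
    by (simp add: f_def o_def)
  have tight: "\<exists>F. finite F \<and> F \<subseteq> onb0 \<and> 1 - \<epsilon> \<le> Re (f (fproj F))" if e: "\<epsilon> > 0" for \<epsilon>
  proof -
    define U where "U = {A \<in> topspace weak_star. f A \<in> ball 1 \<epsilon>}"
    have "openin weak_star U" unfolding U_def
      by (rule openin_continuous_map_preimage[OF cm]) simp
    moreover have "openin weak_star {A. bounded_op A \<and> trace_op (\<rho> \<circ> A) \<in> UNIV}"
      unfolding weak_star_def by (rule topology_generated_by_Basis) (use density_op_trace_class[OF \<rho>] open_UNIV in blast)
    from openin_subset[OF this] have "(id :: 'a \<Rightarrow> 'a) \<in> topspace weak_star" by (rule subsetD) simp
    then have "id \<in> U" using e by (simp add: U_def op_state_id[OF f])
    ultimately have "\<forall>\<^sub>F F in finite_subsets_at_top onb0. fproj F \<in> U" by (rule eventually_fproj_in_weak_star)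
    then obtain F where F: "finite F" "F \<subseteq> onb0" "fproj F \<in> U"
      unfolding eventually_finite_subsets_at_top by blast
    then have "cmod (1 - f (fproj F)) < \<epsilon>" by (simp add: U_def dist_norm)
    then have "1 - \<epsilon> \<le> Re (f (fproj F))" using complex_Re_le_cmod[of "1 - f (fproj F)"] by simp
    then show ?thesis using F by blast
  qed
  obtain \<eta> where \<eta>: "density_op \<eta>" "\<And>A. bounded_op A \<Longrightarrow> trace_op (\<eta> \<circ> A) = f A"
    using op_state_normal[OF f tight] by metis
  have "predual \<Phi> \<rho> = \<eta>"
    unfolding predual_def
  proof (rule the_equality)
    show "trace_class \<eta> \<and> (\<forall>A. bounded_op A \<longrightarrow> trace_op (\<eta> \<circ> A) = trace_op (\<rho> \<circ> \<Phi> A))"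
      using \<eta> density_op_trace_class by (auto simp: f_def)
    fix \<eta>' assume "trace_class \<eta>' \<and> (\<forall>A. bounded_op A \<longrightarrow> trace_op (\<eta>' \<circ> A) = trace_op (\<rho> \<circ> \<Phi> A))"
    then show "\<eta>' = \<eta>" using \<eta> density_op_bounded
      by (intro trace_op_eqD) (auto simp: f_def trace_class_def)
  qed
  then show "density_op (predual \<Phi> \<rho>)"
    "\<And>A. bounded_op A \<Longrightarrow> trace_op (predual \<Phi> \<rho> \<circ> A) = trace_op (\<rho> \<circ> \<Phi> A)"
    using \<eta> by (auto simp: f_def)
qed

section \<open>Quantum Markov semigroups\<close>

lemma qmsD:
  assumes "qms T" "0 \<le> t"
  shows "completely_positive (T t)" "normal_map (T t)" "T t id = id"
  using assms by (auto simp: qms_def)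

lemma qms_add: "qms T \<Longrightarrow> 0 \<le> s \<Longrightarrow> 0 \<le> t \<Longrightarrow> bounded_op A \<Longrightarrow> T (s + t) A = T s (T t A)"
  by (simp add: qms_def)

lemma qms_bounded: "qms T \<Longrightarrow> 0 \<le> t \<Longrightarrow> bounded_op A \<Longrightarrow> bounded_op (T t A)"
  using completely_positive_linear(1)[OF qmsD(1)] by blast

lemma qms_diff:
  assumes "qms T" "0 \<le> t" "bounded_op A" "bounded_op B"
  shows "T t (\<lambda>x. A x - B x) = (\<lambda>x. T t A x - T t B x)"
  using completely_positive_linear(2)[OF qmsD(1)[OF assms(1,2)] assms(3,4), of 1 "-1"] by (simp add: scaleC_minus1)

lemma qms_continuous:
  assumes "qms T" "trace_class \<rho>" "bounded_op A"
  shows "continuous_on {0..} (\<lambda>t. trace_op (\<rho> \<circ> T t A))"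
proof -
  have "continuous_map (top_of_set {0..}) weak_star (\<lambda>t. T t A)" using assms by (auto simp: qms_def)
  from continuous_map_compose[OF this continuous_map_trace_op[OF assms(2)]]
  have "continuous_map (top_of_set {0..}) euclidean (\<lambda>t. trace_op (\<rho> \<circ> T t A))"
    unfolding o_def .
  then show ?thesis by (simp only: continuous_map_iff_continuous)
qed

lemma qms_predual:
  assumes "qms T" "0 \<le> t" "density_op \<rho>"
  shows "density_op (predual (T t) \<rho>)"
    "\<And>A. bounded_op A \<Longrightarrow> trace_op (predual (T t) \<rho> \<circ> A) = trace_op (\<rho> \<circ> T t A)"
  using predual_density[OF assms(3) qmsD[OF assms(1,2)]] by blast+

lemma invariant_stateI:
  assumes "qms T" "density_op \<rho>"
    and inv: "\<And>t A. 0 \<le> t \<Longrightarrow> bounded_op A \<Longrightarrow> trace_op (\<rho> \<circ> T t A) = trace_op (\<rho> \<circ> A)"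
  shows "invariant_state T \<rho>"
  unfolding invariant_state_def
proof (intro conjI allI impI assms(2))
  fix t :: real assume t: "0 \<le> t"
  show "predual (T t) \<rho> = \<rho>"
    by (rule trace_op_eqD)
      (auto simp: density_op_bounded assms(2) qms_predual[OF assms(1) t assms(2)] inv[OF t])
qed

lemma invariant_state_trace:
  assumes "qms T" "invariant_state T \<rho>" "0 \<le> t" "bounded_op A"
  shows "trace_op (\<rho> \<circ> T t A) = trace_op (\<rho> \<circ> A)"
  using qms_predual(2)[OF assms(1,3) _ assms(4), of \<rho>] assms by (simp add: invariant_state_def)

text \<open>Along an invariant state the integrand is constant, and only the constant
  \<open>0\<close> has a finite integral over the half-line. Positivity upgrades the zero trace to
  \<open>q \<circ> \<rho> = 0\<close>.\<close>

lemma bounded_potential_orth_invariant: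
  assumes inv: "invariant_state T \<rho>" and q: "projection q"
    and pot: "(\<integral>\<^sup>+ s \<in> {0..}. ennreal (Re (trace_op (predual (T s) \<rho> \<circ> q))) \<partial>lborel) \<le> ennreal C"
  shows "q (\<rho> x) = 0"
proof -
  have \<rho>: "density_op \<rho>" and pre: "\<And>t. 0 \<le> t \<Longrightarrow> predual (T t) \<rho> = \<rho>"
    using inv by (auto simp: invariant_state_def)
  define c where "c = Re (trace_op (\<rho> \<circ> q))"
  have c0: "0 \<le> c"
    using op_state_positive[OF op_state_density[OF \<rho>] positive_op_projection[OF q]]
    by (simp add: c_def nonneg_Reals_complex_iff)
  have le: "c * real n \<le> \<bar>C\<bar>" for n
  proof -
    have "ennreal (c * real n) = ennreal c * emeasure lborel {0..real n}"
      using c0 by (simp add: ennreal_mult)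
    also have "\<dots> = (\<integral>\<^sup>+ s. ennreal c * indicator {0..real n} s \<partial>lborel)"
      by (rule nn_integral_cmult_indicator[symmetric]) simp
    also have "\<dots> \<le> (\<integral>\<^sup>+ s \<in> {0..}. ennreal (Re (trace_op (predual (T s) \<rho> \<circ> q))) \<partial>lborel)"
      by (rule nn_integral_mono) (auto simp: pre c_def split: split_indicator)
    also have "\<dots> \<le> ennreal \<bar>C\<bar>" by (rule order_trans[OF pot]) (simp add: ennreal_leI)
    finally show ?thesis by simp
  qed
  have "c = 0"
  proof (rule ccontr)
    assume "c \<noteq> 0"
    then have "c > 0" using c0 by simp
    then obtain n where "\<bar>C\<bar> < real n * c" using ex_less_of_nat_mult by blast
    then show False using le[of n] by (simp add: mult.commute)
  qed
  then show ?thesis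
    using trace_op_positive_eq_0[OF \<rho> positive_op_projection[OF q]] by (simp add: c_def)
qed

lemma transient_subset_orth_recurrent: "transient T \<subseteq> orth (positive_recurrent T)"
  unfolding transient_def
proof (rule csup_least[OF closed_csubspace_orth])
  fix V assume "V \<in> {range p | p. projection p \<and>
     (\<exists>C>0. \<forall>\<rho>. density_op \<rho> \<longrightarrow>
        (\<integral>\<^sup>+ s \<in> {0..}. ennreal (Re (trace_op (predual (T s) \<rho> \<circ> p))) \<partial>lborel) \<le> ennreal C)}"
  then obtain p C where V: "V = range p" and p: "projection p"
    and C: "\<And>\<rho>. density_op \<rho> \<Longrightarrow>
        (\<integral>\<^sup>+ s \<in> {0..}. ennreal (Re (trace_op (predual (T s) \<rho> \<circ> p))) \<partial>lborel) \<le> ennreal C"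
    by blast
  have "positive_recurrent T \<subseteq> {x. p x = 0}"
    unfolding positive_recurrent_def
  proof (rule csup_least)
    have bp: "bounded_op p" using p by (simp add: projection_iff)
    show cl: "closed_csubspace {x. p x = 0}" by (rule closed_csubspace_ker[OF bp])
    fix W assume "W \<in> {supp \<rho> | \<rho>. invariant_state T \<rho>}"
    then obtain \<rho> where W: "W = supp \<rho>" and \<rho>: "invariant_state T \<rho>" by blast
    have "density_op \<rho>" using \<rho> by (simp add: invariant_state_def)
    from bounded_potential_orth_invariant[OF \<rho> p C[OF this]]
    have "range \<rho> \<subseteq> {x. p x = 0}" by blast
    then show "W \<subseteq> {x. p x = 0}"
      unfolding W supp_def by (rule closure_minimal) (use cl in \<open>simp add: closed_csubspace_def\<close>)
  qed
  then have "cinner y (p x) = 0" if "y \<in> positive_recurrent T" for x y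
  proof -
    have "p y = 0" using that \<open>positive_recurrent T \<subseteq> {x. p x = 0}\<close> by blast
    moreover have "cinner y (p x) = cinner (p y) x" using p by (simp add: projection_iff)
    ultimately show ?thesis by simp
  qed
  then show "V \<subseteq> orth (positive_recurrent T)" by (auto simp: V orth_def)
qed

lemma supp_subset_positive_recurrent: "invariant_state T \<rho> \<Longrightarrow> supp \<rho> \<subseteq> positive_recurrent T"
  unfolding positive_recurrent_def by (rule csup_upper) blast

text \<open>\<open>p\<close> fixes the range of \<open>\<rho>\<close>, so
  \<open>p \<circ> \<rho> = \<rho>\<close>; the claim is the adjoint of this identity.\<close>

lemma density_op_comp_projection:
  assumes \<rho>: "density_op \<rho>" and p: "projection p" and sub: "supp \<rho> \<subseteq> range p"
  shows "\<rho> \<circ> p = \<rho>"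
proof
  fix x
  have pr: "p (\<rho> x) = \<rho> x" for x
  proof -
    have "\<rho> x \<in> closure (range \<rho>)" by (rule subsetD[OF closure_subset rangeI])
    then obtain z where "\<rho> x = p z" using sub unfolding supp_def by blast
    then show ?thesis using p by (simp add: projection_iff)
  qed
  show "(\<rho> \<circ> p) x = \<rho> x"
  proof (rule cinner_eqI)
    fix z
    have "cinner z (\<rho> (p x)) = cinner (p (\<rho> z)) x"
      using p positive_op_symmetric[OF density_op_positive[OF \<rho>]] by (simp add: projection_iff)
    then show "cinner z ((\<rho> \<circ> p) x) = cinner z (\<rho> x)"
      by (simp add: pr positive_op_symmetric[OF density_op_positive[OF \<rho>]])
  qed
qed

text \<open>For invariant \<open>\<rho>\<close> the operator \<open>B = T h p\<close> has
  expectation \<open>1\<close> and lies below the identity, so \<open>1 - B\<close> kills the range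
  of \<open>\<rho>\<close>. Hence \<open>B\<close> acts as the identity on the recurrent
  subspace.\<close>

lemma positive_recurrent_subharmonic:
  assumes T: "qms T" and h: "0 \<le> h" and p: "projection p" "range p = positive_recurrent T"
  shows "positive_op (\<lambda>x. T h p x - p x)"
proof -
  have bp: "bounded_op p" using p(1) by (simp add: projection_iff)
  define B where "B = T h p"
  have pB: "positive_op B"
    unfolding B_def by (rule completely_positive_positive[OF qmsD(1)[OF T h] positive_op_projection[OF p(1)]])
  have bB: "bounded_op B" by (rule positive_op_bounded[OF pB])
  have "T h (\<lambda>x. id x - p x) = (\<lambda>x. id x - B x)"
    unfolding qms_diff[OF T h bounded_op_id bp] by (simp add: B_def qmsD(3)[OF T h])
  moreover have "positive_op (\<lambda>x. id x - p x)" using positive_op_projection_compl[OF p(1)] by simp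
  ultimately have pN: "positive_op (\<lambda>x. id x - B x)"
    using completely_positive_positive[OF qmsD(1)[OF T h]] by metis
  have bN: "bounded_op (\<lambda>x. id x - B x)" by (rule positive_op_bounded[OF pN])
  have "positive_recurrent T \<subseteq> {x. id x - B x = 0}"
    unfolding positive_recurrent_def
  proof (rule csup_least)
    show cl: "closed_csubspace {x. id x - B x = 0}" by (rule closed_csubspace_ker[OF bN])
    fix W assume "W \<in> {supp \<rho> | \<rho>. invariant_state T \<rho>}"
    then obtain \<rho> where W: "W = supp \<rho>" and inv: "invariant_state T \<rho>" by blast
    have \<rho>: "density_op \<rho>" using inv by (simp add: invariant_state_def)
    have "trace_op (\<rho> \<circ> B) = trace_op (\<rho> \<circ> p)"
      unfolding B_def by (rule invariant_state_trace[OF T inv h bp])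
    also have "\<rho> \<circ> p = \<rho>"
      by (rule density_op_comp_projection[OF \<rho> p(1)]) (use supp_subset_positive_recurrent[OF inv] p(2) in simp)
    also have "trace_op \<rho> = 1" using \<rho> by (simp add: density_op_def)
    finally have "trace_op (\<rho> \<circ> B) = 1" .
    then have "trace_op (\<rho> \<circ> (\<lambda>x. id x - B x)) = 0"
      unfolding op_state_simps(2)[OF op_state_density[OF \<rho>] bounded_op_id bB] op_state_id[OF op_state_density[OF \<rho>]]
      by (simp only: diff_self)
    then have 0: "Re (trace_op (\<rho> \<circ> (\<lambda>x. id x - B x))) = 0" by (simp only: zero_complex.simps)
    have "id (\<rho> x) - B (\<rho> x) = 0" for x by (rule trace_op_positive_eq_0[OF \<rho> pN 0])
    then have "range \<rho> \<subseteq> {x. id x - B x = 0}" by blast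
    then show "W \<subseteq> {x. id x - B x = 0}"
      unfolding W supp_def by (rule closure_minimal) (use cl in \<open>simp add: closed_csubspace_def\<close>)
  qed
  then have By: "B (p x) = p x" for x
  proof -
    have "p x \<in> positive_recurrent T" using p(2) by blast
    then have "id (p x) - B (p x) = 0" using \<open>positive_recurrent T \<subseteq> {x. id x - B x = 0}\<close> by blast
    then show ?thesis by simp
  qed
  \<comment> \<open>Since \<open>B\<close> fixes the range of \<open>p\<close>, the difference
    \<open>B - p\<close> is the compression of \<open>B\<close> to the orthogonal complement, which
    is positive.\<close>
  have "cinner x (B x - p x) = cinner (x - p x) (B (x - p x))" for x
  proof -
    have 1: "cinner (p x) (B z) = cinner (p x) z" for z
      using positive_op_symmetric[OF pB, of "p x" z] By by simp
    have 2: "cinner z (B (p x)) = cinner z (p x)" for z by (simp add: By)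
    have 3: "cinner x (p x) = cinner (p x) (p x)" "cinner (p x) x = cinner (p x) (p x)"
      using p(1) by (simp_all add: projection_iff)
    show ?thesis
      unfolding bounded_op_simps[OF bB] cinner_diff_left cinner_diff_right 1 2 3 by simp
  qed
  then show ?thesis
    using pB bounded_op_diff[OF bB bp] unfolding B_def[symmetric] by (simp add: positive_op_def)
qed

text \<open>Over \<open>{0..n}\<close> the overlap cancels and leaves the integral over
  \<open>{n..n + h}\<close> minus that over \<open>{0..h}\<close>, at most \<open>K * h\<close>;
  monotone convergence passes to the half-line.\<close>

lemma nn_integral_telescope:
  fixes g :: "real \<Rightarrow> real"
  assumes cont: "continuous_on {0..} g" and mono: "\<And>s. 0 \<le> s \<Longrightarrow> g s \<le> g (s + h)"
    and bd: "\<And>s. 0 \<le> s \<Longrightarrow> 0 \<le> g s" "\<And>s. 0 \<le> s \<Longrightarrow> g s \<le> K" and h: "0 \<le> h"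
  shows "(\<integral>\<^sup>+ s \<in> {0..}. ennreal (g (s + h) - g s) \<partial>lborel) \<le> ennreal (K * h)"
proof -
  let ?f = "\<lambda>s. g (s + h) - g s"
  let ?F = "\<lambda>n s. ennreal (?f s) * indicator {0..real n} s"
  have contf: "continuous_on {0..a} ?f" for a
    by (intro continuous_intros continuous_on_compose2[OF cont]) (use h in auto)
  have int: "g integrable_on {a..b}" if "0 \<le> a" for a b
    by (intro integrable_continuous_interval continuous_on_subset[OF cont]) (use that in auto)
  have Fn: "integral\<^sup>N lborel (?F n) \<le> ennreal (K * h)" for n :: nat
  proof -
    have "(?f has_integral integral {0..real n} ?f) {0..real n}"
      by (intro integrable_integral integrable_continuous_interval contf)
    then have "integral\<^sup>N lborel (?F n) = ennreal (integral {0..real n} ?f)"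
      by (rule nn_integral_has_integral_lebesgue'[rotated]) (use mono in auto)
    also have "integral {0..real n} ?f = integral {0..real n} (\<lambda>s. g (s + h)) - integral {0..real n} g"
      by (intro integral_diff int integrable_continuous_interval continuous_on_compose2[OF cont])
        (use h in \<open>auto intro!: continuous_intros\<close>)
    also have "integral {0..real n} (\<lambda>s. g (s + h)) = integral {h..real n + h} g"
      using integral_shift_real_ivl[of h h "real n + h" g] by simp
    also have "\<dots> - integral {0..real n} g = integral {real n..real n + h} g - integral {0..h} g"
      using Henstock_Kurzweil_Integration.integral_combine[where f = g and a = 0 and c = h and b = "real n + h"]
        Henstock_Kurzweil_Integration.integral_combine[where f = g and a = 0 and c = "real n" and b = "real n + h"] int[of 0 "real n + h"] h by simp
    also have "\<dots> \<le> K * h"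
    proof -
      have "integral {real n..real n + h} g \<le> integral {real n..real n + h} (\<lambda>_. K)"
        by (intro integral_le int) (use bd h in auto)
      moreover have "0 \<le> integral {0..h} g" by (intro integral_nonneg int) (use bd in auto)
      ultimately show ?thesis using h by (simp add: mult.commute)
    qed
    finally show ?thesis by (simp add: ennreal_leI)
  qed
  have lim: "(SUP n. ?F n s) = ennreal (?f s) * indicator {0..} s" for s
  proof (rule LIMSEQ_unique[OF LIMSEQ_SUP])
    obtain n where n: "s < real n" using reals_Archimedean2[of s] ..
    have "eventually (\<lambda>n. ?F n s = ennreal (?f s) * indicator {0..} s) sequentially"
      by (rule eventually_mono[OF eventually_ge_at_top[of n]]) (use n in \<open>auto split: split_indicator\<close>)
    then show "(\<lambda>n. ?F n s) \<longlonglongrightarrow> ennreal (?f s) * indicator {0..} s" by (rule tendsto_eventually)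
  qed (auto simp: incseq_def split: split_indicator)
  have meas: "?F n \<in> borel_measurable lborel" for n
  proof -
    have "(\<lambda>s. ennreal (indicator {0..real n} s *\<^sub>R ?f s)) \<in> borel_measurable borel"
      by (intro measurable_compose[OF borel_measurable_continuous_on_indicator[OF _ contf] measurable_ennreal]) simp
    also have "(\<lambda>s. ennreal (indicator {0..real n} s *\<^sub>R ?f s)) = ?F n"
      by (auto simp: fun_eq_iff split: split_indicator)
    finally show ?thesis by simp
  qed
  have "(\<integral>\<^sup>+ s \<in> {0..}. ennreal (?f s) \<partial>lborel) = (\<integral>\<^sup>+ s. (SUP n. ?F n s) \<partial>lborel)"
    unfolding lim ..
  also have "\<dots> = (SUP n. integral\<^sup>N lborel (?F n))"
    by (rule nn_integral_monotone_convergence_SUP[OF _ meas])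
      (auto simp: incseq_def le_fun_def split: split_indicator)
  also have "\<dots> \<le> ennreal (K * h)" using Fn by (rule SUP_least)
  finally show ?thesis .
qed

text \<open>The operator \<open>T h p - p\<close> has bounded potential, and each vector in its range spans a
  projection dominated by a multiple of it, by the Cauchy-Schwarz inequality for its form.\<close>

lemma range_subharmonic_subset_transient:
  assumes T: "qms T" and h: "0 \<le> h" and p: "projection p"
    and sub: "positive_op (\<lambda>x. T h p x - p x)"
  shows "T h p w - p w \<in> transient T"
proof (cases "T h p w - p w = 0")
  case True
  moreover have "0 \<in> transient T"
    using closed_csubspace_csup unfolding transient_def closed_csubspace_def by blast
  ultimately show ?thesis by simp
next
  case False
  define A where "A = (\<lambda>x. T h p x - p x)"
  define y where "y = A w"
  have y0: "y \<noteq> 0" using False by (simp add: y_def A_def)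
  have pA: "positive_op A" using sub by (simp add: A_def)
  have bA: "bounded_op A" by (rule positive_op_bounded[OF pA])
  have bp: "bounded_op p" using p by (simp add: projection_iff)
  have bTp: "bounded_op (T h p)" by (rule qms_bounded[OF T h bp])
  define u where "u = complex_of_real (1 / norm y) *\<^sub>C y"
  have nu: "norm u = 1" using y0 by (simp add: u_def norm_scaleC norm_divide)
  define q where "q = rank1 u u"
  have uu: "cinner u u = 1" by (simp add: cinner_self nu)
  have pq: "projection q"
    unfolding projection_iff q_def
  proof (intro conjI allI)
    show "rank1 u u (rank1 u u x) = rank1 u u x" for x by (simp add: rank1_def cinner_simps uu)
    show "cinner (rank1 u u x) z = cinner x (rank1 u u z)" for x z
      by (rule positive_op_symmetric[OF positive_op_rank1])
  qed simp
  \<comment> \<open>The constant in Cauchy-Schwarz for the form of \<open>A\<close> at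
    \<open>x\<close> and \<open>w\<close>, after normalizing \<open>y = A w\<close>.\<close>
  define K where "K = Re (cinner w (A w)) / (norm y)\<^sup>2"
  have K0: "0 \<le> K" unfolding K_def using positive_op_Re_nonneg[OF pA] by simp
  have dom: "(cmod (cinner u x))\<^sup>2 \<le> K * Re (cinner x (A x))" for x
  proof -
    have "(cmod (cinner u x))\<^sup>2 = (cmod (cinner y x))\<^sup>2 / (norm y)\<^sup>2"
      by (simp add: u_def cinner_simps norm_mult norm_divide power_divide)
    also have "cmod (cinner y x) = cmod (cinner x (A w))"
      unfolding y_def by (metis cinner_commute complex_mod_cnj)
    also have "(cmod (cinner x (A w)))\<^sup>2 \<le> Re (cinner x (A x)) * Re (cinner w (A w))"
      by (rule positive_op_form(2)[OF pA])
    finally show ?thesis using y0 by (simp add: K_def divide_right_mono mult.commute)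
  qed
  have bKA: "bounded_op (\<lambda>x. complex_of_real K *\<^sub>C A x)" by (rule bounded_op_scaleC[OF bA])
  have le: "positive_op (\<lambda>x. complex_of_real K *\<^sub>C A x - q x)"
  proof -
    have "cinner x (complex_of_real K *\<^sub>C A x - q x) = complex_of_real (K * Re (cinner x (A x)) - (cmod (cinner u x))\<^sup>2)" for x
      unfolding q_def cinner_diff_right cinner_rank1_self cinner_scaleC_right
      by (subst positive_op_cinner_real[OF pA]) simp
    moreover have "bounded_op (\<lambda>x. complex_of_real K *\<^sub>C A x - q x)"
      by (rule bounded_op_diff[OF bKA]) (simp add: q_def)
    ultimately show ?thesis using dom by (simp add: positive_op_def nonneg_Reals_complex_iff)
  qed
  have pot: "(\<integral>\<^sup>+ s \<in> {0..}. ennreal (Re (trace_op (predual (T s) \<rho> \<circ> q))) \<partial>lborel) \<le> ennreal (K * h)"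
    if \<rho>: "density_op \<rho>" for \<rho>
  proof -
    \<comment> \<open>The increments of \<open>g\<close> over time \<open>h\<close> are
      \<open>K\<close> times the expectations of \<open>A\<close>, which dominate those of
      \<open>q\<close>.\<close>
    define g where "g s = K * Re (trace_op (\<rho> \<circ> T s p))" for s
    have st: "op_state (\<lambda>A. trace_op (\<rho> \<circ> T s A))" if "0 \<le> s" for s
      by (rule op_state_comp[OF op_state_density[OF \<rho>] qmsD(1,3)[OF T that]])
    have diff: "g (s + h) - g s = K * Re (trace_op (predual (T s) \<rho> \<circ> A))" if s: "0 \<le> s" for s
      unfolding g_def qms_add[OF T s h bp] qms_predual(2)[OF T s \<rho> bA]
      unfolding A_def op_state_simps(2)[OF st[OF s] bTp bp] by (simp add: algebra_simps)
    have nn: "0 \<le> Re (trace_op (\<rho> \<circ> T s B))" if "0 \<le> s" "positive_op B" for s B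
      using op_state_positive[OF st[OF that(1)] that(2)] by (simp add: nonneg_Reals_complex_iff)
    have "(\<integral>\<^sup>+ s \<in> {0..}. ennreal (Re (trace_op (predual (T s) \<rho> \<circ> q))) \<partial>lborel) \<le>
        (\<integral>\<^sup>+ s \<in> {0..}. ennreal (g (s + h) - g s) \<partial>lborel)"
    proof (rule nn_integral_mono)
      fix s :: real
      show "ennreal (Re (trace_op (predual (T s) \<rho> \<circ> q))) * indicator {0..} s \<le> ennreal (g (s + h) - g s) * indicator {0..} s"
      proof (cases "0 \<le> s")
        case True
        note os = op_state_density[OF qms_predual(1)[OF T True \<rho>]]
        have "Re (trace_op (predual (T s) \<rho> \<circ> q)) \<le> Re (trace_op (predual (T s) \<rho> \<circ> (\<lambda>x. complex_of_real K *\<^sub>C A x)))"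
          by (rule op_state_mono[OF os _ bKA le]) (simp add: q_def)
        also have "\<dots> = g (s + h) - g s"
          unfolding diff[OF True] op_state_simps(3)[OF os bA bA] by simp
        finally show ?thesis using True by (simp add: ennreal_leI)
      qed simp
    qed
    also have "\<dots> \<le> ennreal (K * h)"
    proof (rule nn_integral_telescope[OF _ _ _ _ h])
      show "continuous_on {0..} g"
        unfolding g_def by (intro continuous_intros qms_continuous[OF T density_op_trace_class[OF \<rho>] bp])
      show "g s \<le> g (s + h)" if "0 \<le> s" for s
      proof -
        have "0 \<le> Re (trace_op (predual (T s) \<rho> \<circ> A))"
          unfolding qms_predual(2)[OF T that \<rho> bA] by (rule nn[OF that pA])
        then have "0 \<le> g (s + h) - g s" unfolding diff[OF that] by (rule mult_nonneg_nonneg[OF K0])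
        then show ?thesis by simp
      qed
      show "0 \<le> g s" if "0 \<le> s" for s
        unfolding g_def using nn[OF that positive_op_projection[OF p]] K0 by simp
      show "g s \<le> K" if "0 \<le> s" for s
      proof -
        have "Re (trace_op (\<rho> \<circ> T s p)) \<le> Re (trace_op (\<rho> \<circ> T s id))"
          by (rule op_state_mono[OF st[OF that] bp bounded_op_id]) (use positive_op_projection_compl[OF p] in simp)
        also have "\<dots> = 1" using op_state_id[OF st[OF that]] by simp
        finally have "Re (trace_op (\<rho> \<circ> T s p)) \<le> 1" .
        from mult_left_mono[OF this K0] show ?thesis unfolding g_def by simp
      qed
    qed
    finally show ?thesis .
  qed
  have "range q \<subseteq> transient T"
    unfolding transient_def
  proof (rule csup_upper, intro CollectI exI conjI)
    \<comment> \<open>The bound has to be strictly positive while \<open>K * h\<close> may vanish,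
      whence the summand \<open>1\<close>.\<close>
    show "\<forall>\<rho>. density_op \<rho> \<longrightarrow> (\<integral>\<^sup>+ s \<in> {0..}. ennreal (Re (trace_op (predual (T s) \<rho> \<circ> q))) \<partial>lborel) \<le> ennreal (K * h + 1)"
      by (intro allI impI order_trans[OF pot ennreal_leI]) simp_all
    show "0 < K * h + 1" using K0 h by (simp add: add_nonneg_pos)
  qed (use pq in auto)
  moreover have "y = q y"
    using y0 by (simp add: q_def rank1_def u_def cinner_simps cinner_self scaleC_scaleC power2_eq_square)
  ultimately show ?thesis unfolding y_def A_def by (metis rangeI subset_iff)
qed

section \<open>Asymptotic states\<close>

lemma op_state_vector: "norm v = 1 \<Longrightarrow> op_state (\<lambda>A. cinner v (A v))"
  unfolding op_state_def by (auto simp: cinner_simps positive_op_def cinner_self)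

text \<open>Tychonoff's theorem provides a limit point of the Cesaro means in the topology of pointwise convergence;
  this state need not be normal.\<close>

lemma cesaro_limit_state:
  fixes T :: "real \<Rightarrow> ('a::complex_hilbert \<Rightarrow> 'a) \<Rightarrow> ('a \<Rightarrow> 'a)"
  assumes T: "qms T" and v: "norm v = 1"
  shows "\<exists>\<phi>. op_state \<phi> \<and>
    (\<forall>h A. 0 \<le> h \<longrightarrow> bounded_op A \<longrightarrow> \<phi> (T h A) = \<phi> A) \<and>
    (\<forall>A c. bounded_op A \<longrightarrow> (\<forall>t\<ge>0. c \<le> Re (cinner v (T t A v))) \<longrightarrow> c \<le> Re (\<phi> A)) \<and>
    (\<forall>A. bounded_op A \<longrightarrow> (\<forall>t\<ge>0. cinner v (T t A v) = 0) \<longrightarrow> \<phi> A = 0)"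
proof -
  define f where "f t A = cinner v (T t A v)" for t A
  have f: "op_state (f t)" if "0 \<le> t" for t
    unfolding f_def by (rule op_state_comp[OF op_state_vector[OF v] qmsD(1,3)[OF T that]])
  have cont: "continuous_on {0..} (\<lambda>t. f t A)" if A: "bounded_op A" for A
  proof -
    have "continuous_on {0..} (\<lambda>t. trace_op (rank1 v v \<circ> T t A))"
      by (rule qms_continuous[OF T density_op_trace_class[OF density_op_rank1[OF v]] A])
    then show ?thesis
      by (rule continuous_on_eq) (simp add: f_def trace_op_rank1' qms_bounded[OF T _ A])
  qed
  have cont': "continuous_on {a..b} (\<lambda>t. f t A)" if "bounded_op A" "0 \<le> a" for A a b
    by (rule continuous_on_subset[OF cont[OF that(1)]]) (use that(2) in auto)
  have int: "(\<lambda>t. f t A) integrable_on {a..b}" if "bounded_op A" "0 \<le> a" for A a b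
    by (rule integrable_continuous_interval[OF cont'[OF that]])
  \<comment> \<open>Unbounded operators get radius \<open>0\<close> here and mean \<open>0\<close>
    below, so that the means are points of a compact product over all functions.\<close>
  define K where "K A = (if bounded_op A then onorm A else 0)" for A :: "'a \<Rightarrow> 'a"
  have K: "norm (A x) \<le> K A * norm x" "0 \<le> K A" if "bounded_op A" for A x
    using that onorm[OF bounded_op_linear[OF that], of x] onorm_pos_le[OF bounded_op_linear[OF that]]
    by (auto simp: K_def)
  have fK: "cmod (f t A) \<le> K A" if "0 \<le> t" "bounded_op A" for t A
    by (rule op_state_norm_le[OF f[OF that(1)] that(2) K[OF that(2)]])
  define m where "m t A = (if bounded_op A then (1 / t) *\<^sub>R integral {0..t} (\<lambda>s. f s A) else 0)" for t A
  have m: "m t A = (1 / t) *\<^sub>R integral {0..t} (\<lambda>s. f s A)" if "bounded_op A" for t A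
    using that by (simp add: m_def)
  have mK: "m t A \<in> cball 0 (K A)" if t: "0 < t" for t A
  proof (cases "bounded_op A")
    case True
    have "norm (integral {0..t} (\<lambda>s. f s A)) \<le> K A * (t - 0)"
      by (rule integral_bound) (use t True cont' fK in auto)
    then show ?thesis using t by (simp add: m[OF True] divide_le_eq)
  qed (simp add: m_def K_def)
  have "compactin (product_topology (\<lambda>A. euclidean) UNIV) (PiE UNIV (\<lambda>A. cball (0::complex) (K A)))"
    unfolding compactin_PiE by simp
  then have comp: "compact (PiE UNIV (\<lambda>A. cball (0::complex) (K A)))"
    unfolding euclidean_product_topology by simp
  have "filtermap m at_top \<noteq> bot" by (simp add: filtermap_bot_iff)
  moreover have "eventually (\<lambda>g. g \<in> PiE UNIV (\<lambda>A. cball (0::complex) (K A))) (filtermap m at_top)"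
    unfolding eventually_filtermap by (rule eventually_mono[OF eventually_gt_at_top[of 0]]) (use mK in auto)
  ultimately obtain \<phi> where \<phi>: "inf (nhds \<phi>) (filtermap m at_top) \<noteq> bot"
    using comp unfolding compact_filter by blast
  \<comment> \<open>\<open>G\<close> refines both the neighbourhoods of \<open>\<phi>\<close> and
    the tails of the means: values converge along it and eventual properties of the means persist.
    It plays the part of a convergent subnet.\<close>
  define G where "G = inf (nhds \<phi>) (filtermap m at_top)"
  have G0: "G \<noteq> bot" using \<phi> by (simp add: G_def)
  have lim: "((\<lambda>g. g A) \<longlongrightarrow> \<phi> A) G" for A
  proof -
    have "((\<lambda>g. g A) \<longlongrightarrow> \<phi> A) (nhds \<phi>)"
      unfolding tendsto_def
    proof (intro allI impI)
      fix U :: "complex set" assume U: "open U" "\<phi> A \<in> U"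
      have "open ((\<lambda>g. g A) -` U)" by (rule open_vimage[OF U(1) continuous_on_product_coordinates])
      then show "\<forall>\<^sub>F g in nhds \<phi>. g A \<in> U" unfolding eventually_nhds using U(2) by blast
    qed
    then show ?thesis unfolding G_def by (rule tendsto_mono[OF inf.cobounded1])
  qed
  have evG: "eventually P G" if "\<And>t. 0 < t \<Longrightarrow> P (m t)" for P
  proof -
    have "eventually P (filtermap m at_top)"
      unfolding eventually_filtermap by (rule eventually_mono[OF eventually_gt_at_top[of 0]]) (use that in auto)
    then show ?thesis unfolding G_def by (rule filter_leD[OF inf.cobounded2])
  qed
  have limm: "(h \<longlongrightarrow> l) G" if "((\<lambda>t. h (m t)) \<longlongrightarrow> l) at_top" for h l
  proof -
    have "(h \<longlongrightarrow> l) (filtermap m at_top)" using that by (simp add: filterlim_filtermap)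
    then show ?thesis unfolding G_def by (rule tendsto_mono[OF inf.cobounded2])
  qed
  have lin: "\<phi> (\<lambda>x. a *\<^sub>C A x + b *\<^sub>C B x) = a * \<phi> A + b * \<phi> B" if A: "bounded_op A" "bounded_op B" for A B a b
  proof -
    have "m t (\<lambda>x. a *\<^sub>C A x + b *\<^sub>C B x) = a * m t A + b * m t B" if t: "0 < t" for t
    proof -
      have "integral {0..t} (\<lambda>s. f s (\<lambda>x. a *\<^sub>C A x + b *\<^sub>C B x)) = integral {0..t} (\<lambda>s. a * f s A + b * f s B)"
        by (rule integral_cong) (simp add: op_state_lincomb[OF f A])
      also have "\<dots> = a * integral {0..t} (\<lambda>s. f s A) + b * integral {0..t} (\<lambda>s. f s B)"
      proof (subst integral_add)
        show "(\<lambda>s. a * f s A) integrable_on {0..t}" "(\<lambda>s. b * f s B) integrable_on {0..t}"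
          by (intro integrable_continuous_interval continuous_intros cont' A order_refl)+
      qed simp
      finally have "(1 / t) *\<^sub>R integral {0..t} (\<lambda>s. f s (\<lambda>x. a *\<^sub>C A x + b *\<^sub>C B x)) =
          a * ((1 / t) *\<^sub>R integral {0..t} (\<lambda>s. f s A)) + b * ((1 / t) *\<^sub>R integral {0..t} (\<lambda>s. f s B))"
        by (simp only: scaleR_right_distrib mult_scaleR_right)
      then show ?thesis by (simp only: m[OF A(1)] m[OF A(2)] m[OF bounded_op_lincomb[OF A]])
    qed
    then have "eventually (\<lambda>g. a * g A + b * g B = g (\<lambda>x. a *\<^sub>C A x + b *\<^sub>C B x)) G" by (intro evG) (simp only:)
    moreover have "((\<lambda>g. a * g A + b * g B) \<longlongrightarrow> a * \<phi> A + b * \<phi> B) G" by (intro tendsto_add tendsto_mult tendsto_const lim)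
    ultimately have "((\<lambda>g. g (\<lambda>x. a *\<^sub>C A x + b *\<^sub>C B x)) \<longlongrightarrow> a * \<phi> A + b * \<phi> B) G" by (rule Lim_transform_eventually[rotated])
    then show ?thesis by (rule tendsto_unique[OF G0 lim])
  qed
  have ge: "c \<le> Re (\<phi> A)" if A: "bounded_op A" and c: "\<And>t. 0 \<le> t \<Longrightarrow> c \<le> Re (f t A)" for A c
  proof (rule tendsto_lowerbound[OF tendsto_Re[OF lim] _ G0])
    have "c \<le> Re (m t A)" if t: "0 < t" for t
    proof -
      have 1: "((\<lambda>s. Re (f s A)) has_integral Re (integral {0..t} (\<lambda>s. f s A))) {0..t}"
        using has_integral_linear[OF integrable_integral[OF int[OF A order_refl]] bounded_linear_Re] by (simp add: o_def)
      have 2: "((\<lambda>s. c) has_integral c * t) {0..t}"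
        using has_integral_const_real[of c 0 t] t by (simp add: mult.commute)
      have "c * t \<le> Re (integral {0..t} (\<lambda>s. f s A))"
        by (rule has_integral_le[OF 2 1]) (simp add: c)
      then show ?thesis using t by (simp add: m[OF A] le_divide_eq)
    qed
    then show "\<forall>\<^sub>F g in G. c \<le> Re (g A)" by (rule evG)
  qed
  have zero: "\<phi> A = 0" if A: "bounded_op A" and c: "\<And>t. 0 \<le> t \<Longrightarrow> f t A = 0" for A
  proof -
    have "m t A = 0" if t: "0 < t" for t
    proof -
      have "integral {0..t} (\<lambda>s. f s A) = integral {0..t} (\<lambda>s. 0)" by (rule integral_cong) (simp add: c)
      then show ?thesis by (simp add: m[OF A])
    qed
    then have "eventually (\<lambda>g. g A = 0) G" by (intro evG)
    then have "((\<lambda>g. g A) \<longlongrightarrow> 0) G" by (rule tendsto_eventually)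
    with lim show ?thesis by (rule tendsto_unique[OF G0])
  qed
  have id: "\<phi> id = 1"
  proof -
    have "m t id = 1" if t: "0 < t" for t
    proof -
      have "integral {0..t} (\<lambda>s. f s id) = integral {0..t} (\<lambda>s. 1)" by (rule integral_cong) (simp add: op_state_id[OF f])
      then show ?thesis using t by (simp add: m[OF bounded_op_id] scaleR_conv_of_real flip: of_real_mult)
    qed
    then have "eventually (\<lambda>g. g id = 1) G" by (intro evG)
    then have "((\<lambda>g. g id) \<longlongrightarrow> 1) G" by (rule tendsto_eventually)
    with lim show ?thesis by (rule tendsto_unique[OF G0])
  qed
  have pos: "\<phi> A \<in> \<real>\<^sub>\<ge>\<^sub>0" if A: "positive_op A" for A
  proof -
    have p: "Re (f t A) \<ge> 0" "Im (f t A) = 0" if "0 \<le> t" for t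
      using op_state_positive[OF f[OF that] A] by (auto simp: nonneg_Reals_complex_iff)
    have bA: "bounded_op A" by (rule positive_op_bounded[OF A])
    \<comment> \<open>Only lower bounds on real parts pass to the limit so far. Applied to the
      multiples of \<open>A\<close> by \<open>\<i>\<close> and \<open>- \<i>\<close>, they force the
      imaginary part to vanish.\<close>
    have biA: "bounded_op (\<lambda>x. \<i> *\<^sub>C A x)" "bounded_op (\<lambda>x. (- \<i>) *\<^sub>C A x)" by (rule bounded_op_scaleC[OF bA])+
    have phi: "\<phi> (\<lambda>x. c *\<^sub>C A x) = c * \<phi> A" for c using lin[OF bA bA, of c 0] by simp
    have fi: "f t (\<lambda>x. c *\<^sub>C A x) = c * f t A" if "0 \<le> t" for t c by (rule op_state_simps(3)[OF f[OF that] bA bA])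
    have "0 \<le> Re (\<phi> A)" by (rule ge[OF bA]) (use p in auto)
    moreover have "0 \<le> Re (\<phi> (\<lambda>x. \<i> *\<^sub>C A x))" by (rule ge[OF biA(1)]) (use p fi in auto)
    moreover have "0 \<le> Re (\<phi> (\<lambda>x. (- \<i>) *\<^sub>C A x))" by (rule ge[OF biA(2)]) (use p fi in \<open>auto simp del: scaleC_minus_left\<close>)
    ultimately show ?thesis unfolding phi by (simp add: nonneg_Reals_complex_iff)
  qed
  have inv: "\<phi> (T h A) = \<phi> A" if h: "0 \<le> h" and A: "bounded_op A" for h A
  proof -
    have bTA: "bounded_op (T h A)" by (rule qms_bounded[OF T h A])
    \<comment> \<open>Shifting the orbit by \<open>h\<close> changes its integral only by two
      boundary pieces of length \<open>h\<close>, which the factor \<open>1 / t\<close> makes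
      negligible.\<close>
    have diff: "norm (m t (T h A) - m t A) \<le> (2 * K A * h) * (1 / t)" if t: "0 < t" for t
    proof -
      have "integral {0..t} (\<lambda>s. f s (T h A)) = integral {0..t} (\<lambda>s. f (s + h) A)"
        by (rule integral_cong) (simp add: f_def qms_add[OF T _ h A])
      also have "\<dots> = integral {h..t + h} (\<lambda>s. f s A)"
        using integral_shift_real_ivl[of h h "t + h" "\<lambda>s. f s A"] by simp
      finally have "integral {0..t} (\<lambda>s. f s (T h A)) - integral {0..t} (\<lambda>s. f s A) =
          integral {t..t + h} (\<lambda>s. f s A) - integral {0..h} (\<lambda>s. f s A)"
        using Henstock_Kurzweil_Integration.integral_combine[where f = "\<lambda>s. f s A" and a = 0 and c = h and b = "t + h"]
          Henstock_Kurzweil_Integration.integral_combine[where f = "\<lambda>s. f s A" and a = 0 and c = t and b = "t + h"]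
          int[OF A, of 0 "t + h"] h t by (simp add: algebra_simps)
      moreover have "norm (integral {t..t + h} (\<lambda>s. f s A)) \<le> K A * (t + h - t)"
        by (rule integral_bound) (use t h A cont' fK in auto)
      moreover have "norm (integral {0..h} (\<lambda>s. f s A)) \<le> K A * (h - 0)"
        by (rule integral_bound) (use t h A cont' fK in auto)
      ultimately have "norm (integral {0..t} (\<lambda>s. f s (T h A)) - integral {0..t} (\<lambda>s. f s A)) \<le> 2 * K A * h"
        using norm_triangle_ineq4[of "integral {t..t + h} (\<lambda>s. f s A)" "integral {0..h} (\<lambda>s. f s A)"] by simp
      then show ?thesis
        unfolding m[OF A] m[OF bTA] scaleR_diff_right[symmetric] norm_scaleR using t
        by (simp add: divide_right_mono)
    qed
    have "((\<lambda>t. (2 * K A * h) * (1 / t)) \<longlongrightarrow> (2 * K A * h) * 0) at_top"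
      by (intro tendsto_intros tendsto_divide_0[OF tendsto_const] filterlim_at_top_imp_at_infinity filterlim_ident)
    then have "((\<lambda>t. m t (T h A) - m t A) \<longlongrightarrow> 0) at_top"
      unfolding mult_zero_right
      by (rule Lim_null_comparison[rotated]) (use diff in \<open>auto intro: eventually_mono[OF eventually_gt_at_top[of 0]]\<close>)
    then have "((\<lambda>g. g (T h A) - g A) \<longlongrightarrow> 0) G" by (rule limm)
    moreover have "((\<lambda>g. g (T h A) - g A) \<longlongrightarrow> \<phi> (T h A) - \<phi> A) G" by (intro tendsto_diff lim)
    ultimately have "\<phi> (T h A) - \<phi> A = 0" using tendsto_unique[OF G0] by blast
    then show ?thesis by simp
  qed
  have "op_state \<phi>" using lin pos id by (simp add: op_state_def)
  then show ?thesis
    using inv ge zero unfolding f_def by (intro exI[of _ \<phi>] conjI) blast+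
qed

text \<open>One finite-rank operator below the identity captures almost all mass of the evolved
  vector state at every time. The \<open>itself\<close> argument fixes the type of the index
  set.\<close>

definition tight_orbit :: "(real \<Rightarrow> ('a::complex_hilbert \<Rightarrow> 'a) \<Rightarrow> ('a \<Rightarrow> 'a)) \<Rightarrow> 'i itself \<Rightarrow> 'a \<Rightarrow> bool" where
  "tight_orbit T (_ :: 'i itself) v \<longleftrightarrow> (\<forall>\<epsilon>>0. \<exists>(I :: 'i set) s. finite I \<and>
     positive_op (\<lambda>x. x - (\<Sum>i\<in>I. rank1 (s i) (s i) x)) \<and>
     (\<forall>t\<ge>0. 1 - \<epsilon> \<le> Re (cinner v (T t (\<lambda>x. \<Sum>i\<in>I. rank1 (s i) (s i) x) v))))"

lemma tight_orbit_meets_recurrent: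
  assumes T: "qms T" and p: "projection p" "range p = positive_recurrent T"
    and v: "norm v = 1" and tight: "tight_orbit T TYPE('i) v"
    and zero: "\<And>t. 0 \<le> t \<Longrightarrow> cinner v (T t p v) = 0"
  shows False
proof -
  obtain \<phi> where \<phi>: "op_state \<phi>"
    "\<And>h A. 0 \<le> h \<Longrightarrow> bounded_op A \<Longrightarrow> \<phi> (T h A) = \<phi> A"
    "\<And>A c. bounded_op A \<Longrightarrow> (\<And>t. 0 \<le> t \<Longrightarrow> c \<le> Re (cinner v (T t A v))) \<Longrightarrow> c \<le> Re (\<phi> A)"
    "\<And>A. bounded_op A \<Longrightarrow> (\<And>t. 0 \<le> t \<Longrightarrow> cinner v (T t A v) = 0) \<Longrightarrow> \<phi> A = 0"
    using cesaro_limit_state[OF T v] by blast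
  have bp: "bounded_op p" using p(1) by (simp add: projection_iff)
  have "\<exists>F. finite F \<and> F \<subseteq> onb0 \<and> 1 - \<epsilon> \<le> Re (\<phi> (fproj F))" if e: "\<epsilon> > 0" for \<epsilon>
  proof -
    obtain I :: "'i set" and s where I: "finite I" "positive_op (\<lambda>x. x - (\<Sum>i\<in>I. rank1 (s i) (s i) x))"
      "\<And>t. t \<ge> 0 \<Longrightarrow> 1 - \<epsilon> / 2 \<le> Re (cinner v (T t (\<lambda>x. \<Sum>i\<in>I. rank1 (s i) (s i) x) v))"
    proof -
      have "\<epsilon> / 2 > 0" using e by simp
      then have "\<exists>(I :: 'i set) s. finite I \<and> positive_op (\<lambda>x. x - (\<Sum>i\<in>I. rank1 (s i) (s i) x)) \<and>
          (\<forall>t\<ge>0. 1 - \<epsilon> / 2 \<le> Re (cinner v (T t (\<lambda>x. \<Sum>i\<in>I. rank1 (s i) (s i) x) v)))"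
        using tight unfolding tight_orbit_def by blast
      then show ?thesis using that by blast
    qed
    \<comment> \<open>A lower bound valid at all times is inherited by the limit. Halving
      \<open>\<epsilon>\<close> provides the strict inequality needed to pass to basis
      projections.\<close>
    have "1 - \<epsilon> / 2 \<le> Re (\<phi> (\<lambda>x. \<Sum>i\<in>I. rank1 (s i) (s i) x))"
      by (rule \<phi>(3)[OF bounded_op_sum I(3)]) simp_all
    then show ?thesis
      by (intro op_state_finite_rank_tight[OF \<phi>(1) I(1,2)]) (use e in simp)
  qed
  then obtain \<sigma> where \<sigma>: "density_op \<sigma>" "\<And>A. bounded_op A \<Longrightarrow> trace_op (\<sigma> \<circ> A) = \<phi> A"
    using op_state_normal[OF \<phi>(1)] by metis
  have inv: "invariant_state T \<sigma>"
    by (rule invariant_stateI[OF T \<sigma>(1)]) (simp add: \<sigma>(2) \<phi>(2) qms_bounded[OF T])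
  have "\<sigma> \<circ> p = \<sigma>"
    by (rule density_op_comp_projection[OF \<sigma>(1) p(1)]) (use supp_subset_positive_recurrent[OF inv] p(2) in simp)
  then have "\<phi> p = 1" using \<sigma>(2)[OF bp] \<sigma>(1) by (simp add: density_op_def)
  moreover have "\<phi> p = 0" by (rule \<phi>(4)[OF bp zero])
  ultimately show False by simp
qed

theorem orth_recurrent_eq_transient:
  assumes T: "qms T" and tight: "\<And>v. norm v = 1 \<Longrightarrow> tight_orbit T TYPE('i) v"
  shows "orth (positive_recurrent T) = transient T"
proof
  show "transient T \<subseteq> orth (positive_recurrent T)" by (rule transient_subset_orth_recurrent)
  show "orth (positive_recurrent T) \<subseteq> transient T"
  proof
    fix x assume x: "x \<in> orth (positive_recurrent T)"
    have tr: "closed_csubspace (transient T)" unfolding transient_def by (rule closed_csubspace_csup)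
    have R: "closed_csubspace (positive_recurrent T)" unfolding positive_recurrent_def by (rule closed_csubspace_csup)
    obtain p where p: "projection p" "range p = positive_recurrent T"
      "\<And>x. p x = 0 \<longleftrightarrow> x \<in> orth (positive_recurrent T)"
      by (rule projection_onto_exists[OF R]) blast
    obtain u where u: "u \<in> transient T" "x - u \<in> orth (transient T)" by (rule orth_projection_exists[OF tr])
    \<comment> \<open>The part of \<open>x\<close> orthogonal to the transient subspace. It is still
      orthogonal to the recurrent one, as \<open>u\<close> is too by the inclusion already
      proved.\<close>
    define w where "w = x - u"
    have pw: "p w = 0"
      unfolding p(3) w_def using transient_subset_orth_recurrent u(1)
      by (intro closed_csubspace_diff closed_csubspace_orth x) blast
    have zero: "cinner w (T t p w) = 0" if t: "0 \<le> t" for t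
    proof -
      have "T t p w - p w \<in> transient T"
        by (rule range_subharmonic_subset_transient[OF T t p(1) positive_recurrent_subharmonic[OF T t p(1,2)]])
      then have "cinner (T t p w - p w) w = 0" using u(2) by (simp add: orth_def w_def)
      then show ?thesis using cinner_commute[of w "T t p w"] by (simp add: pw)
    qed
    have "w = 0"
    proof (rule ccontr)
      assume w0: "w \<noteq> 0"
      define v where "v = complex_of_real (1 / norm w) *\<^sub>C w"
      have v: "norm v = 1" using w0 by (simp add: v_def norm_scaleC norm_divide)
      have "cinner v (T t p v) = 0" if t: "0 \<le> t" for t
      proof -
        have "bounded_op (T t p)" using p(1) by (intro qms_bounded[OF T t]) (simp add: projection_iff)
        then show ?thesis using zero[OF t] by (simp add: v_def cinner_simps bounded_op_simps)
      qed
      then show False by (rule tight_orbit_meets_recurrent[OF T p(1,2) v tight[OF v]])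
    qed
    then show "x \<in> transient T" using u(1) by (simp add: w_def)
  qed
qed

section \<open>Extension of isometries\<close>

text \<open>Formal linear combinations, meant for finitely supported \<open>c\<close>. Distinct
  coefficient functions may yield the same vector, so well-definedness of maps is settled through
  distances.\<close>

definition lincomb :: "('w \<Rightarrow> 'a::complex_hilbert) \<Rightarrow> ('w \<Rightarrow> complex) \<Rightarrow> 'a" where
  "lincomb e c = (\<Sum>w | c w \<noteq> 0. c w *\<^sub>C e w)"

lemma lincomb_superset:
  assumes "finite F" "{w. c w \<noteq> 0} \<subseteq> F"
  shows "lincomb e c = (\<Sum>w\<in>F. c w *\<^sub>C e w)"
  unfolding lincomb_def using assms by (intro sum.mono_neutral_left) auto

lemma lincomb_add:
  assumes "finite {w. c w \<noteq> 0}" "finite {w. d w \<noteq> 0}"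
  shows "lincomb e (\<lambda>w. c w + d w) = lincomb e c + lincomb e d"
proof -
  let ?F = "{w. c w \<noteq> 0} \<union> {w. d w \<noteq> 0}"
  have fin: "finite ?F" using assms by simp
  have "{w. c w + d w \<noteq> 0} \<subseteq> ?F" by auto
  then show ?thesis
    using lincomb_superset[OF fin, of c e] lincomb_superset[OF fin, of d e] lincomb_superset[OF fin, of "\<lambda>w. c w + d w" e]
    by (simp add: sum.distrib scaleC_add_left)
qed

lemma lincomb_scale: "lincomb e (\<lambda>w. a * c w) = a *\<^sub>C lincomb e c"
  by (cases "a = 0") (auto simp: lincomb_def scaleC_scaleC scaleC.sum_right)

lemma finite_support_scale: "finite {w. c w \<noteq> (0::complex)} \<Longrightarrow> finite {w. a * c w \<noteq> 0}"
  by (rule rev_finite_subset) auto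

lemma finite_support_add: "finite {w. c w \<noteq> (0::complex)} \<Longrightarrow> finite {w. d w \<noteq> 0} \<Longrightarrow> finite {w. c w + d w \<noteq> 0}"
  by (rule finite_subset[of _ "{w. c w \<noteq> 0} \<union> {w. d w \<noteq> 0}"]) auto

lemma lincomb_delta: "lincomb e (\<lambda>w. if w = v then 1 else 0) = e v"
  using lincomb_superset[of "{v}" "\<lambda>w. if w = v then 1 else 0" e] by auto

text \<open>The vectors approximable by finite combinations form a closed subspace containing the
  total family.\<close>

lemma lincomb_dense:
  fixes e :: "'w \<Rightarrow> 'a::complex_hilbert"
  assumes total: "\<And>x. (\<And>w. cinner (e w) x = 0) \<Longrightarrow> x = 0" and r: "0 < r"
  shows "\<exists>c. finite {w. c w \<noteq> 0} \<and> dist (lincomb e c) x < r"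
proof -
  define S where "S = {x. \<forall>r>0. \<exists>c. finite {w. c w \<noteq> 0} \<and> dist (lincomb e c) x < r}"
  have "closure S \<subseteq> S"
  proof
    fix x assume "x \<in> closure S"
    then have x: "\<forall>r>0. \<exists>y\<in>S. dist y x < r" by (simp add: closure_approachable)
    show "x \<in> S" unfolding S_def
    proof (intro CollectI allI impI)
      fix r :: real assume "0 < r"
      then have r2: "r / 2 > 0" by simp
      then obtain y where y: "y \<in> S" "dist y x < r / 2" using x by blast
      then obtain c where "finite {w. c w \<noteq> 0}" "dist (lincomb e c) y < r / 2" using r2 unfolding S_def by blast
      then show "\<exists>c. finite {w. c w \<noteq> 0} \<and> dist (lincomb e c) x < r"
        using dist_triangle_half_l[of "lincomb e c" y r x] y(2) by (auto simp: dist_commute)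
    qed
  qed
  then have "closed S" using closure_subset_eq by blast
  moreover have "0 \<in> S" unfolding S_def
    by (auto intro!: exI[of _ "\<lambda>_. 0"] simp: lincomb_def)
  moreover have "x + y \<in> S" if xy: "x \<in> S" "y \<in> S" for x y
    unfolding S_def
  proof (intro CollectI allI impI)
    fix r :: real assume "0 < r"
    then have r2: "r / 2 > 0" by simp
    obtain c where c: "finite {w. c w \<noteq> 0}" "dist (lincomb e c) x < r / 2" using xy(1) r2 unfolding S_def by blast
    obtain d where d: "finite {w. d w \<noteq> 0}" "dist (lincomb e d) y < r / 2" using xy(2) r2 unfolding S_def by blast
    have "dist (lincomb e (\<lambda>w. c w + d w)) (x + y) < r"
      unfolding lincomb_add[OF c(1) d(1)] using dist_triangle_add[of "lincomb e c" "lincomb e d" x y] c(2) d(2) by simp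
    then show "\<exists>c. finite {w. c w \<noteq> 0} \<and> dist (lincomb e c) (x + y) < r"
      using finite_support_add[OF c(1) d(1)] by (intro exI[of _ "\<lambda>w. c w + d w"] conjI)
  qed
  moreover have "a *\<^sub>C x \<in> S" if x: "x \<in> S" for a x
    unfolding S_def
  proof (intro CollectI allI impI)
    fix r :: real assume r: "0 < r"
    \<comment> \<open>The summand \<open>1\<close> keeps the tolerance meaningful for
      \<open>a = 0\<close>.\<close>
    have a1: "0 < cmod a + 1" using norm_ge_zero[of a] by linarith
    then have "0 < r / (cmod a + 1)" using r by simp
    then obtain c where c: "finite {w. c w \<noteq> 0}" "dist (lincomb e c) x < r / (cmod a + 1)"
      using x unfolding S_def by blast
    have "dist (lincomb e (\<lambda>w. a * c w)) (a *\<^sub>C x) = cmod a * dist (lincomb e c) x"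
      by (simp add: lincomb_scale dist_norm norm_scaleC flip: scaleC_diff_right)
    also have "\<dots> \<le> (cmod a + 1) * dist (lincomb e c) x" by (intro mult_right_mono) auto
    also have "\<dots> < r" using c(2) a1 by (simp add: pos_less_divide_eq mult.commute)
    finally show "\<exists>c. finite {w. c w \<noteq> 0} \<and> dist (lincomb e c) (a *\<^sub>C x) < r"
      using finite_support_scale[OF c(1), of a] by (intro exI[of _ "\<lambda>w. a * c w"] conjI)
  qed
  ultimately have cl: "closed_csubspace S" by (simp add: closed_csubspace_def)
  have "range e \<subseteq> S"
  proof
    fix y assume "y \<in> range e"
    then obtain v where v: "y = e v" by blast
    have fs: "finite {w. (if w = v then 1 else 0 :: complex) \<noteq> 0}" by simp
    show "y \<in> S" unfolding S_def
      using fs lincomb_delta[of e v] v by (intro CollectI allI impI exI[of _ "\<lambda>w. if w = v then 1 else 0"]) simp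
  qed
  then have "S = UNIV" using total by (intro total_subset_UNIV[OF _ cl, of "range e"]) auto
  then show ?thesis using r unfolding S_def by blast
qed

text \<open>Equal Gram matrices give combinations of \<open>e\<close> and of \<open>g\<close> with
  the same coefficients equal distances, so a Cauchy approximation of \<open>x\<close> by the former
  yields one of \<open>U x\<close> by the latter.\<close>

lemma isometry_extension:
  fixes e g :: "'w \<Rightarrow> 'a::complex_hilbert"
  assumes total: "\<And>x. (\<And>w. cinner (e w) x = 0) \<Longrightarrow> x = 0"
    and iso: "\<And>v w. cinner (g v) (g w) = cinner (e v) (e w)"
  obtains U where "bounded_op U" "\<And>x y. cinner (U x) (U y) = cinner x y" "\<And>w. U (e w) = g w"
proof -
  let ?fin = "\<lambda>c :: 'w \<Rightarrow> complex. finite {w. c w \<noteq> 0}"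
  have inner: "cinner (lincomb g c) (lincomb g d) = cinner (lincomb e c) (lincomb e d)" for c d
    unfolding lincomb_def cinner_simps iso ..
  have nrm: "norm (lincomb g c) = norm (lincomb e c)" for c
  proof -
    have "complex_of_real ((norm (lincomb g c))\<^sup>2) = complex_of_real ((norm (lincomb e c))\<^sup>2)"
      unfolding cinner_self[symmetric] inner ..
    then have "(norm (lincomb g c))\<^sup>2 = (norm (lincomb e c))\<^sup>2" by (simp only: of_real_eq_iff)
    then show ?thesis by simp
  qed
  have diff: "lincomb h c - lincomb h d = lincomb h (\<lambda>w. c w + (-1) * d w)" if "?fin c" "?fin d"
    for h :: "'w \<Rightarrow> 'a" and c d
    unfolding lincomb_add[OF that(1) finite_support_scale[OF that(2)]] lincomb_scale by (simp add: scaleC_minus1)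
  have dist: "dist (lincomb g c) (lincomb g d) = dist (lincomb e c) (lincomb e d)" if "?fin c" "?fin d" for c d
    unfolding dist_norm diff[OF that] nrm ..
  have "\<exists>c. \<forall>n. ?fin (c n) \<and> dist (lincomb e (c n)) x < inverse (real (Suc n))" for x
    by (intro choice allI lincomb_dense[OF total]) auto
  then obtain C where C: "\<And>x n. ?fin (C x n)" "\<And>x n. dist (lincomb e (C x n)) x < inverse (real (Suc n))"
    by metis
  have Clim: "(\<lambda>n. lincomb e (C x n)) \<longlonglongrightarrow> x" for x
    unfolding tendsto_dist_iff[of _ x]
  proof (rule tendsto_sandwich[OF _ _ tendsto_const LIMSEQ_inverse_real_of_nat])
    show "\<forall>\<^sub>F n in sequentially. dist (lincomb e (C x n)) x \<le> inverse (real (Suc n))"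
      by (rule always_eventually, rule allI, rule less_imp_le, rule C(2))
  qed simp
  have "Cauchy (\<lambda>n. lincomb g (C x n))" for x
    using LIMSEQ_imp_Cauchy[OF Clim[of x]] unfolding Cauchy_def dist[OF C(1) C(1)] .
  then have "\<exists>y. (\<lambda>n. lincomb g (C x n)) \<longlonglongrightarrow> y" for x by (simp add: Cauchy_convergent_iff convergent_def)
  then obtain U where U: "\<And>x. (\<lambda>n. lincomb g (C x n)) \<longlonglongrightarrow> U x" by metis
  \<comment> \<open>The limit does not depend on the approximating sequence; hence the values on the
    family and linearity can be read off from convenient sequences.\<close>
  have Ulim: "U x = y" if fin: "\<And>n. ?fin (a n)" and a: "(\<lambda>n. lincomb e (a n)) \<longlonglongrightarrow> x" "(\<lambda>n. lincomb g (a n)) \<longlonglongrightarrow> y" for x y a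
  proof -
    have "(\<lambda>n. dist (lincomb e (C x n)) (lincomb e (a n))) \<longlonglongrightarrow> dist x x" by (intro tendsto_intros Clim a)
    moreover have "(\<lambda>n. dist (lincomb g (C x n)) (lincomb g (a n))) \<longlonglongrightarrow> dist (U x) y" by (intro tendsto_intros U a)
    ultimately have "dist (U x) y = dist x x" unfolding dist[OF C(1) fin] by (metis LIMSEQ_unique)
    then show ?thesis by simp
  qed
  have "U (e w) = g w" for w
    by (rule Ulim[of "\<lambda>n v. if v = w then 1 else 0"]) (simp_all add: lincomb_delta)
  moreover have UU: "cinner (U x) (U y) = cinner x y" for x y
  proof (rule LIMSEQ_unique)
    show "(\<lambda>n. cinner (lincomb g (C x n)) (lincomb g (C y n))) \<longlonglongrightarrow> cinner (U x) (U y)"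
      by (intro cinner.tendsto U)
    show "(\<lambda>n. cinner (lincomb g (C x n)) (lincomb g (C y n))) \<longlonglongrightarrow> cinner x y"
      unfolding inner by (intro cinner.tendsto Clim)
  qed
  moreover have "bounded_op U"
  proof (rule bounded_opI[where K = 1])
    fix x y a
    show "U (x + y) = U x + U y"
    proof (rule Ulim)
      show "?fin (\<lambda>w. C x n w + C y n w)" for n by (rule finite_support_add[OF C(1) C(1)])
      show "(\<lambda>n. lincomb e (\<lambda>w. C x n w + C y n w)) \<longlonglongrightarrow> x + y"
        unfolding lincomb_add[OF C(1) C(1)] by (intro tendsto_intros Clim)
      show "(\<lambda>n. lincomb g (\<lambda>w. C x n w + C y n w)) \<longlonglongrightarrow> U x + U y"
        unfolding lincomb_add[OF C(1) C(1)] by (intro tendsto_intros U)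
    qed
    show "U (a *\<^sub>C x) = a *\<^sub>C U x"
    proof (rule Ulim)
      show "?fin (\<lambda>w. a * C x n w)" for n by (rule finite_support_scale[OF C(1)])
      show "(\<lambda>n. lincomb e (\<lambda>w. a * C x n w)) \<longlonglongrightarrow> a *\<^sub>C x"
        unfolding lincomb_scale by (intro scaleC.tendsto tendsto_const Clim)
      show "(\<lambda>n. lincomb g (\<lambda>w. a * C x n w)) \<longlonglongrightarrow> a *\<^sub>C U x"
        unfolding lincomb_scale by (intro scaleC.tendsto tendsto_const U)
    qed
    have "complex_of_real ((norm (U x))\<^sup>2) = complex_of_real ((norm x)\<^sup>2)"
      unfolding cinner_self[symmetric] UU ..
    then have "(norm (U x))\<^sup>2 = (norm x)\<^sup>2" by (simp only: of_real_eq_iff)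
    then show "norm (U x) \<le> 1 * norm x" by simp
  qed
  ultimately show ?thesis using that by blast
qed

section \<open>Exponential vectors\<close>

lemma complex_sum_words_length:
  fixes a :: "'d::finite \<Rightarrow> complex"
  shows "(\<Sum>xs | length xs = n. prod_list (map a xs)) = (\<Sum>i\<in>UNIV. a i) ^ n"
proof (induction n)
  case (Suc n)
  have eq: "{xs :: 'd list. length xs = Suc n} = (\<lambda>(x, xs). x # xs) ` (UNIV \<times> {xs. length xs = n})"
    by (auto simp: length_Suc_conv image_iff)
  have "(\<Sum>xs | length xs = Suc n. prod_list (map a xs)) =
      (\<Sum>(x, xs)\<in>UNIV \<times> {xs. length xs = n}. a x * prod_list (map a xs))"
    unfolding eq by (subst sum.reindex) (auto simp: inj_on_def o_def case_prod_unfold)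
  also have "\<dots> = (\<Sum>i\<in>UNIV. a i) * (\<Sum>xs | length xs = n. prod_list (map a xs))"
    by (simp add: sum.cartesian_product[symmetric] sum_product)
  finally show ?case using Suc by simp
qed simp

lemma has_sum_by_length:
  fixes h :: "'d::finite list \<Rightarrow> complex"
  assumes "(h has_sum s) UNIV"
  shows "((\<lambda>n. \<Sum>xs | length xs = n. h xs) has_sum s) UNIV"
proof -
  have "bij_betw snd (SIGMA n:UNIV. {xs :: 'd list. length xs = n}) UNIV"
    by (rule bij_betwI[where g = "\<lambda>xs. (length xs, xs)"]) auto
  then have "((\<lambda>p. h (snd p)) has_sum s) (SIGMA n:UNIV. {xs. length xs = n})"
    using assms has_sum_reindex_bij_betw by blast
  then show ?thesis
    by (rule has_sum_SigmaD) (auto intro!: has_sum_finiteI finite_words_length)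
qed

lemma cinner_fock_has_sum:
  "((\<lambda>xs. cnj (coeff_fock f xs) * coeff_fock g xs) has_sum cinner f g) UNIV"
  unfolding cinner_fock_def by (rule has_sum_infsum[OF coeff_summable])

lemma coeff_expvec: "coeff_fock (expvec z) xs = (\<Prod>i\<leftarrow>xs. z $ i) / complex_of_real (sqrt (fact (length xs)))"
  by (simp add: expvec.rep_eq)

lemma cnj_prod_list: "cnj (prod_list (map a xs)) = prod_list (map (\<lambda>i. cnj (a i)) xs)"
  by (induction xs) auto

lemma prod_list_map_mult:
  "prod_list (map a xs) * prod_list (map b xs) = prod_list (map (\<lambda>i. a i * (b i :: complex)) xs)"
  by (induction xs) (auto simp: algebra_simps)

text \<open>Grouping words by length turns the sum into the exponential series, since the words of
  length \<open>n\<close> expand the \<open>n\<close>-th power of \<open>cdot z w\<close>.\<close>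

lemma cinner_expvec: "cinner (expvec z) (expvec w) = exp (cdot z w)"
proof -
  have c: "cnj (coeff_fock (expvec z) xs) * coeff_fock (expvec w) xs =
      prod_list (map (\<lambda>i. cnj (z $ i) * w $ i) xs) /\<^sub>R fact (length xs)" for xs
  proof -
    have "complex_of_real (sqrt (fact (length xs))) * complex_of_real (sqrt (fact (length xs))) = complex_of_real (fact (length xs))"
      unfolding of_real_mult[symmetric] by simp
    then show ?thesis
      unfolding coeff_expvec complex_cnj_divide cnj_prod_list complex_cnj_complex_of_real times_divide_times_eq prod_list_map_mult
      by (simp add: scaleR_conv_of_real field_simps)
  qed
  have "((\<lambda>n. \<Sum>xs | length xs = n. cnj (coeff_fock (expvec z) xs) * coeff_fock (expvec w) xs) has_sum
      cinner (expvec z) (expvec w)) UNIV"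
    by (rule has_sum_by_length[OF cinner_fock_has_sum])
  moreover have "(\<Sum>xs | length xs = n. cnj (coeff_fock (expvec z) xs) * coeff_fock (expvec w) xs) = cdot z w ^ n /\<^sub>R fact n" for n
  proof -
    have "(\<Sum>xs | length xs = n. cnj (coeff_fock (expvec z) xs) * coeff_fock (expvec w) xs) =
        (\<Sum>xs | length xs = n. prod_list (map (\<lambda>i. cnj (z $ i) * w $ i) xs) /\<^sub>R fact n)"
      by (intro sum.cong refl) (simp add: c)
    also have "\<dots> = cdot z w ^ n /\<^sub>R fact n"
      unfolding scaleR_sum_right[symmetric] complex_sum_words_length cdot_def ..
    finally show ?thesis .
  qed
  ultimately have "(\<lambda>n. cdot z w ^ n /\<^sub>R fact n) sums cinner (expvec z) (expvec w)"
    by (simp add: has_sum_imp_sums)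
  then show ?thesis using exp_converges[of "cdot z w"] sums_unique2 by blast
qed

lemma digits_unique:
  fixes a b :: "nat \<Rightarrow> nat"
  assumes "\<And>j. j < d \<Longrightarrow> a j < B" "\<And>j. j < d \<Longrightarrow> b j < B" "(\<Sum>j<d. a j * B ^ j) = (\<Sum>j<d. b j * B ^ j)" "j < d"
  shows "a j = b j"
  using assms
proof (induction d arbitrary: a b j)
  case (Suc d)
  have split: "(\<Sum>j<Suc d. c j * B ^ j) = c 0 + B * (\<Sum>j<d. c (Suc j) * B ^ j)" for c :: "nat \<Rightarrow> nat"
    unfolding sum.lessThan_Suc_shift sum_distrib_left by (auto intro: sum.cong)
  have eq: "a 0 + B * (\<Sum>j<d. a (Suc j) * B ^ j) = b 0 + B * (\<Sum>j<d. b (Suc j) * B ^ j)"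
    using Suc.prems(3) unfolding split .
  have lt: "a 0 < B" "b 0 < B" using Suc.prems(1,2) by auto
  have "a 0 = b 0" using arg_cong[OF eq, of "\<lambda>x. x mod B"] lt by simp
  moreover from this have "(\<Sum>j<d. a (Suc j) * B ^ j) = (\<Sum>j<d. b (Suc j) * B ^ j)" using eq lt by simp
  then have "a (Suc i) = b (Suc i)" if "i < d" for i
    by (rule Suc.IH[rotated 2]) (use Suc.prems that in auto)
  ultimately show ?case using Suc.prems(4) by (cases j) auto
qed simp

text \<open>A Kronecker substitution turns the homogeneous component of degree \<open>n\<close> into a polynomial in one
  variable with a separate monomial for each multiset of size \<open>n\<close>.\<close>

lemma homogeneous_polynomial_eq_0:
  fixes f :: "'d::finite list \<Rightarrow> complex"
  assumes perm: "\<And>xs ys. mset xs = mset ys \<Longrightarrow> f xs = f ys"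
    and zero: "\<And>w. (\<Sum>xs | length xs = n. prod_list (map w xs) * f xs) = 0"
    and len: "length xs0 = n"
  shows "f xs0 = 0"
proof -
  obtain idx :: "'d \<Rightarrow> nat" where idx: "bij_betw idx UNIV {..<CARD('d)}"
    using ex_bij_betw_finite_nat[of "UNIV :: 'd set"] by (auto simp: atLeast0LessThan)
  \<comment> \<open>No letter occurs more than \<open>n\<close> times in a word of length
    \<open>n\<close>, so the multiplicities are digits in base \<open>n + 1\<close> and
    \<open>\<kappa>\<close> encodes the multiset.\<close>
  define B where "B = Suc n"
  define \<kappa> where "\<kappa> xs = sum_list (map (\<lambda>i. B ^ idx i) xs)" for xs
  have \<kappa>: "\<kappa> xs = (\<Sum>j<CARD('d). count (mset xs) (inv_into UNIV idx j) * B ^ j)" for xs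
  proof -
    have "\<kappa> xs = (\<Sum>i\<in>UNIV. count (mset xs) i * B ^ idx i)"
    proof (induction xs)
      case (Cons x xs)
      have "(\<Sum>i\<in>UNIV. count (mset (x # xs)) i * B ^ idx i) =
          (\<Sum>i\<in>UNIV. count (mset xs) i * B ^ idx i + (if i = x then B ^ idx x else 0))"
        by (intro sum.cong) auto
      then show ?case using Cons by (simp add: \<kappa>_def sum.distrib)
    qed (simp add: \<kappa>_def)
    also have "\<dots> = (\<Sum>i\<in>UNIV. count (mset xs) (inv_into UNIV idx (idx i)) * B ^ idx i)"
      by (simp add: bij_betw_inv_into_left[OF idx])
    also have "\<dots> = (\<Sum>j<CARD('d). count (mset xs) (inv_into UNIV idx j) * B ^ j)"
      by (rule sum.reindex_bij_betw[OF idx])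
    finally show ?thesis .
  qed
  have inj: "mset xs = mset ys" if "\<kappa> xs = \<kappa> ys" "length xs = n" "length ys = n" for xs ys
  proof (rule multiset_eqI)
    fix i
    have c: "count (mset zs) j < B" if "length zs = n" for zs :: "'d list" and j
      using count_le_length[of zs j] that by (simp add: B_def count_mset less_Suc_eq_le)
    have "count (mset xs) (inv_into UNIV idx (idx i)) = count (mset ys) (inv_into UNIV idx (idx i))"
      using that(1) unfolding \<kappa>
      by (rule digits_unique[rotated 2]) (use c that(2,3) idx in \<open>auto simp: bij_betw_def\<close>)
    then show "count (mset xs) i = count (mset ys) i" by (simp add: bij_betw_inv_into_left[OF idx])
  qed
  define W where "W = {xs :: 'd list. length xs = n}"
  have W: "finite W" unfolding W_def by (rule finite_words_length)
  define q where "q = (\<Sum>xs\<in>W. monom (f xs) (\<kappa> xs))"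
  have "poly q s = 0" for s
  proof -
    have "prod_list (map (\<lambda>i. s ^ (B ^ idx i)) xs) = s ^ \<kappa> xs" for xs
      by (induction xs) (auto simp: \<kappa>_def power_add)
    then show ?thesis
      using zero[of "\<lambda>i. s ^ (B ^ idx i)"] by (simp add: q_def poly_sum poly_monom W_def mult.commute)
  qed
  then have "q = 0" by (intro poly_all_0_iff_0[THEN iffD1]) simp
  then have "0 = coeff q (\<kappa> xs0)" by simp
  also have "\<dots> = (\<Sum>xs\<in>W. if \<kappa> xs = \<kappa> xs0 then f xs else 0)" by (simp add: q_def coeff_sum coeff_monom)
  also have "\<dots> = (\<Sum>xs\<in>W. if \<kappa> xs = \<kappa> xs0 then f xs0 else 0)"
  proof (intro sum.cong refl if_cong)
    show "f xs = f xs0" if "xs \<in> W" "\<kappa> xs = \<kappa> xs0" for xs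
      by (rule perm[OF inj]) (use that len in \<open>auto simp: W_def\<close>)
  qed
  also have "\<dots> = (\<Sum>xs\<in>{xs\<in>W. \<kappa> xs = \<kappa> xs0}. f xs0)"
    by (rule sum.inter_filter[OF W, symmetric])
  also have "\<dots> = of_nat (card {xs\<in>W. \<kappa> xs = \<kappa> xs0}) * f xs0"
    by (rule sum_constant)
  finally have "of_nat (card {xs\<in>W. \<kappa> xs = \<kappa> xs0}) * f xs0 = 0" by (rule sym)
  moreover have "card {xs\<in>W. \<kappa> xs = \<kappa> xs0} \<noteq> 0"
  proof -
    have "xs0 \<in> {xs\<in>W. \<kappa> xs = \<kappa> xs0}" using len by (simp add: W_def)
    moreover have "finite {xs\<in>W. \<kappa> xs = \<kappa> xs0}" using W by simp
    ultimately show ?thesis using card_0_eq by blast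
  qed
  ultimately show ?thesis by (simp only: mult_eq_0_iff of_nat_eq_0_iff) blast
qed

text \<open>Along a complex line the inner product is an identically vanishing power series in
  \<open>t\<close>. Its coefficients are homogeneous polynomials in \<open>w\<close>, one for each
  word length, and vanish separately.\<close>

lemma expvec_total:
  fixes f :: "'d::finite fock"
  assumes zero: "\<And>w. cinner (expvec w) f = 0"
  shows "f = 0"
proof (rule fock_eqI)
  fix xs0 :: "'d list"
  define n where "n = length xs0"
  have hom: "(\<Sum>xs | length xs = n. prod_list (map w xs) * coeff_fock f xs) = 0" for w :: "'d \<Rightarrow> complex"
  proof -
    define a where "a k = (\<Sum>xs | length xs = k. prod_list (map w xs) * coeff_fock f xs) / complex_of_real (sqrt (fact k))" for k
    have sums: "(\<lambda>k. a k * (t - 0) ^ k) sums 0" for t :: complex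
    proof -
      define z where "z = (\<chi> i. cnj (t * w i))"
      have "((\<lambda>k. \<Sum>xs | length xs = k. cnj (coeff_fock (expvec z) xs) * coeff_fock f xs) has_sum 0) UNIV"
        using has_sum_by_length[OF cinner_fock_has_sum[of "expvec z" f]] by (simp add: zero)
      moreover have "(\<Sum>xs | length xs = k. cnj (coeff_fock (expvec z) xs) * coeff_fock f xs) = a k * (t - 0) ^ k" for k
      proof -
        have p: "prod_list (map (\<lambda>i. t * w i) xs) = t ^ length xs * prod_list (map w xs)" for xs
          by (induction xs) auto
        show ?thesis
          unfolding a_def sum_divide_distrib sum_distrib_right
          by (intro sum.cong refl) (simp add: coeff_expvec z_def cnj_prod_list p)
      qed
      ultimately show ?thesis by (simp add: has_sum_imp_sums)
    qed
    have "Abs_fps a = 0"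
    proof (rule eval_fps_eqD)
      \<comment> \<open>Convergence at \<open>t = 1\<close> already provides a positive
        radius.\<close>
      have "conv_radius a \<ge> ereal (norm (1 :: complex))"
        by (rule conv_radius_geI) (use sums[of 1] in \<open>simp add: sums_iff\<close>)
      then show "0 < fps_conv_radius (Abs_fps a)"
        using less_le_trans[of 0 "ereal (norm (1 :: complex))" "conv_radius a"] by (simp add: fps_conv_radius_def)
      have "eval_fps (Abs_fps a) t = 0" for t using sums[of t] by (simp add: eval_fps_def sums_iff)
      then show "\<forall>\<^sub>F t in nhds 0. eval_fps (Abs_fps a) t = eval_fps 0 t" by simp
    qed simp
    then have "a n = 0" by (metis fps_nth_Abs_fps fps_zero_nth)
    then show ?thesis by (simp add: a_def)
  qed
  show "coeff_fock f xs0 = coeff_fock 0 xs0"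
  proof -
    have "coeff_fock f xs = coeff_fock f ys" if "mset xs = mset ys" for xs ys
      using coeff_fock[of f] that by blast
    from homogeneous_polynomial_eq_0[OF this hom n_def[symmetric]] show ?thesis by (simp only: coeff_simps)
  qed
qed

section \<open>Weyl operators\<close>

lemma cdot_add: "cdot z (v + w) = cdot z v + cdot z w" "cdot (z + v) w = cdot z w + cdot v w"
  by (simp_all add: cdot_def sum.distrib algebra_simps)

lemma cdot_minus: "cdot (- z) w = - cdot z w" "cdot z (- w) = - cdot z w"
  by (simp_all add: cdot_def sum_negf)

lemma cdot_self: "cdot z z = complex_of_real ((norm z)\<^sup>2)"
proof -
  have "Im (cdot z z) = 0" by (simp add: cdot_def)
  moreover have "Re (cdot z z) = (norm z)\<^sup>2" by (simp add: inner_eq_Re_cdot[symmetric] power2_norm_eq_inner)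
  ultimately show ?thesis by (simp add: complex_eq_iff)
qed

lemma cnj_cdot: "cnj (cdot z w) = cdot w z"
  by (simp add: cdot_def mult.commute)

definition weyl_phase :: "complex ^ 'd \<Rightarrow> complex ^ 'd::finite \<Rightarrow> complex" where
  "weyl_phase z w = exp (- complex_of_real ((norm z)\<^sup>2) / 2 - cdot z w)"

lemma bounded_op_expvec_eqI:
  fixes A B :: "'d::finite fock \<Rightarrow> 'd fock"
  assumes A: "bounded_op A" "bounded_op B" and eq: "\<And>w. A (expvec w) = B (expvec w)"
  shows "A = B"
proof -
  have "{x. A x - B x = 0} = UNIV"
  proof (rule total_subset_UNIV[of "range expvec"])
    show "x = 0" if "\<And>d. d \<in> range expvec \<Longrightarrow> cinner d x = 0" for x :: "'d fock"
      by (rule expvec_total) (use that in blast)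
    show "closed_csubspace {x. A x - B x = 0}" by (rule closed_csubspace_ker[OF bounded_op_diff[OF A]])
  qed (use eq in auto)
  then show ?thesis by (auto simp: fun_eq_iff)
qed

lemma unitary_opI:
  assumes U: "bounded_op U" and iso: "\<And>x y. cinner (U x) (U y) = cinner x y" and surj: "\<And>y. \<exists>x. U x = y"
  shows "unitary_op U"
proof -
  have 1: "adj U (U x) = x" for x
    by (rule cinner_eqI) (simp add: cinner_adj_right[OF U] iso)
  moreover have "U (adj U y) = y" for y using surj[of y] 1 by metis
  ultimately show ?thesis using U by (auto simp: unitary_op_def fun_eq_iff)
qed

text \<open>The prescribed images of exponential vectors preserve inner products, so an isometry
  exists. The one for \<open>- z\<close> is its right inverse because the phases multiply to
  \<open>1\<close>, and totality gives the uniqueness that the definite description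
  requires.\<close>

lemma weyl_spec:
  fixes z :: "complex ^ 'd::finite"
  shows "unitary_op (weyl z)" "weyl z (expvec w) = weyl_phase z w *\<^sub>C expvec (z + w)"
proof -
  have ex: "\<exists>U. bounded_op U \<and> (\<forall>x y. cinner (U x) (U y) = cinner x y) \<and>
      (\<forall>w. U (expvec w) = weyl_phase z w *\<^sub>C expvec (z + w))" for z :: "complex ^ 'd"
  proof -
    have "cinner (weyl_phase z v *\<^sub>C expvec (z + v)) (weyl_phase z w *\<^sub>C expvec (z + w)) = cinner (expvec v) (expvec w)" for v w
      unfolding cinner_simps cinner_expvec weyl_phase_def exp_cnj mult_exp_exp
      by (simp add: cdot_add cdot_self cnj_cdot)
    from isometry_extension[of expvec "\<lambda>w. weyl_phase z w *\<^sub>C expvec (z + w)", OF expvec_total this]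
    show ?thesis by metis
  qed
  obtain U where U: "bounded_op U" "\<And>x y. cinner (U x) (U y) = cinner x y"
      "\<And>w. U (expvec w) = weyl_phase z w *\<^sub>C expvec (z + w)" using ex[of z] by blast
  obtain V where V: "bounded_op V" "\<And>x y. cinner (V x) (V y) = cinner x y"
      "\<And>w. V (expvec w) = weyl_phase (- z) w *\<^sub>C expvec (- z + w)" using ex[of "- z"] by blast
  have "U \<circ> V = id"
  proof (rule bounded_op_expvec_eqI)
    show "bounded_op (U \<circ> V)" by (rule bounded_op_comp[OF U(1) V(1)])
    have "weyl_phase (- z) w * weyl_phase z (- z + w) = 1" for w
      unfolding weyl_phase_def mult_exp_exp cdot_add cdot_minus cdot_self by simp
    then show "(U \<circ> V) (expvec w) = id (expvec w)" for w
      by (simp add: V(3) bounded_op_simps[OF U(1)] U(3) scaleC_scaleC)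
  qed simp
  then have "unitary_op U" by (intro unitary_opI U) (metis comp_apply id_apply)
  then have "unitary_op U \<and> (\<forall>w. U (expvec w) = exp (- complex_of_real ((norm z)\<^sup>2) / 2 - cdot z w) *\<^sub>C expvec (z + w))"
    using U(3) by (simp add: weyl_phase_def)
  moreover have "U' = U" if "unitary_op U' \<and> (\<forall>w. U' (expvec w) = exp (- complex_of_real ((norm z)\<^sup>2) / 2 - cdot z w) *\<^sub>C expvec (z + w))" for U'
    using that U by (intro bounded_op_expvec_eqI) (auto simp: weyl_phase_def unitary_op_def)
  ultimately have "weyl z = U" unfolding weyl_def by (rule the_equality)
  then show "unitary_op (weyl z)" "weyl z (expvec w) = weyl_phase z w *\<^sub>C expvec (z + w)"
    using \<open>unitary_op U\<close> U(3) by auto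
qed

lemma bounded_op_weyl: "bounded_op (weyl z)"
  using weyl_spec(1)[of z] by (simp add: unitary_op_def)

lemma unitary_op_norm:
  assumes "unitary_op U" shows "norm (U x) = norm x"
proof -
  have U: "bounded_op U" "adj U (U x) = x" using assms by (auto simp: unitary_op_def fun_eq_iff)
  have "complex_of_real ((norm (U x))\<^sup>2) = complex_of_real ((norm x)\<^sup>2)"
    unfolding cinner_self[symmetric] cinner_adj_right[OF U(1), symmetric] U(2) ..
  then have "(norm (U x))\<^sup>2 = (norm x)\<^sup>2" by (simp only: of_real_eq_iff)
  then show ?thesis by simp
qed

lemma norm_weyl: "norm (weyl z x) = norm x"
  by (rule unitary_op_norm[OF weyl_spec(1)])

lemma cinner_expvec_weyl:
  "cinner (expvec u) (weyl z (expvec v)) = exp (- complex_of_real ((norm z)\<^sup>2) / 2 - cdot z v + cdot u z + cdot u v)"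
  by (simp add: weyl_spec(2) cinner_simps cinner_expvec weyl_phase_def mult_exp_exp cdot_add algebra_simps)

section \<open>Second quantized contractions\<close>

text \<open>Scaled so that pairing with it reads off the coefficient at \<open>ws\<close>; its
  squared norm is the inverse of the number of rearrangements. Summing \<open>rank1\<close> over all
  words up to length \<open>n\<close>, rearrangements included, thus gives the projection onto at
  most \<open>n\<close> particles.\<close>

lift_definition word_vec :: "'d::finite list \<Rightarrow> 'd fock" is
  "\<lambda>ws xs. if mset xs = mset ws then 1 / of_nat (card {ys. mset ys = mset ws}) else 0"
proof -
  fix ws :: "'d list"
  have "finite {ys. mset ys = mset ws}"
    by (rule finite_subset[OF _ finite_words_length[of "length ws"]]) (auto dest: mset_eq_length)
  then have "sq_summable (\<lambda>xs. if mset xs = mset ws then 1 / of_nat (card {ys. mset ys = mset ws}) else 0)"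
    unfolding sq_summable_def
    by (intro finite_nonzero_values_imp_summable_on) (rule rev_finite_subset, auto)
  then show "sq_summable (\<lambda>xs. if mset xs = mset ws then 1 / of_nat (card {ys. mset ys = mset ws}) else 0) \<and>
    (\<forall>xs ys. mset xs = mset ys \<longrightarrow>
      (if mset xs = mset ws then 1 / of_nat (card {ys. mset ys = mset ws}) else 0 :: complex) =
      (if mset ys = mset ws then 1 / of_nat (card {ys. mset ys = mset ws}) else 0))" by auto
qed

lemma coeff_perm: "mset xs = mset ys \<Longrightarrow> coeff_fock f xs = coeff_fock f ys"
  using coeff_fock[of f] by blast

lemma cinner_word_vec: "cinner (word_vec ws) f = coeff_fock f ws"
proof -
  let ?S = "{ys. mset ys = mset ws}"
  have fin: "finite ?S"
    by (rule finite_subset[OF _ finite_words_length[of "length ws"]]) (auto dest: mset_eq_length)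
  have "((\<lambda>xs. cnj (coeff_fock (word_vec ws) xs) * coeff_fock f xs) has_sum
      (\<Sum>xs\<in>?S. coeff_fock f ws / of_nat (card ?S))) UNIV"
  proof (rule has_sum_finite_neutralI[where B = ?S])
    show "(\<Sum>xs\<in>?S. coeff_fock f ws / of_nat (card ?S)) = (\<Sum>xs\<in>?S. cnj (coeff_fock (word_vec ws) xs) * coeff_fock f xs)"
    proof (intro sum.cong refl)
      fix xs assume xs: "xs \<in> ?S"
      then have "coeff_fock f ws = coeff_fock f xs" by (intro coeff_perm) simp
      then show "coeff_fock f ws / of_nat (card ?S) = cnj (coeff_fock (word_vec ws) xs) * coeff_fock f xs"
        using xs by (simp only: word_vec.rep_eq mem_Collect_eq if_True) simp
    qed
  qed (use fin in \<open>auto simp: word_vec.rep_eq\<close>)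
  moreover have "(\<Sum>xs\<in>?S. coeff_fock f ws / of_nat (card ?S)) = coeff_fock f ws"
  proof -
    have "card ?S \<noteq> 0" using fin card_0_eq[OF fin] by blast
    then have "of_nat (card ?S) \<noteq> (0 :: complex)" by (simp only: of_nat_eq_0_iff not_False_eq_True)
    then show ?thesis
      unfolding sum_constant times_divide_eq_right by (rule nonzero_mult_div_cancel_left)
  qed
  ultimately have "((\<lambda>xs. cnj (coeff_fock (word_vec ws) xs) * coeff_fock f xs) has_sum coeff_fock f ws) UNIV"
    by (simp only:)
  from has_sum_unique[OF cinner_fock_has_sum this] show ?thesis .
qed

text \<open>The operator \<open>q\<^sup>N\<close> with \<open>N\<close> the particle number, and \<open>0\<close> (as a junk value) if \<open>\<bar>q\<bar> > 1\<close>.\<close>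

lift_definition numpow :: "real \<Rightarrow> 'd fock \<Rightarrow> 'd fock" is
  "\<lambda>q f xs. complex_of_real (if \<bar>q\<bar> \<le> 1 then q ^ length xs else 0) * f xs"
proof -
  fix q :: real and f :: "'d list \<Rightarrow> complex"
  assume f: "sq_summable f \<and> (\<forall>xs ys. mset xs = mset ys \<longrightarrow> f xs = f ys)"
  have "(\<lambda>xs. (cmod (complex_of_real (if \<bar>q\<bar> \<le> 1 then q ^ length xs else 0) * f xs))\<^sup>2) summable_on UNIV"
  proof (rule summable_on_comparison_test)
    show "(\<lambda>xs. (cmod (f xs))\<^sup>2) summable_on UNIV" using conjunct1[OF f] unfolding sq_summable_def .
    fix xs :: "'d list"
    have "\<bar>q\<bar> ^ length xs \<le> 1" if "\<bar>q\<bar> \<le> 1" using that by (intro power_le_one) auto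
    then have "cmod (complex_of_real (if \<bar>q\<bar> \<le> 1 then q ^ length xs else 0) * f xs) \<le> 1 * cmod (f xs)"
      unfolding norm_mult by (intro mult_right_mono) (auto simp: power_abs)
    then show "(cmod (complex_of_real (if \<bar>q\<bar> \<le> 1 then q ^ length xs else 0) * f xs))\<^sup>2 \<le> (cmod (f xs))\<^sup>2"
      by (intro power_mono) auto
  qed simp
  then show "sq_summable (\<lambda>xs. complex_of_real (if \<bar>q\<bar> \<le> 1 then q ^ length xs else 0) * f xs) \<and>
    (\<forall>xs ys. mset xs = mset ys \<longrightarrow> complex_of_real (if \<bar>q\<bar> \<le> 1 then q ^ length xs else 0) * f xs =
       complex_of_real (if \<bar>q\<bar> \<le> 1 then q ^ length ys else 0) * f ys)"
    unfolding sq_summable_def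
  proof (intro conjI allI impI)
    fix xs ys :: "'d list" assume m: "mset xs = mset ys"
    then have "length xs = length ys" "f xs = f ys" using f mset_eq_length by blast+
    then show "complex_of_real (if \<bar>q\<bar> \<le> 1 then q ^ length xs else 0) * f xs =
       complex_of_real (if \<bar>q\<bar> \<le> 1 then q ^ length ys else 0) * f ys" by simp
  qed
qed

lemma coeff_numpow: "\<bar>q\<bar> \<le> 1 \<Longrightarrow> coeff_fock (numpow q f) xs = complex_of_real (q ^ length xs) * coeff_fock f xs"
  by (simp add: numpow.rep_eq)

lemma norm_sq_has_sum: "((\<lambda>xs. (cmod (coeff_fock f xs))\<^sup>2) has_sum (norm f)\<^sup>2) UNIV"
  using sq_summable_coeff[of f] unfolding power2_norm_eq_inner inner_self_fock sq_summable_def by simp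

lemma numpow_expvec: "\<bar>q\<bar> \<le> 1 \<Longrightarrow> numpow q (expvec w) = expvec (q *\<^sub>R w)"
proof (rule fock_eqI)
  fix xs assume q: "\<bar>q\<bar> \<le> 1"
  have "(\<Prod>i\<leftarrow>xs. (q *\<^sub>R w) $ i) = complex_of_real (q ^ length xs) * (\<Prod>i\<leftarrow>xs. w $ i)"
  proof (induction xs)
    case (Cons i xs)
    have "(q *\<^sub>R w) $ i = complex_of_real q * w $ i"
      unfolding vector_scaleR_component by (rule scaleR_conv_of_real)
    then show ?case using Cons by simp
  qed simp
  then show "coeff_fock (numpow q (expvec w)) xs = coeff_fock (expvec (q *\<^sub>R w)) xs"
    by (simp add: coeff_numpow[OF q] coeff_expvec)
qed

lemma norm_numpow_le:
  fixes x :: "'d::finite fock"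
  assumes q: "\<bar>q\<bar> \<le> 1" shows "norm (numpow q x) \<le> norm x"
proof -
  have "(norm (numpow q x))\<^sup>2 \<le> (norm x)\<^sup>2"
  proof (rule has_sum_mono[OF norm_sq_has_sum norm_sq_has_sum])
    fix xs :: "'d list"
    have "\<bar>q\<bar> ^ length xs \<le> 1" using q by (intro power_le_one) auto
    then have "cmod (coeff_fock (numpow q x) xs) \<le> 1 * cmod (coeff_fock x xs)"
      unfolding coeff_numpow[OF q] norm_mult norm_of_real power_abs by (intro mult_right_mono) auto
    then show "(cmod (coeff_fock (numpow q x) xs))\<^sup>2 \<le> (cmod (coeff_fock x xs))\<^sup>2" by (intro power_mono) auto
  qed
  then show ?thesis by simp
qed

lemma bounded_op_numpow:
  assumes q: "\<bar>q\<bar> \<le> 1" shows "bounded_op (numpow q :: 'd::finite fock \<Rightarrow> 'd fock)"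
proof (rule bounded_opI[where K = 1])
  show "numpow q (x + y) = numpow q x + numpow q y" for x y :: "'d fock"
    by (rule fock_eqI) (simp add: coeff_numpow[OF q] coeff_simps algebra_simps)
  show "numpow q (c *\<^sub>C x) = c *\<^sub>C numpow q x" for c and x :: "'d fock"
    by (rule fock_eqI) (simp add: coeff_numpow[OF q] scaleC_fock.rep_eq)
  show "norm (numpow q x) \<le> 1 * norm x" for x :: "'d fock" using norm_numpow_le[OF q] by simp
qed

lemma numpow_form:
  fixes f :: "'a::finite fock"
  assumes q: "0 \<le> q" "q \<le> 1"
  shows "((\<lambda>xs. q ^ length xs * (cmod (coeff_fock f xs))\<^sup>2) has_sum Re (cinner f (numpow q f))) UNIV"
    "Im (cinner f (numpow q f)) = 0"
proof -
  have q': "\<bar>q\<bar> \<le> 1" using q by simp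
  have h: "((\<lambda>xs. complex_of_real (q ^ length xs * (cmod (coeff_fock f xs))\<^sup>2)) has_sum cinner f (numpow q f)) UNIV"
    using cinner_fock_has_sum[of f "numpow q f"]
    unfolding coeff_numpow[OF q'] of_real_mult complex_norm_square by (simp add: algebra_simps)
  show "((\<lambda>xs. q ^ length xs * (cmod (coeff_fock f xs))\<^sup>2) has_sum Re (cinner f (numpow q f))) UNIV"
    using has_sum_Re[OF h] unfolding Re_complex_of_real .
  have "((\<lambda>xs :: 'a list. 0) has_sum Im (cinner f (numpow q f))) UNIV"
    using has_sum_Im[OF h] unfolding Im_complex_of_real .
  from has_sum_unique[OF this has_sum_0_simp] show "Im (cinner f (numpow q f)) = 0" .
qed

section \<open>Cutting off the particle number\<close>

lemma finite_words_length_le: "finite {xs :: 'd::finite list. length xs \<le> n}"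
  using finite_lists_length_le[of "UNIV :: 'd set" n] by simp

lemma cinner_word_projection:
  "cinner f (\<Sum>ws | length ws \<le> n. rank1 (word_vec ws) (word_vec ws) f) =
   complex_of_real (\<Sum>ws | length ws \<le> n. (cmod (coeff_fock f ws))\<^sup>2)"
  unfolding cinner.sum_right cinner_rank1_self cinner_word_vec by simp

lemma word_projection_le_id:
  "positive_op (\<lambda>f :: 'd::finite fock. f - (\<Sum>ws | length ws \<le> n. rank1 (word_vec ws) (word_vec ws) f))"
proof -
  have "bounded_op (\<lambda>f :: 'd fock. f - (\<Sum>ws | length ws \<le> n. rank1 (word_vec ws) (word_vec ws) f))"
    by (intro bounded_op_diff bounded_op_sum) simp_all
  moreover have "(\<Sum>ws | length ws \<le> n. (cmod (coeff_fock f ws))\<^sup>2) \<le> (norm f)\<^sup>2" for f :: "'d fock"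
    by (rule norm_coeff_sum_le[OF finite_words_length_le])
  ultimately show ?thesis
    unfolding positive_op_def cinner_diff_right cinner_word_projection cinner_self
    by (simp add: nonneg_Reals_complex_iff)
qed

text \<open>Compared word by word: the weight \<open>q ^ length ws\<close> is at most
  \<open>1\<close> up to length \<open>n\<close> and at most \<open>q ^ n\<close> beyond.\<close>

lemma numpow_le_word_projection:
  assumes q: "0 \<le> q" "q \<le> 1"
  shows "positive_op (\<lambda>f :: 'd::finite fock.
    ((\<Sum>ws | length ws \<le> n. rank1 (word_vec ws) (word_vec ws) f) + complex_of_real (q ^ n) *\<^sub>C f) - numpow q f)"
proof -
  have q': "\<bar>q\<bar> \<le> 1" using q by simp
  have b: "bounded_op (\<lambda>f :: 'd fock. ((\<Sum>ws | length ws \<le> n. rank1 (word_vec ws) (word_vec ws) f) + complex_of_real (q ^ n) *\<^sub>C f) - numpow q f)"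
    by (intro bounded_op_diff bounded_op_add bounded_op_sum bounded_op_scaleC bounded_op_numpow q') simp_all
  have le: "Re (cinner f (numpow q f)) \<le> (\<Sum>ws | length ws \<le> n. (cmod (coeff_fock f ws))\<^sup>2) + q ^ n * (norm f)\<^sup>2" for f :: "'d fock"
  proof (rule has_sum_mono[OF numpow_form(1)[OF q]])
    have "((\<lambda>ws. if length ws \<le> n then (cmod (coeff_fock f ws))\<^sup>2 else 0) has_sum (\<Sum>ws | length ws \<le> n. (cmod (coeff_fock f ws))\<^sup>2)) UNIV"
      by (rule has_sum_finite_neutralI[where B = "{ws. length ws \<le> n}"]) (auto simp: finite_words_length_le)
    then show "((\<lambda>ws. (if length ws \<le> n then (cmod (coeff_fock f ws))\<^sup>2 else 0) + q ^ n * (cmod (coeff_fock f ws))\<^sup>2) has_sum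
        ((\<Sum>ws | length ws \<le> n. (cmod (coeff_fock f ws))\<^sup>2) + q ^ n * (norm f)\<^sup>2)) UNIV"
      by (intro has_sum_add has_sum_cmult_right norm_sq_has_sum)
    fix xs
    show "q ^ length xs * (cmod (coeff_fock f xs))\<^sup>2 \<le>
        (if length xs \<le> n then (cmod (coeff_fock f xs))\<^sup>2 else 0) + q ^ n * (cmod (coeff_fock f xs))\<^sup>2"
    proof (cases "length xs \<le> n")
      case True
      have "q ^ length xs * (cmod (coeff_fock f xs))\<^sup>2 \<le> 1 * (cmod (coeff_fock f xs))\<^sup>2"
        by (intro mult_right_mono power_le_one q) auto
      then show ?thesis using True q by (simp add: add_increasing2)
    next
      case False
      then show ?thesis using q by (auto intro!: mult_right_mono power_decreasing)
    qed
  qed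
  show ?thesis
    unfolding positive_op_def cinner_diff_right cinner_add_right cinner_word_projection cinner_scaleC_right cinner_self
    using b le numpow_form(2)[OF q, where 'a = 'd] by (simp add: nonneg_Reals_complex_iff)
qed

section \<open>Expectations of bounded families of operators\<close>

text \<open>A property of functions that is stable under linear combinations and uniform limits passes from
  the matrix elements at exponential vectors to all matrix elements and all normal states.\<close>

locale uniformly_closed =
  fixes B :: "'i \<Rightarrow> 'd::finite fock \<Rightarrow> 'd fock" and Q :: "('i \<Rightarrow> complex) \<Rightarrow> bool"
  assumes bounded: "\<And>i. bounded_op (B i)" and contr: "\<And>i x. norm (B i x) \<le> norm x"
    and add: "\<And>f g. Q f \<Longrightarrow> Q g \<Longrightarrow> Q (\<lambda>i. f i + g i)" and scale: "\<And>c f. Q f \<Longrightarrow> Q (\<lambda>i. c * f i)"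
    and lim: "\<And>f. (\<And>\<epsilon>. \<epsilon> > 0 \<Longrightarrow> \<exists>g. Q g \<and> (\<forall>i. cmod (f i - g i) \<le> \<epsilon>)) \<Longrightarrow> Q f"
    and base: "\<And>u v. Q (\<lambda>i. cinner (expvec u) (B i (expvec v)))"
begin

lemma zero: "Q (\<lambda>i. 0)"
  using scale[OF base, of 0] by simp

lemma sum: "(\<And>j. j \<in> F \<Longrightarrow> Q (f j)) \<Longrightarrow> Q (\<lambda>i. \<Sum>j\<in>F. f j i)"
  by (induction F rule: infinite_finite_induct) (auto simp: zero add)

text \<open>The parameter \<open>s\<close> is the identity or \<open>cnj\<close>, which serves the
  linear and the conjugate linear slot of a matrix element alike. The bound uniform in
  \<open>i\<close> makes the admissible vectors a closed subspace.\<close>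

lemma extend:
  assumes add': "\<And>x y i. h (x + y) i = h x i + h y i" and scale': "\<And>c x i. h (c *\<^sub>C x) i = s c * h x i"
    and bd: "\<And>x i. cmod (h x i) \<le> K * norm x"
    and base': "\<And>v. Q (h (expvec v))"
  shows "Q (h (x :: 'd fock))"
proof -
  define S where "S = {x. Q (h x)}"
  have "closure S \<subseteq> S"
  proof
    fix x assume x: "x \<in> closure S"
    have "Q (h x)"
    proof (rule lim)
      fix \<epsilon> :: real assume e: "\<epsilon> > 0"
      define d where "d = \<epsilon> / (\<bar>K\<bar> + 1)"
      have d: "d > 0" using e by (simp add: d_def add_nonneg_pos)
      obtain y where y: "y \<in> S" "dist y x < d" using x d unfolding closure_approachable by blast
      have "cmod (h x i - h y i) \<le> \<epsilon>" for i
      proof -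
        have "h x i = h (x - y) i + h y i" using add'[of "x - y" y i] by simp
        then have "cmod (h x i - h y i) = cmod (h (x - y) i)" by simp
        also have "\<dots> \<le> K * norm (x - y)" by (rule bd)
        also have "\<dots> \<le> (\<bar>K\<bar> + 1) * norm (x - y)" by (intro mult_right_mono) auto
        also have "\<dots> \<le> (\<bar>K\<bar> + 1) * d"
          using y(2) by (intro mult_left_mono) (auto simp: dist_norm norm_minus_commute)
        also have "\<dots> = \<epsilon>" by (simp add: d_def add_nonneg_eq_0_iff)
        finally show ?thesis .
      qed
      then show "\<exists>g. Q g \<and> (\<forall>i. cmod (h x i - g i) \<le> \<epsilon>)" using y(1) unfolding S_def by blast
    qed
    then show "x \<in> S" by (simp add: S_def)
  qed
  then have cl: "closed S" using closure_subset_eq by blast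
  have h0: "h (0 *\<^sub>C expvec 0) = (\<lambda>i. s 0 * h (expvec 0) i)" unfolding scale' ..
  have "0 \<in> S" using scale[OF base'[of 0], of "s 0"] h0 by (simp add: S_def)
  moreover have "x + y \<in> S" if "x \<in> S" "y \<in> S" for x y
  proof -
    have "h (x + y) = (\<lambda>i. h x i + h y i)" unfolding add' ..
    then show ?thesis using that add unfolding S_def by simp
  qed
  moreover have "c *\<^sub>C x \<in> S" if "x \<in> S" for c x
  proof -
    have "h (c *\<^sub>C x) = (\<lambda>i. s c * h x i)" unfolding scale' ..
    then show ?thesis using that scale unfolding S_def by simp
  qed
  ultimately have "closed_csubspace S" using cl by (simp add: closed_csubspace_def)
  moreover have "range expvec \<subseteq> S" using base' by (auto simp: S_def)
  ultimately have "S = UNIV"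
    by (intro total_subset_UNIV[of "range expvec"]) (blast intro: expvec_total)+
  then show ?thesis by (auto simp: S_def)
qed

lemma matrix_element_le: "cmod (cinner x (B i y)) \<le> norm x * norm y"
  by (rule order_trans[OF cmod_cinner_le mult_left_mono[OF contr]]) simp

lemma matrix_element: "Q (\<lambda>i. cinner x (B i y))"
proof -
  have 1: "Q (\<lambda>i. cinner (expvec u) (B i y))" for u y
  proof (rule extend[of "\<lambda>y i. cinner (expvec u) (B i y)" "\<lambda>c. c" "norm (expvec u)" y])
    show "cinner (expvec u) (B i (x + z)) = cinner (expvec u) (B i x) + cinner (expvec u) (B i z)" for x z i
      unfolding bounded_op_simps(1)[OF bounded] by (rule cinner_add_right)
    show "cinner (expvec u) (B i (c *\<^sub>C x)) = c * cinner (expvec u) (B i x)" for c x i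
      unfolding bounded_op_simps(3)[OF bounded] by (rule cinner_scaleC_right)
    show "cmod (cinner (expvec u) (B i x)) \<le> norm (expvec u) * norm x" for x i
      by (rule matrix_element_le)
  qed (rule base)
  show ?thesis
  proof (rule extend[of "\<lambda>x i. cinner x (B i y)" cnj "norm y" x])
    show "cmod (cinner x (B i y)) \<le> norm y * norm x" for x i
      using matrix_element_le[of x i y] by (simp only: mult.commute)
  qed (rule cinner_add_left cinner_scaleC_left 1)+
qed

text \<open>Finite sums of matrix elements at the vectors \<open>R e\<close> approximate the
  expectation uniformly in \<open>i\<close>: contractivity bounds the tail by the Hilbert-Schmidt
  tail of \<open>R\<close>.\<close>

lemma density_expectation:
  assumes \<eta>: "density_op \<eta>" shows "Q (\<lambda>i. trace_op (\<eta> \<circ> B i))"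
proof (rule lim)
  fix \<epsilon> :: real assume e: "\<epsilon> > 0"
  obtain R where "bounded_op R" "\<And>x y. cinner (R x) y = cinner x (R y)" "\<And>x. R (R x) = \<eta> x"
    and R: "\<And>E. is_onb E \<Longrightarrow> ((\<lambda>e. (norm (R e))\<^sup>2) has_sum 1) E"
    "\<And>E A. is_onb E \<Longrightarrow> bounded_op A \<Longrightarrow> ((\<lambda>e. cinner e (\<eta> (A e))) has_sum trace_op (\<eta> \<circ> A)) E"
    "\<And>E A. is_onb E \<Longrightarrow> bounded_op A \<Longrightarrow> ((\<lambda>e. cinner (R e) (A (R e))) has_sum trace_op (\<eta> \<circ> A)) E"
    by (rule density_opE[OF \<eta>]) (rule that)
  note s = R(1)[OF is_onb_onb0]
  obtain F where F: "finite F" "F \<subseteq> onb0" "dist (\<Sum>e\<in>F. (norm (R e))\<^sup>2) 1 \<le> \<epsilon>"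
    using has_sum_finite_approximation[OF s e] by blast
  have tail: "((\<lambda>e. (norm (R e))\<^sup>2) has_sum (1 - (\<Sum>e\<in>F. (norm (R e))\<^sup>2))) (onb0 - F)"
    by (rule has_sum_Diff[OF s has_sum_finite[OF F(1)] F(2)])
  have "cmod (trace_op (\<eta> \<circ> B i) - (\<Sum>e\<in>F. cinner (R e) (B i (R e)))) \<le> \<epsilon>" for i
  proof -
    have t: "((\<lambda>e. cinner (R e) (B i (R e))) has_sum (trace_op (\<eta> \<circ> B i) - (\<Sum>e\<in>F. cinner (R e) (B i (R e))))) (onb0 - F)"
      by (rule has_sum_Diff[OF R(3)[OF is_onb_onb0 bounded] has_sum_finite[OF F(1)] F(2)])
    have le: "cmod (cinner (R e) (B i (R e))) \<le> (norm (R e))\<^sup>2" for e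
      using matrix_element_le[of "R e" i "R e"] by (simp only: power2_eq_square)
    have "(\<lambda>e. cmod (cinner (R e) (B i (R e)))) summable_on (onb0 - F)"
      by (rule summable_on_comparison_test[OF has_sum_imp_summable[OF tail] le]) simp
    then obtain n where n: "((\<lambda>e. cmod (cinner (R e) (B i (R e)))) has_sum n) (onb0 - F)" by (auto simp: summable_on_def)
    have "cmod (trace_op (\<eta> \<circ> B i) - (\<Sum>e\<in>F. cinner (R e) (B i (R e)))) \<le> n"
      by (rule norm_has_sum_bound[OF n t])
    also have "n \<le> 1 - (\<Sum>e\<in>F. (norm (R e))\<^sup>2)" by (rule has_sum_mono[OF n tail le])
    also have "\<dots> \<le> \<epsilon>" using F(3) by (simp add: dist_real_def)
    finally show ?thesis .
  qed
  moreover have "Q (\<lambda>i. \<Sum>e\<in>F. cinner (R e) (B i (R e)))" by (rule sum) (rule matrix_element)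
  ultimately show "\<exists>g. Q g \<and> (\<forall>i. cmod (trace_op (\<eta> \<circ> B i) - g i) \<le> \<epsilon>)" by blast
qed

end

section \<open>Continuity and decay of characteristic functions\<close>

lemma continuous_uniform_approx:
  fixes f :: "'a::topological_space \<Rightarrow> complex"
  assumes "\<And>\<epsilon>. \<epsilon> > 0 \<Longrightarrow> \<exists>g. continuous_on UNIV g \<and> (\<forall>i. cmod (f i - g i) \<le> \<epsilon>)"
  shows "continuous_on UNIV f"
  unfolding continuous_on_def
proof (intro ballI tendstoI)
  fix x and \<epsilon> :: real assume e: "\<epsilon> > 0"
  then obtain g where g: "continuous_on UNIV g" "\<And>i. cmod (f i - g i) \<le> \<epsilon> / 4"
    using assms[of "\<epsilon> / 4"] by auto
  have "(g \<longlongrightarrow> g x) (at x)" using g(1) by (simp add: continuous_on_def)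
  then have "eventually (\<lambda>y. dist (g y) (g x) < \<epsilon> / 4) (at x)" using e by (intro tendstoD) auto
  then show "eventually (\<lambda>y. dist (f y) (f x) < \<epsilon>) (at x)"
  proof eventually_elim
    case (elim y)
    have "dist (f y) (g y) \<le> \<epsilon> / 4" "dist (g x) (f x) \<le> \<epsilon> / 4"
      using g(2)[of y] g(2)[of x] by (auto simp: dist_norm norm_minus_commute)
    then show ?case
      using elim dist_triangle[of "f y" "f x" "g y"] dist_triangle[of "g y" "f x" "g x"] e by linarith
  qed
qed

lemma continuous_cdot: "continuous_on UNIV (\<lambda>z. cdot z v)" "continuous_on UNIV (\<lambda>z. cdot u z)"
  unfolding cdot_def by (intro continuous_intros)+

lemma continuous_weyl_expectation:
  fixes \<eta> :: "'d::finite fock \<Rightarrow> 'd fock"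
  assumes "density_op \<eta>" shows "continuous_on UNIV (\<lambda>z. trace_op (\<eta> \<circ> weyl z))"
proof -
  interpret uniformly_closed "weyl :: _ \<Rightarrow> 'd fock \<Rightarrow> 'd fock" "\<lambda>f. continuous_on UNIV f"
  proof
    show "continuous_on UNIV (\<lambda>z. cinner (expvec u) (weyl z (expvec v)))" for u v :: "complex ^ 'd"
      unfolding cinner_expvec_weyl by (intro continuous_intros continuous_cdot) simp
    show "continuous_on UNIV (\<lambda>i. f i + g i)" if "continuous_on UNIV f" "continuous_on UNIV g"
      for f g :: "complex ^ 'd \<Rightarrow> complex" using that by (rule continuous_on_add)
    show "continuous_on UNIV (\<lambda>i. c * f i)" if "continuous_on UNIV f"
      for c and f :: "complex ^ 'd \<Rightarrow> complex" using that by (rule continuous_on_mult_left)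
  qed (simp_all add: bounded_op_weyl norm_weyl continuous_uniform_approx)
  show ?thesis by (rule density_expectation[OF assms])
qed

lemma tendsto_0_uniform_approx:
  fixes f :: "'a \<Rightarrow> complex"
  assumes "\<And>\<epsilon>. \<epsilon> > 0 \<Longrightarrow> \<exists>g. (g \<longlongrightarrow> 0) F \<and> (\<forall>i. cmod (f i - g i) \<le> \<epsilon>)"
  shows "(f \<longlongrightarrow> 0) F"
proof (rule tendstoI)
  fix \<epsilon> :: real assume e: "\<epsilon> > 0"
  then obtain g where g: "(g \<longlongrightarrow> 0) F" "\<And>i. cmod (f i - g i) \<le> \<epsilon> / 2"
    using assms[of "\<epsilon> / 2"] by auto
  have "eventually (\<lambda>y. dist (g y) 0 < \<epsilon> / 2) F" using g(1) e by (intro tendstoD) auto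
  then show "eventually (\<lambda>y. dist (f y) 0 < \<epsilon>) F"
  proof eventually_elim
    case (elim y)
    then show ?case using g(2)[of y] norm_triangle_sub[of "f y" "g y"] by simp
  qed
qed

lemma norm_cdot_le: "cmod (cdot z w) \<le> real CARD('d) * (norm z * norm (w :: complex ^ 'd::finite))"
proof -
  have "cmod (cdot z w) \<le> (\<Sum>i\<in>UNIV. cmod (cnj (z $ i) * w $ i))" unfolding cdot_def by (rule norm_sum)
  also have "\<dots> \<le> (\<Sum>i\<in>(UNIV :: 'd set). norm z * norm w)"
    by (intro sum_mono) (auto simp: norm_mult intro!: mult_mono Finite_Cartesian_Product.norm_nth_le)
  finally show ?thesis by simp
qed

text \<open>A quantum Riemann-Lebesgue lemma: at exponential vectors the Gaussian factor in
  \<open>z\<close> beats the exponential of the linear terms, and decay at infinity is stable under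
  uniform limits.\<close>

lemma weyl_expectation_tendsto_0:
  fixes \<eta> :: "'d::finite fock \<Rightarrow> 'd fock"
  assumes "density_op \<eta>" shows "((\<lambda>z. trace_op (\<eta> \<circ> weyl z)) \<longlongrightarrow> 0) at_infinity"
proof -
  interpret uniformly_closed "weyl :: _ \<Rightarrow> 'd fock \<Rightarrow> 'd fock" "\<lambda>f. (f \<longlongrightarrow> 0) at_infinity"
  proof
    fix u v :: "complex ^ 'd"
    define K where "K = real CARD('d) * (norm u + norm v)"
    have "((\<lambda>x :: real. exp (- x\<^sup>2 / 2 + K * x + Re (cdot u v))) \<longlongrightarrow> 0) at_top"
      by real_asymp
    then have "((\<lambda>z :: complex ^ 'd. exp (- (norm z)\<^sup>2 / 2 + K * norm z + Re (cdot u v))) \<longlongrightarrow> 0) at_infinity"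
      by (rule filterlim_compose[OF _ filterlim_norm_at_top])
    then show "((\<lambda>z. cinner (expvec u) (weyl z (expvec v))) \<longlongrightarrow> 0) at_infinity"
    proof (rule Lim_null_comparison[rotated])
      show "\<forall>\<^sub>F z in at_infinity. norm (cinner (expvec u) (weyl z (expvec v))) \<le> exp (- (norm z)\<^sup>2 / 2 + K * norm z + Re (cdot u v))"
      proof (rule always_eventually, rule allI)
        fix z :: "complex ^ 'd"
        have "- Re (cdot z v) \<le> real CARD('d) * (norm z * norm v)"
          using abs_Re_le_cmod[of "cdot z v"] norm_cdot_le[of z v] by linarith
        moreover have "Re (cdot u z) \<le> real CARD('d) * (norm u * norm z)"
          using abs_Re_le_cmod[of "cdot u z"] norm_cdot_le[of u z] by linarith
        ultimately show "norm (cinner (expvec u) (weyl z (expvec v))) \<le> exp (- (norm z)\<^sup>2 / 2 + K * norm z + Re (cdot u v))"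
          unfolding cinner_expvec_weyl norm_exp_eq_Re by (simp add: K_def algebra_simps)
      qed
    qed
  next
    show "((\<lambda>i. f i + g i) \<longlongrightarrow> 0) at_infinity" if "(f \<longlongrightarrow> 0) at_infinity" "(g \<longlongrightarrow> 0) at_infinity"
      for f g :: "complex ^ 'd \<Rightarrow> complex" using tendsto_add[OF that] by simp
    show "((\<lambda>i. c * f i) \<longlongrightarrow> 0) at_infinity" if "(f \<longlongrightarrow> 0) at_infinity"
      for c and f :: "complex ^ 'd \<Rightarrow> complex" using tendsto_mult_left[OF that, of c] by simp
  qed (simp_all add: bounded_op_weyl norm_weyl tendsto_0_uniform_approx)
  show ?thesis by (rule density_expectation[OF assms])
qed

section \<open>Gaussian averages of Weyl operators\<close>

text \<open>Completing the square absorbs the quadratic term and the real part of \<open>a\<close>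
  into an affine substitution; the imaginary part is left to the characteristic function of the
  normal law.\<close>

lemma gaussian_exponential_integral:
  fixes a :: complex and s :: real
  assumes s: "0 < s"
  shows "integrable std_normal_distribution (\<lambda>x. exp (- complex_of_real (s * x\<^sup>2 / 2) + a * complex_of_real x))" (is "integrable _ ?f")
    and "(CLINT x|std_normal_distribution. exp (- complex_of_real (s * x\<^sup>2 / 2) + a * complex_of_real x)) =
      complex_of_real (1 / sqrt (1 + s)) * exp (a\<^sup>2 / complex_of_real (2 * (1 + s)))"
proof -
  interpret real_distribution std_normal_distribution by (rule real_dist_normal_dist)
  have meas: "?f \<in> borel_measurable borel"
    by (intro borel_measurable_continuous_onI continuous_intros) auto
  show "integrable std_normal_distribution ?f"
  proof (rule integrable_const_bound[where B = "exp ((Re a)\<^sup>2 / (2 * s))"])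
    have "- (s * x\<^sup>2 / 2) + Re a * x \<le> (Re a)\<^sup>2 / (2 * s)" for x
    proof -
      have "0 \<le> (s * x - Re a)\<^sup>2 / (2 * s)" using s by simp
      also have "(s * x - Re a)\<^sup>2 / (2 * s) = s * x\<^sup>2 / 2 - Re a * x + (Re a)\<^sup>2 / (2 * s)"
        using s by (simp add: power2_diff field_simps power2_eq_square)
      finally show ?thesis by simp
    qed
    then show "AE x in std_normal_distribution. norm (?f x) \<le> exp ((Re a)\<^sup>2 / (2 * s))" by simp
  qed (use meas in simp)
  \<comment> \<open>The tilted density has variance \<open>1 / (1 + s)\<close> and mean
    \<open>Re a / (1 + s)\<close>, which are \<open>c\<^sup>2\<close> and \<open>t\<close>.\<close>
  define c where "c = 1 / sqrt (1 + s)"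
  define t where "t = Re a / (1 + s)"
  have c: "c > 0" "c\<^sup>2 = 1 / (1 + s)" using s by (auto simp: c_def power_divide)
  have st: "(1 + s) * t = Re a" "(1 + s) * c\<^sup>2 = 1" using s by (auto simp: t_def c)
  have "(CLINT x|std_normal_distribution. ?f x) = (CLINT x|lborel. std_normal_density x *\<^sub>R ?f x)"
    by (rule integral_density) (use meas in auto)
  also have "\<dots> = \<bar>c\<bar> *\<^sub>R (CLINT x|lborel. std_normal_density (t + c * x) *\<^sub>R ?f (t + c * x))"
    by (rule lborel_integral_real_affine) (use c in simp)
  also have "(\<lambda>x. std_normal_density (t + c * x) *\<^sub>R ?f (t + c * x)) =
      (\<lambda>x. exp (complex_of_real ((Re a)\<^sup>2 / (2 * (1 + s))) + \<i> * complex_of_real (Im a * t)) *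
        (std_normal_density x *\<^sub>R iexp (Im a * c * x)))"
  proof
    fix x
    have re: "- (t + c * x)\<^sup>2 / 2 - s * (t + c * x)\<^sup>2 / 2 + Re a * (t + c * x) = (Re a)\<^sup>2 / (2 * (1 + s)) - x\<^sup>2 / 2"
    proof -
      have "- (t + c * x)\<^sup>2 / 2 - s * (t + c * x)\<^sup>2 / 2 + Re a * (t + c * x) =
         - ((1 + s) * t) * t / 2 - ((1 + s) * t) * c * x - ((1 + s) * c\<^sup>2) * x\<^sup>2 / 2 + Re a * (t + c * x)"
        by (simp add: power2_eq_square field_simps)
      also have "\<dots> = Re a * t / 2 - x\<^sup>2 / 2" unfolding st by (simp add: algebra_simps)
      also have "Re a * t / 2 = (Re a)\<^sup>2 / (2 * (1 + s))" by (simp add: t_def power2_eq_square)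
      finally show ?thesis .
    qed
    have a: "a = complex_of_real (Re a) + \<i> * complex_of_real (Im a)" by (rule complex_eq)
    have "std_normal_density (t + c * x) *\<^sub>R ?f (t + c * x) =
       complex_of_real (1 / sqrt (2 * pi)) * exp (complex_of_real (- (t + c * x)\<^sup>2 / 2) + (- complex_of_real (s * (t + c * x)\<^sup>2 / 2) + a * complex_of_real (t + c * x)))"
      unfolding std_normal_density_def exp_add scaleR_conv_of_real exp_of_real by simp
    also have "complex_of_real (- (t + c * x)\<^sup>2 / 2) + (- complex_of_real (s * (t + c * x)\<^sup>2 / 2) + a * complex_of_real (t + c * x)) =
       complex_of_real (- (t + c * x)\<^sup>2 / 2 - s * (t + c * x)\<^sup>2 / 2 + Re a * (t + c * x)) + \<i> * complex_of_real (Im a * (t + c * x))"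
      by (subst (1) a) (simp add: algebra_simps)
    also have "\<dots> = (complex_of_real ((Re a)\<^sup>2 / (2 * (1 + s))) + \<i> * complex_of_real (Im a * t)) + (complex_of_real (- x\<^sup>2 / 2) + \<i> * complex_of_real (Im a * c * x))"
      unfolding re by (simp add: algebra_simps)
    finally show "std_normal_density (t + c * x) *\<^sub>R ?f (t + c * x) = exp (complex_of_real ((Re a)\<^sup>2 / (2 * (1 + s))) + \<i> * complex_of_real (Im a * t)) *
        (std_normal_density x *\<^sub>R iexp (Im a * c * x))"
      unfolding std_normal_density_def exp_add[of "_ + _" "_ + _"] exp_add[of "complex_of_real (- x\<^sup>2 / 2)"] scaleR_conv_of_real exp_of_real
      by simp
  qed
  also have "(CLINT x|lborel. exp (complex_of_real ((Re a)\<^sup>2 / (2 * (1 + s))) + \<i> * complex_of_real (Im a * t)) *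
        (std_normal_density x *\<^sub>R iexp (Im a * c * x))) =
      exp (complex_of_real ((Re a)\<^sup>2 / (2 * (1 + s))) + \<i> * complex_of_real (Im a * t)) * (CLINT x|lborel. std_normal_density x *\<^sub>R iexp (Im a * c * x))"
    by (rule integral_mult_right_zero)
  also have "(CLINT x|lborel. std_normal_density x *\<^sub>R iexp (Im a * c * x)) = char std_normal_distribution (Im a * c)"
    unfolding char_def by (rule integral_density[symmetric]) (auto intro!: borel_measurable_continuous_onI continuous_intros)
  also have "\<dots> = exp (complex_of_real (- ((Im a * c)\<^sup>2) / 2))"
    unfolding char_std_normal_distribution exp_of_real ..
  also have "exp (complex_of_real ((Re a)\<^sup>2 / (2 * (1 + s))) + \<i> * complex_of_real (Im a * t)) * exp (complex_of_real (- ((Im a * c)\<^sup>2) / 2)) =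
      exp (a\<^sup>2 / complex_of_real (2 * (1 + s)))"
  proof -
    have a2: "a\<^sup>2 = complex_of_real ((Re a)\<^sup>2 - (Im a)\<^sup>2) + \<i> * complex_of_real (2 * Re a * Im a)"
      by (simp add: complex_eq_iff power2_eq_square)
    have "complex_of_real ((Re a)\<^sup>2 / (2 * (1 + s))) + \<i> * complex_of_real (Im a * t) + complex_of_real (- ((Im a * c)\<^sup>2) / 2) = a\<^sup>2 / complex_of_real (2 * (1 + s))"
    proof (rule complex_eqI)
      have "(Im a * c)\<^sup>2 / 2 = (Im a)\<^sup>2 / (2 * (1 + s))" unfolding power_mult_distrib c(2) by simp
      then have "(Re a)\<^sup>2 / (2 * (1 + s)) - (Im a * c)\<^sup>2 / 2 = ((Re a)\<^sup>2 - (Im a)\<^sup>2) / (2 * (1 + s))"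
        by (simp only: diff_divide_distrib)
      then show "Re (complex_of_real ((Re a)\<^sup>2 / (2 * (1 + s))) + \<i> * complex_of_real (Im a * t) + complex_of_real (- ((Im a * c)\<^sup>2) / 2)) = Re (a\<^sup>2 / complex_of_real (2 * (1 + s)))"
        unfolding a2 Re_divide_of_real by simp
      have "Im a * t = 2 * Re a * Im a / (2 * (1 + s))" by (simp only: t_def mult.assoc mult_divide_mult_cancel_left) simp
      then show "Im (complex_of_real ((Re a)\<^sup>2 / (2 * (1 + s))) + \<i> * complex_of_real (Im a * t) + complex_of_real (- ((Im a * c)\<^sup>2) / 2)) = Im (a\<^sup>2 / complex_of_real (2 * (1 + s)))"
        unfolding a2 Im_divide_of_real by simp
    qed
    then show ?thesis by (simp only: mult_exp_exp)
  qed
  finally show "(CLINT x|std_normal_distribution. ?f x) = complex_of_real (1 / sqrt (1 + s)) * exp (a\<^sup>2 / complex_of_real (2 * (1 + s)))"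
    using c(1) by (simp add: scaleR_conv_of_real c_def)
qed

definition normal_product :: "('d + 'd \<Rightarrow> real) measure" where
  "normal_product = Pi\<^sub>M UNIV (\<lambda>_. std_normal_distribution)"

text \<open>Under \<open>normal_product\<close>, a random point whose real and imaginary parts are
  independent and centred with variance \<open>r\<^sup>2\<close>.\<close>

definition phase_point :: "real \<Rightarrow> ('d + 'd \<Rightarrow> real) \<Rightarrow> complex ^ 'd::finite" where
  "phase_point r \<omega> = (\<chi> i. Complex (r * \<omega> (Inl i)) (r * \<omega> (Inr i)))"

interpretation normal_product: prob_space "normal_product :: ('d::finite + 'd \<Rightarrow> real) measure"
proof -
  interpret product_prob_space "\<lambda>_ :: 'd + 'd. std_normal_distribution" UNIV
    by (rule product_prob_spaceI) (simp add: prob_space_normal_density)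
  show "prob_space (normal_product :: ('d + 'd \<Rightarrow> real) measure)"
    unfolding normal_product_def by unfold_locales
qed

lemma phase_point_measurable: "phase_point r \<in> borel_measurable normal_product"
proof -
  have comp: "(\<lambda>\<omega>. \<omega> k) \<in> borel_measurable normal_product" for k :: "'d + 'd"
    unfolding normal_product_def
    using measurable_component_singleton[of k UNIV "\<lambda>_. std_normal_distribution"] by simp
  show ?thesis
    unfolding borel_measurable_euclidean_space[of "phase_point r"]
  proof
    fix b :: "complex ^ 'd" assume "b \<in> Basis"
    then obtain i u where b: "b = axis i u" "u \<in> Basis" by (auto simp: Basis_vec_def)
    have "(\<lambda>\<omega>. phase_point r \<omega> \<bullet> b) = (\<lambda>\<omega>. Complex (r * \<omega> (Inl i)) (r * \<omega> (Inr i)) \<bullet> u)"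
      by (simp add: b(1) inner_axis phase_point_def)
    moreover have "u = 1 \<or> u = \<i>" using b(2) by (auto simp: Basis_complex_def)
    ultimately have "(\<lambda>\<omega>. phase_point r \<omega> \<bullet> b) = (\<lambda>\<omega>. r * \<omega> (Inl i)) \<or> (\<lambda>\<omega>. phase_point r \<omega> \<bullet> b) = (\<lambda>\<omega>. r * \<omega> (Inr i))"
      by (auto simp: inner_complex_def)
    then show "(\<lambda>\<omega>. phase_point r \<omega> \<bullet> b) \<in> borel_measurable normal_product"
      using borel_measurable_times[OF borel_measurable_const comp] by auto
  qed
qed

lemma integrable_phase_point:
  fixes h :: "complex ^ 'd::finite \<Rightarrow> complex"
  assumes "continuous_on UNIV h" "\<And>z. cmod (h z) \<le> K"
  shows "integrable normal_product (\<lambda>\<omega>. h (phase_point r \<omega>))"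
proof (rule normal_product.integrable_const_bound[where B = K])
  show "(\<lambda>\<omega>. h (phase_point r \<omega>)) \<in> borel_measurable normal_product"
    by (rule measurable_compose[OF phase_point_measurable borel_measurable_continuous_onI[OF assms(1)]])
qed (use assms(2) in simp)

text \<open>The exponent splits over the real coordinates, so the average is a product of
  one-dimensional integrals. Up to the prefactor the result is a matrix element of
  \<open>q^N\<close> for \<open>q = (1 - r\<^sup>2) / (1 + r\<^sup>2)\<close>.\<close>

lemma gaussian_average_weyl_expvec:
  fixes u v :: "complex ^ 'd::finite"
  assumes r: "0 < r"
  shows "(CLINT \<omega>|normal_product. cinner (expvec u) (weyl (phase_point r \<omega>) (expvec v))) =
    complex_of_real ((1 / (1 + r\<^sup>2)) ^ CARD('d)) * exp (complex_of_real ((1 - r\<^sup>2) / (1 + r\<^sup>2)) * cdot u v)"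
proof -
  define s where "s = r\<^sup>2"
  have s: "0 < s" using r by (simp add: s_def)
  \<comment> \<open>The linear coefficient of each real coordinate in the exponent of the matrix
    element.\<close>
  define \<beta> where "\<beta> k = (case k of Inl i \<Rightarrow> complex_of_real r * (cnj (u $ i) - v $ i)
      | Inr i \<Rightarrow> \<i> * complex_of_real r * (cnj (u $ i) + v $ i))" for k :: "'d + 'd"
  define g where "g k x = - complex_of_real (s * x\<^sup>2 / 2) + \<beta> k * complex_of_real x" for k and x :: real
  have split: "(\<Sum>k\<in>(UNIV :: ('d + 'd) set). h k) = (\<Sum>i\<in>UNIV. h (Inl i) + h (Inr i))" for h :: "'d + 'd \<Rightarrow> complex"
    unfolding UNIV_Plus_UNIV[symmetric] by (simp add: sum.Plus sum.distrib del: UNIV_Plus_UNIV)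
  have point: "cinner (expvec u) (weyl (phase_point r \<omega>) (expvec v)) = exp (cdot u v) * (\<Prod>k\<in>UNIV. exp (g k (\<omega> k)))" for \<omega>
  proof -
    define z :: "complex ^ 'd" where "z = phase_point r \<omega>"
    have comp: "- (cnj (z $ i) * z $ i) / 2 - cnj (z $ i) * v $ i + cnj (u $ i) * z $ i = g (Inl i) (\<omega> (Inl i)) + g (Inr i) (\<omega> (Inr i))" for i
      by (simp add: z_def phase_point_def g_def \<beta>_def s_def complex_eq_iff power2_eq_square) (simp add: field_simps)
    have "- complex_of_real ((norm z)\<^sup>2) / 2 - cdot z v + cdot u z =
        (\<Sum>i\<in>UNIV. - (cnj (z $ i) * z $ i) / 2 - cnj (z $ i) * v $ i + cnj (u $ i) * z $ i)"
      unfolding cdot_self[symmetric] cdot_def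
      by (simp add: sum.distrib sum_subtractf sum_negf sum_divide_distrib)
    also have "\<dots> = (\<Sum>k\<in>UNIV. g k (\<omega> k))" unfolding split comp ..
    finally have "- complex_of_real ((norm z)\<^sup>2) / 2 - cdot z v + cdot u z + cdot u v = cdot u v + (\<Sum>k\<in>UNIV. g k (\<omega> k))"
      by simp
    then show ?thesis
      unfolding cinner_expvec_weyl z_def[symmetric] exp_add[symmetric] exp_sum[OF finite_class.finite_UNIV, symmetric] by (simp only:)
  qed
  interpret ps: product_prob_space "\<lambda>_ :: 'd + 'd. std_normal_distribution" UNIV
    by (rule product_prob_spaceI) (simp add: prob_space_normal_density)
  have "(CLINT \<omega>|normal_product. cinner (expvec u) (weyl (phase_point r \<omega>) (expvec v))) =
      exp (cdot u v) * (CLINT \<omega>|Pi\<^sub>M UNIV (\<lambda>_. std_normal_distribution). \<Prod>k\<in>UNIV. exp (g k (\<omega> k)))"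
    unfolding point normal_product_def by (rule integral_mult_right_zero)
  also have "(CLINT \<omega>|Pi\<^sub>M UNIV (\<lambda>_. std_normal_distribution). \<Prod>k\<in>UNIV. exp (g k (\<omega> k))) =
      (\<Prod>k\<in>UNIV. CLINT x|std_normal_distribution. exp (g k x))"
    unfolding g_def
    by (rule ps.product_integral_prod[OF finite_class.finite_UNIV gaussian_exponential_integral(1)[OF s]])
  also have "\<dots> = (\<Prod>k\<in>UNIV. complex_of_real (1 / sqrt (1 + s)) * exp ((\<beta> k)\<^sup>2 / complex_of_real (2 * (1 + s))))"
    unfolding g_def gaussian_exponential_integral(2)[OF s] ..
  also have "\<dots> = complex_of_real (1 / sqrt (1 + s)) ^ (CARD('d) + CARD('d)) * exp (\<Sum>k\<in>UNIV. (\<beta> k)\<^sup>2 / complex_of_real (2 * (1 + s)))"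
    unfolding prod.distrib exp_sum[OF finite_class.finite_UNIV] by simp
  also have "complex_of_real (1 / sqrt (1 + s)) ^ (CARD('d) + CARD('d)) = complex_of_real ((1 / (1 + s)) ^ CARD('d))"
  proof -
    have "(1 / sqrt (1 + s)) * (1 / sqrt (1 + s)) = 1 / (1 + s)" using s by simp
    then show ?thesis unfolding power_add power_mult_distrib[symmetric] of_real_mult[symmetric] of_real_power[symmetric] by simp
  qed
  also have "(\<Sum>k\<in>UNIV. (\<beta> k)\<^sup>2 / complex_of_real (2 * (1 + s))) = - complex_of_real (2 * s / (1 + s)) * cdot u v"
  proof -
    \<comment> \<open>The pure squares cancel between the real and the imaginary coordinate; only
      the cross term survives.\<close>
    have "(\<beta> (Inl i))\<^sup>2 + (\<beta> (Inr i))\<^sup>2 = - complex_of_real (4 * s) * (cnj (u $ i) * v $ i)" for i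
      by (simp add: \<beta>_def s_def power2_eq_square algebra_simps)
    then have "(\<Sum>k\<in>UNIV. (\<beta> k)\<^sup>2) = - complex_of_real (4 * s) * cdot u v"
      unfolding split cdot_def sum_distrib_left by simp
    then have "(\<Sum>k\<in>UNIV. (\<beta> k)\<^sup>2 / complex_of_real (2 * (1 + s))) = - complex_of_real (4 * s) * cdot u v / complex_of_real (2 * (1 + s))"
      unfolding sum_divide_distrib[symmetric] by simp
    also have "\<dots> = - complex_of_real (4 * s / (2 * (1 + s))) * cdot u v" by simp
    also have "4 * s / (2 * (1 + s)) = 2 * s / (1 + s)" using s by (simp add: field_simps)
    finally show ?thesis .
  qed
  also have "exp (cdot u v) * (complex_of_real ((1 / (1 + s)) ^ CARD('d)) * exp (- complex_of_real (2 * s / (1 + s)) * cdot u v)) =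
      complex_of_real ((1 / (1 + s)) ^ CARD('d)) * exp (cdot u v + - complex_of_real (2 * s / (1 + s)) * cdot u v)"
    unfolding exp_add by (simp only: mult_ac)
  also have "cdot u v + - complex_of_real (2 * s / (1 + s)) * cdot u v = complex_of_real (1 - 2 * s / (1 + s)) * cdot u v"
    by (simp add: algebra_simps)
  also have "1 - 2 * s / (1 + s) = (1 - s) / (1 + s)" using s by (simp add: field_simps)
  finally show ?thesis by (simp only: s_def)
qed

text \<open>The averaging identity is linear and stable under uniform limits, so it extends from
  exponential vectors to densities by the locale.\<close>

lemma gaussian_average_density:
  fixes \<eta> :: "'d::finite fock \<Rightarrow> 'd fock"
  assumes \<eta>: "density_op \<eta>" and r: "0 < r"
  shows "(CLINT \<omega>|normal_product. trace_op (\<eta> \<circ> weyl (phase_point r \<omega>))) =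
    complex_of_real ((1 / (1 + r\<^sup>2)) ^ CARD('d)) * trace_op (\<eta> \<circ> numpow ((1 - r\<^sup>2) / (1 + r\<^sup>2)))"
proof -
  define c where "c = complex_of_real ((1 / (1 + r\<^sup>2)) ^ CARD('d))"
  define q where "q = (1 - r\<^sup>2) / (1 + r\<^sup>2)"
  have r2: "0 < r\<^sup>2" using r by simp
  have "\<bar>1 - r\<^sup>2\<bar> \<le> \<bar>1 + r\<^sup>2\<bar>" using r2 by linarith
  then have q: "\<bar>q\<bar> \<le> 1" using r2 unfolding q_def abs_divide by (simp add: divide_le_eq)
  \<comment> \<open>One family holds both sides of the identity: \<open>Some z\<close> indexes the
    Weyl operators to be averaged, \<open>None\<close> the operator they average to.\<close>
  define B where "B = (\<lambda>i :: (complex ^ 'd) option. case i of None \<Rightarrow> numpow q | Some z \<Rightarrow> (weyl z :: 'd fock \<Rightarrow> 'd fock))"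
  \<comment> \<open>Continuity and boundedness accompany the identity so that all integrals
    exist.\<close>
  define Q where "Q = (\<lambda>f :: (complex ^ 'd) option \<Rightarrow> complex. continuous_on UNIV (\<lambda>z. f (Some z)) \<and>
    (\<exists>K. \<forall>z. cmod (f (Some z)) \<le> K) \<and> (CLINT \<omega>|normal_product. f (Some (phase_point r \<omega>))) = c * f None)"
  have int: "integrable normal_product (\<lambda>\<omega>. f (Some (phase_point r \<omega>)))" if "Q f" for f
    using that integrable_phase_point[of "\<lambda>z. f (Some z)"] unfolding Q_def by blast
  interpret uniformly_closed B Q
  proof
    show "bounded_op (B i)" for i
      by (cases i) (simp_all add: B_def bounded_op_weyl bounded_op_numpow[OF q])
    show "norm (B i x) \<le> norm x" for i x
      by (cases i) (simp_all add: B_def norm_weyl norm_numpow_le[OF q])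
    show "Q (\<lambda>i. f i + g i)" if f: "Q f" and g: "Q g" for f g
    proof -
      obtain K L where K: "\<forall>z. cmod (f (Some z)) \<le> K" and L: "\<forall>z. cmod (g (Some z)) \<le> L" using f g unfolding Q_def by blast
      have "\<forall>z. cmod (f (Some z) + g (Some z)) \<le> K + L" using K L norm_triangle_mono by blast
      moreover have "(CLINT \<omega>|normal_product. f (Some (phase_point r \<omega>)) + g (Some (phase_point r \<omega>))) = c * (f None + g None)"
        using f g unfolding Bochner_Integration.integral_add[OF int[OF f] int[OF g]] Q_def by (simp add: distrib_left)
      ultimately show ?thesis using f g unfolding Q_def by (intro conjI exI[of _ "K + L"] continuous_on_add) blast+
    qed
    show "Q (\<lambda>i. a * f i)" if f: "Q f" for a f
    proof -
      obtain K where K: "\<forall>z. cmod (f (Some z)) \<le> K" using f unfolding Q_def by blast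
      have "\<forall>z. cmod (a * f (Some z)) \<le> cmod a * K" using K by (simp add: norm_mult mult_left_mono)
      moreover have "(CLINT \<omega>|normal_product. a * f (Some (phase_point r \<omega>))) = c * (a * f None)"
        using f unfolding integral_mult_right_zero Q_def by simp
      ultimately show ?thesis using f unfolding Q_def by (intro conjI exI[of _ "cmod a * K"] continuous_on_mult_left) blast+
    qed
    show "Q f" if app: "\<And>\<epsilon>. \<epsilon> > 0 \<Longrightarrow> \<exists>g. Q g \<and> (\<forall>i. cmod (f i - g i) \<le> \<epsilon>)" for f
    proof -
      have cont: "continuous_on UNIV (\<lambda>z. f (Some z))"
      proof (rule continuous_uniform_approx)
        fix \<epsilon> :: real assume "\<epsilon> > 0"
        from app[OF this] obtain g where g: "Q g" "\<forall>i. cmod (f i - g i) \<le> \<epsilon>" by blast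
        show "\<exists>g. continuous_on UNIV g \<and> (\<forall>z. cmod (f (Some z) - g z) \<le> \<epsilon>)"
          by (rule exI[of _ "\<lambda>z. g (Some z)"]) (use g in \<open>simp add: Q_def\<close>)
      qed
      obtain g0 K where g0: "\<forall>i. cmod (f i - g0 i) \<le> 1" "\<forall>z. cmod (g0 (Some z)) \<le> K"
        using app[of 1] unfolding Q_def by auto
      have bd: "cmod (f (Some z)) \<le> 1 + K" for z
        using norm_triangle_sub[of "f (Some z)" "g0 (Some z)"] g0(1)[rule_format, of "Some z"] g0(2)[rule_format, of z] by linarith
      have intf: "integrable normal_product (\<lambda>\<omega>. f (Some (phase_point r \<omega>)))"
        by (rule integrable_phase_point[OF cont bd])
      \<comment> \<open>Replacing \<open>f\<close> by a function within \<open>d\<close> of it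
        changes the two sides by at most \<open>d\<close> and \<open>cmod c * d\<close>, which add
        up to \<open>\<epsilon>\<close>.\<close>
      have le: "cmod ((CLINT \<omega>|normal_product. f (Some (phase_point r \<omega>))) - c * f None) \<le> 0 + \<epsilon>" if e: "\<epsilon> > 0" for \<epsilon>
      proof -
        define d where "d = \<epsilon> / (1 + cmod c)"
        have c1: "1 + cmod c > 0" using norm_ge_zero[of c] by linarith
        then have d: "d > 0" using e by (simp add: d_def)
        from app[OF this] obtain g where g: "Q g" "\<And>i. cmod (f i - g i) \<le> d" by blast
        have "(CLINT \<omega>|normal_product. f (Some (phase_point r \<omega>))) - c * f None =
            (CLINT \<omega>|normal_product. f (Some (phase_point r \<omega>)) - g (Some (phase_point r \<omega>))) - c * (f None - g None)"
          unfolding Bochner_Integration.integral_diff[OF intf int[OF g(1)]] using g(1) unfolding Q_def by (simp add: right_diff_distrib)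
        also have "cmod \<dots> \<le> cmod (CLINT \<omega>|normal_product. f (Some (phase_point r \<omega>)) - g (Some (phase_point r \<omega>))) + cmod (c * (f None - g None))"
          by (rule norm_triangle_ineq4)
        also have "\<dots> \<le> d + cmod c * d"
        proof (rule add_mono)
          have "cmod (CLINT \<omega>|normal_product. f (Some (phase_point r \<omega>)) - g (Some (phase_point r \<omega>))) \<le>
              (LINT \<omega>|normal_product. cmod (f (Some (phase_point r \<omega>)) - g (Some (phase_point r \<omega>))))"
            by (rule integral_norm_bound)
          also have "\<dots> \<le> (LINT \<omega>|(normal_product :: ('d + 'd \<Rightarrow> real) measure). d)"
            by (rule integral_mono) (use g(2) intf int[OF g(1)] in auto)
          also have "\<dots> = d" by (simp add: normal_product.prob_space)
          finally show "cmod (CLINT \<omega>|normal_product. f (Some (phase_point r \<omega>)) - g (Some (phase_point r \<omega>))) \<le> d" .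
          show "cmod (c * (f None - g None)) \<le> cmod c * d"
            unfolding norm_mult by (intro mult_left_mono g(2)) simp
        qed
        also have "\<dots> = (1 + cmod c) * d" by (simp add: algebra_simps)
        also have "\<dots> = \<epsilon>" using c1 by (simp add: d_def)
        finally show ?thesis by simp
      qed
      have "cmod ((CLINT \<omega>|normal_product. f (Some (phase_point r \<omega>))) - c * f None) \<le> 0"
        by (rule field_le_epsilon) (rule le)
      then have "(CLINT \<omega>|normal_product. f (Some (phase_point r \<omega>))) = c * f None" by simp
      then show ?thesis using cont bd unfolding Q_def by blast
    qed
    show "Q (\<lambda>i. cinner (expvec u) (B i (expvec v)))" for u v
    proof -
      have "continuous_on UNIV (\<lambda>z. cinner (expvec u) (weyl z (expvec v)))"
        unfolding cinner_expvec_weyl by (intro continuous_intros continuous_cdot) simp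
      moreover have "cmod (cinner (expvec u) (weyl z (expvec v))) \<le> norm (expvec u) * norm (expvec v)" for z
        using cmod_cinner_le[of "expvec u" "weyl z (expvec v)"] by (simp add: norm_weyl)
      moreover have "(q *\<^sub>R v) $ i = complex_of_real q * v $ i" for i
        unfolding vector_scaleR_component by (rule scaleR_conv_of_real)
      then have "cinner (expvec u) (numpow q (expvec v)) = exp (complex_of_real q * cdot u v)"
        by (simp add: numpow_expvec[OF q] cinner_expvec cdot_def sum_distrib_left mult.left_commute del: vector_scaleR_component)
      ultimately show ?thesis
        unfolding Q_def B_def option.case gaussian_average_weyl_expvec[OF r] c_def q_def by auto
    qed
  qed
  have "Q (\<lambda>i. trace_op (\<eta> \<circ> B i))" by (rule density_expectation[OF \<eta>])
  then show ?thesis unfolding Q_def B_def option.case c_def q_def by blast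
qed

lemma phase_point_tail_measurable:
  "{\<omega>. c < norm (phase_point r \<omega> :: complex ^ 'd::finite)} \<in> sets normal_product"
proof -
  have "(\<lambda>\<omega>. norm (phase_point r \<omega> :: complex ^ 'd)) \<in> borel_measurable normal_product"
    by (rule measurable_compose[OF phase_point_measurable]) simp
  from borel_measurable_less[OF borel_measurable_const this, of c] show ?thesis
    by (simp add: normal_product_def space_PiM)
qed

text \<open>The tails at radius \<open>n\<close> for unit scale decrease to the empty set; scaling
  by \<open>r\<close> with \<open>r * n \<le> \<delta>\<close> moves the tail beyond
  \<open>\<delta>\<close> inside one of them.\<close>

lemma phase_point_tail:
  assumes \<delta>: "0 < \<delta>" and \<epsilon>: "0 < \<epsilon>"
  obtains r where "0 < r" "r \<le> 1"
    "measure normal_product {\<omega>. \<delta> < norm (phase_point r \<omega> :: complex ^ 'd::finite)} \<le> \<epsilon>"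
proof -
  define A where "A n = {\<omega>. real n < norm (phase_point 1 \<omega> :: complex ^ 'd)}" for n
  have "(\<lambda>n. measure normal_product (A n)) \<longlonglongrightarrow> measure normal_product (\<Inter>n. A n)"
    by (rule normal_product.finite_Lim_measure_decseq)
      (auto simp: A_def phase_point_tail_measurable decseq_def intro: le_less_trans)
  moreover have "\<exists>n. \<omega> \<notin> A n" for \<omega>
  proof -
    obtain n where "norm (phase_point 1 \<omega> :: complex ^ 'd) < real n" using reals_Archimedean2 by blast
    then have "\<omega> \<notin> A n" by (simp add: A_def)
    then show ?thesis ..
  qed
  then have "(\<Inter>n. A n) = {}" by blast
  ultimately have "(\<lambda>n. measure normal_product (A n)) \<longlonglongrightarrow> 0" by simp
  then have "eventually (\<lambda>n. measure normal_product (A n) < \<epsilon>) sequentially" using \<epsilon> by (rule order_tendstoD(2))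
  then obtain n where n: "measure normal_product (A n) < \<epsilon>" by (auto simp: eventually_sequentially)
  define r where "r = min 1 (\<delta> / (real n + 1))"
  have r: "0 < r" "r \<le> 1" using \<delta> by (auto simp: r_def)
  have rn: "r * real n \<le> \<delta>"
  proof -
    have "r * real n \<le> \<delta> / (real n + 1) * real n" unfolding r_def by (intro mult_right_mono) auto
    also have "\<dots> \<le> \<delta>" using \<delta> by (simp add: field_simps)
    finally show ?thesis .
  qed
  have "{\<omega>. \<delta> < norm (phase_point r \<omega> :: complex ^ 'd)} \<subseteq> A n"
  proof
    fix \<omega> assume "\<omega> \<in> {\<omega>. \<delta> < norm (phase_point r \<omega> :: complex ^ 'd)}"
    moreover have "phase_point r \<omega> = r *\<^sub>R (phase_point 1 \<omega> :: complex ^ 'd)"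
      by (simp add: vec_eq_iff phase_point_def complex_eq_iff)
    then have "norm (phase_point r \<omega> :: complex ^ 'd) = r * norm (phase_point 1 \<omega> :: complex ^ 'd)" using r(1) by simp
    ultimately have "r * real n < r * norm (phase_point 1 \<omega> :: complex ^ 'd)" using rn by auto
    then show "\<omega> \<in> A n" unfolding mult_less_cancel_left_pos[OF r(1)] by (simp add: A_def)
  qed
  then have "measure normal_product {\<omega>. \<delta> < norm (phase_point r \<omega> :: complex ^ 'd)} \<le> measure normal_product (A n)"
    by (rule normal_product.finite_measure_mono) (simp add: A_def phase_point_tail_measurable)
  with n r that show ?thesis by fastforce
qed

text \<open>Averaging \<open>weyl z\<close> over a narrow Gaussian distribution of \<open>z\<close> yields a multiple of \<open>numpow q\<close>,
  which is close to a projection onto finitely many word vectors. The resulting bound on the tail of a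
  density operator therefore depends only on the modulus of continuity of its characteristic function
  at \<open>0\<close>.\<close>

lemma density_tight:
  assumes \<delta>: "0 < \<delta>" and \<epsilon>: "0 < \<epsilon>"
  obtains n where "\<And>\<eta> :: 'd::finite fock \<Rightarrow> 'd fock. density_op \<eta> \<Longrightarrow>
    (\<And>z. norm z \<le> \<delta> \<Longrightarrow> cmod (trace_op (\<eta> \<circ> weyl z) - 1) \<le> \<epsilon>) \<Longrightarrow>
    1 - 4 * \<epsilon> \<le> Re (trace_op (\<eta> \<circ> (\<lambda>f. \<Sum>ws | length ws \<le> n. rank1 (word_vec ws) (word_vec ws) f)))"
proof -
  obtain r where r: "0 < r" "r \<le> 1"
    and tail: "measure normal_product {\<omega>. \<delta> < norm (phase_point r \<omega> :: complex ^ 'd)} \<le> \<epsilon>"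
    by (rule phase_point_tail[OF \<delta> \<epsilon>])
  define S where "S = {\<omega>. \<delta> < norm (phase_point r \<omega> :: complex ^ 'd)}"
  define q where "q = (1 - r\<^sup>2) / (1 + r\<^sup>2)"
  define c where "c = (1 / (1 + r\<^sup>2)) ^ CARD('d)"
  have r2: "0 < r\<^sup>2" "r\<^sup>2 \<le> 1" using r by (auto simp: power_le_one)
  have "0 < 1 + r\<^sup>2" "1 - r\<^sup>2 < 1 + r\<^sup>2" using r2 by linarith+
  then have q: "0 \<le> q" "q < 1" using r2(2) by (simp_all only: q_def pos_divide_less_eq zero_le_divide_iff) auto
  have "1 / (1 + r\<^sup>2) \<le> 1" "0 \<le> 1 / (1 + r\<^sup>2)" using \<open>0 < 1 + r\<^sup>2\<close> r2(1) by (simp_all only: pos_divide_le_eq zero_le_divide_iff) auto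
  then have c: "0 \<le> c" "c \<le> 1" unfolding c_def by (auto intro!: power_le_one)
  \<comment> \<open>Here \<open>r > 0\<close> matters, as it keeps \<open>q\<close> below
    \<open>1\<close>; \<open>r \<le> 1\<close> has made \<open>q\<close> nonnegative.\<close>
  obtain n where n: "q ^ n < \<epsilon>" using real_arch_pow_inv[OF \<epsilon> q(2)] by blast
  have q': "\<bar>q\<bar> \<le> 1" "q \<le> 1" using q by auto
  define P where "P = (\<lambda>f :: 'd fock. \<Sum>ws | length ws \<le> n. rank1 (word_vec ws) (word_vec ws) f)"
  have P: "bounded_op P" unfolding P_def by (rule bounded_op_sum) simp
  show thesis
  proof (rule that[of n])
    fix \<eta> :: "'d fock \<Rightarrow> 'd fock"
    assume \<eta>: "density_op \<eta>" and near: "\<And>z. norm z \<le> \<delta> \<Longrightarrow> cmod (trace_op (\<eta> \<circ> weyl z) - 1) \<le> \<epsilon>"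
    define f where "f A = trace_op (\<eta> \<circ> A)" for A
    have f: "op_state f" unfolding f_def by (rule op_state_density[OF \<eta>])
    have w1: "cmod (f (weyl z)) \<le> 1" for z
      by (rule op_state_norm_le[OF f bounded_op_weyl]) (simp_all add: norm_weyl)
    have cont: "continuous_on UNIV (\<lambda>z. f (weyl z))" unfolding f_def by (rule continuous_weyl_expectation[OF \<eta>])
    have int: "integrable normal_product (\<lambda>\<omega>. f (weyl (phase_point r \<omega>)))"
      by (rule integrable_phase_point[OF cont w1])
    have S: "S \<in> sets normal_product" unfolding S_def by (rule phase_point_tail_measurable)
    have ind: "integrable normal_product (indicat_real S)"
      using S by (simp add: integrable_indicator_iff normal_product.emeasure_eq_measure)
    \<comment> \<open>Off \<open>S\<close> the hypothesis applies, on \<open>S\<close> the trivial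
      bound \<open>2\<close>. Integration costs \<open>\<epsilon> + 2 * \<epsilon>\<close>, and
      \<open>q ^ n\<close> later adds one more \<open>\<epsilon>\<close>.\<close>
    have pw: "cmod (f (weyl (phase_point r \<omega>)) - 1) \<le> \<epsilon> + 2 * indicat_real S \<omega>" for \<omega>
    proof (cases "\<omega> \<in> S")
      case True
      have "cmod (f (weyl (phase_point r \<omega>)) - 1) \<le> cmod (f (weyl (phase_point r \<omega>))) + cmod 1" by (rule norm_triangle_ineq4)
      then show ?thesis using w1[of "phase_point r \<omega>"] True \<epsilon> by simp
    next
      case False
      then show ?thesis using near by (simp add: S_def f_def)
    qed
    have "(CLINT \<omega>|normal_product. f (weyl (phase_point r \<omega>))) - 1 = (CLINT \<omega>|normal_product. f (weyl (phase_point r \<omega>)) - 1)"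
      using int by (simp add: normal_product.prob_space)
    also have "cmod \<dots> \<le> (LINT \<omega>|normal_product. cmod (f (weyl (phase_point r \<omega>)) - 1))" by (rule integral_norm_bound)
    also have "\<dots> \<le> (LINT \<omega>|normal_product. \<epsilon> + 2 * indicat_real S \<omega>)"
      by (rule integral_mono) (use int ind pw in auto)
    also have "\<dots> = \<epsilon> + 2 * measure normal_product S"
      using ind S by (simp add: normal_product.prob_space)
    also have "\<dots> \<le> 3 * \<epsilon>" using tail unfolding S_def by simp
    finally have "cmod ((CLINT \<omega>|normal_product. f (weyl (phase_point r \<omega>))) - 1) \<le> 3 * \<epsilon>" .
    then have "cmod (complex_of_real c * f (numpow q) - 1) \<le> 3 * \<epsilon>"
      unfolding f_def c_def q_def gaussian_average_density[OF \<eta> r(1)] .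
    then have "1 - 3 * \<epsilon> \<le> Re (complex_of_real c * f (numpow q))"
      using abs_Re_le_cmod[of "complex_of_real c * f (numpow q) - 1"] by simp
    also have "\<dots> = c * Re (f (numpow q))" by simp
    also have "\<dots> \<le> Re (f (numpow q))"
    proof -
      have "positive_op (numpow q :: 'd fock \<Rightarrow> 'd fock)"
        using has_sum_nonneg[OF numpow_form(1)[OF q(1) q'(2), where 'a = 'd]] numpow_form(2)[OF q(1) q'(2), where 'a = 'd] q
        by (simp add: positive_op_def bounded_op_numpow[OF q'(1)] nonneg_Reals_complex_iff)
      from op_state_positive[OF f this] show ?thesis
        using mult_right_mono[OF c(2), of "Re (f (numpow q))"] by (simp add: nonneg_Reals_complex_iff)
    qed
    also have "\<dots> \<le> Re (f (\<lambda>x. P x + complex_of_real (q ^ n) *\<^sub>C id x))"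
    proof (rule op_state_mono[OF f bounded_op_numpow[OF q'(1)]])
      show "bounded_op (\<lambda>x. P x + complex_of_real (q ^ n) *\<^sub>C id x)"
        by (intro bounded_op_add bounded_op_scaleC P bounded_op_id)
      show "positive_op (\<lambda>x. (P x + complex_of_real (q ^ n) *\<^sub>C id x) - numpow q x)"
        unfolding P_def id_apply by (rule numpow_le_word_projection[OF q(1) q'(2)])
    qed
    also have "\<dots> = Re (f P) + q ^ n"
      unfolding op_state_simps(1)[OF f P bounded_op_scaleC[OF bounded_op_id]] op_state_simps(3)[OF f bounded_op_id bounded_op_id]
      by (simp add: op_state_id[OF f])
    finally have "1 - 4 * \<epsilon> \<le> Re (f P)" using n by simp
    then show "1 - 4 * \<epsilon> \<le> Re (trace_op (\<eta> \<circ> (\<lambda>f. \<Sum>ws | length ws \<le> n. rank1 (word_vec ws) (word_vec ws) f)))"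
      unfolding f_def P_def .
  qed
qed

section \<open>Gaussian semigroups\<close>

lemma sum_UNIV_Plus: "(\<Sum>k\<in>(UNIV :: ('a::finite + 'b::finite) set). h k) = (\<Sum>i\<in>UNIV. h (Inl i)) + (\<Sum>j\<in>UNIV. h (Inr j))"
  unfolding UNIV_Plus_UNIV[symmetric] by (simp add: sum.Plus del: UNIV_Plus_UNIV)

lemma of_real_vec_to_real: "of_real_vec (to_real z) = z"
  by (simp add: of_real_vec_def to_real_def vec_eq_iff)

lemma inner_to_real: "to_real z \<bullet> to_real w = z \<bullet> w"
  by (simp add: inner_vec_def sum_UNIV_Plus to_real_def inner_complex_def sum.distrib)

lemma real_mat_mult_to_real:
  assumes "linear A" shows "real_mat A *v to_real z = to_real (A z)"
proof -
  have "linear (to_real :: complex ^ 'd \<Rightarrow> real ^ ('d + 'd))"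
    by (rule linearI) (auto simp: to_real_def vec_eq_iff split: sum.split)
  moreover have "linear (of_real_vec :: real ^ ('d + 'd) \<Rightarrow> complex ^ 'd)"
    by (rule linearI) (auto simp: of_real_vec_def vec_eq_iff complex_eq_iff)
  ultimately have "linear (to_real \<circ> A \<circ> of_real_vec)" using assms by (intro linear_compose)
  from matrix_works[OF this[unfolded linear_def, folded scalar_mult_eq_scaleR[abs_def]], of "to_real z"] show ?thesis
    unfolding real_mat_def by (simp add: of_real_vec_to_real)
qed

text \<open>On real vectors the term with factor \<open>\<i>\<close> contributes nothing to the real
  part.\<close>

lemma psd_mat_real_part:
  assumes "psd_mat (\<chi> k l. complex_of_real (A $ k $ l) + \<i> * complex_of_real (B $ k $ l))"
  shows "0 \<le> x \<bullet> (A *v x)"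
proof -
  have "0 \<le> Re (\<Sum>k\<in>UNIV. cnj (complex_of_real (x $ k)) *
      (\<Sum>l\<in>UNIV. (complex_of_real (A $ k $ l) + \<i> * complex_of_real (B $ k $ l)) * complex_of_real (x $ l)))"
    using assms[unfolded psd_mat_def, rule_format, of "\<chi> k. complex_of_real (x $ k)"]
    by (simp only: nonneg_Reals_complex_iff matrix_vector_mult_def vec_lambda_beta)
  also have "\<dots> = x \<bullet> (A *v x)"
    by (simp add: inner_vec_def matrix_vector_mult_def)
  finally show ?thesis .
qed

lemma gaussian_params_nonneg:
  assumes "gaussian_params Z C" shows "0 \<le> z \<bullet> C z"
proof -
  have "0 \<le> to_real z \<bullet> (real_mat C *v to_real z)"
    by (rule psd_mat_real_part[where B = "transpose (real_mat Z) ** J_mat + J_mat ** real_mat Z"])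
      (use assms in \<open>simp add: gaussian_params_def\<close>)
  then show ?thesis using assms by (simp add: real_mat_mult_to_real inner_to_real gaussian_params_def)
qed

text \<open>Homogeneity later carries a bound on the flow from one ball to all vectors. The scalar
  may be pulled out because the series is dominated by an exponential series.\<close>

lemma flow_scaleR:
  assumes Z: "linear Z" shows "flow Z t (a *\<^sub>R z) = a *\<^sub>R flow Z t z"
proof -
  obtain K where K: "0 < K" "\<And>x. norm (Z x) \<le> K * norm x" using linear_bounded_pos[OF Z] by blast
  have bd: "norm ((Z ^^ n) z) \<le> K ^ n * norm z" for n
  proof (induction n)
    case (Suc n)
    have "norm ((Z ^^ Suc n) z) \<le> K * norm ((Z ^^ n) z)" using K(2) by simp
    also have "\<dots> \<le> K * (K ^ n * norm z)" using Suc K(1) by simp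
    finally show ?case by (simp add: mult_ac)
  qed simp
  have "summable (\<lambda>n. (\<bar>t\<bar> * K) ^ n /\<^sub>R fact n * norm z)" by (intro summable_mult2 summable_exp_generic)
  then have sum: "summable (\<lambda>n. (t ^ n / fact n) *\<^sub>R (Z ^^ n) z)"
  proof (rule summable_comparison_test'[where N = 0])
    fix n
    have "norm ((t ^ n / fact n) *\<^sub>R (Z ^^ n) z) = \<bar>t\<bar> ^ n / fact n * norm ((Z ^^ n) z)" by (simp add: power_abs)
    also have "\<dots> \<le> \<bar>t\<bar> ^ n / fact n * (K ^ n * norm z)" by (intro mult_left_mono bd) simp
    finally show "norm ((t ^ n / fact n) *\<^sub>R (Z ^^ n) z) \<le> (\<bar>t\<bar> * K) ^ n /\<^sub>R fact n * norm z"
      by (simp add: power_mult_distrib divide_inverse mult_ac)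
  qed
  have "(Z ^^ n) (a *\<^sub>R z) = a *\<^sub>R (Z ^^ n) z" for n
    by (induction n) (simp_all add: linear_scale[OF Z])
  then have "flow Z t (a *\<^sub>R z) = (\<Sum>n. a *\<^sub>R ((t ^ n / fact n) *\<^sub>R (Z ^^ n) z))"
    unfolding flow_def by (simp add: mult.commute)
  then show ?thesis unfolding flow_def suminf_scaleR_right[OF sum] .
qed

lemma weyl_0: "weyl 0 = (id :: 'd::finite fock \<Rightarrow> 'd fock)"
  by (rule bounded_op_expvec_eqI) (simp_all add: bounded_op_weyl bounded_op_id weyl_spec(2) weyl_phase_def cdot_def scaleC_one)

lemma weyl_expectation_near_0:
  fixes \<eta> :: "'d::finite fock \<Rightarrow> 'd fock"
  assumes \<eta>: "density_op \<eta>" and \<epsilon>: "0 < \<epsilon>"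
  obtains \<delta> where "0 < \<delta>" "\<And>z. norm z \<le> \<delta> \<Longrightarrow> cmod (trace_op (\<eta> \<circ> weyl z) - 1) \<le> \<epsilon>"
proof -
  have at0: "trace_op (\<eta> \<circ> weyl 0) = 1" using \<eta> by (simp add: weyl_0 density_op_def)
  from continuous_weyl_expectation[OF \<eta>, unfolded continuous_on_iff, rule_format, of 0, OF UNIV_I \<epsilon>]
  obtain d where d: "d > 0" "\<And>z. dist z 0 < d \<Longrightarrow> dist (trace_op (\<eta> \<circ> weyl z)) 1 < \<epsilon>" unfolding at0 by auto
  show thesis
    by (rule that[of "d / 2"]) (use d in \<open>auto simp: dist_norm intro!: less_imp_le\<close>)
qed

lemma gaussian_orbit_equicontinuous:
  fixes T :: "real \<Rightarrow> ('d::finite fock \<Rightarrow> 'd fock) \<Rightarrow> ('d fock \<Rightarrow> 'd fock)"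
  assumes T: "gaussian_qms T Z C \<zeta>" and \<rho>: "invariant_state T \<rho>" and v: "norm v = 1" and \<epsilon>: "0 < \<epsilon>"
  obtains \<delta> where "0 < \<delta>" "\<And>t z. 0 \<le> t \<Longrightarrow> norm z \<le> \<delta> \<Longrightarrow> cmod (cinner v (T t (weyl z) v) - 1) \<le> \<epsilon>"
proof -
  have q: "qms T" and par: "gaussian_params Z C" and Z: "linear Z"
    using T by (auto simp: gaussian_qms_def gaussian_params_def)
  define \<mu> where "\<mu> z = trace_op (\<rho> \<circ> weyl z)" for z
  define c where "c t z = exp (complex_of_real (- (integral {0..t} (\<lambda>s. flow Z s z \<bullet> C (flow Z s z))) / 2)
      + \<i> * complex_of_real (integral {0..t} (\<lambda>s. \<zeta> \<bullet> flow Z s z)))" for t z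
  have \<rho>': "density_op \<rho>" using \<rho> by (simp add: invariant_state_def)
  have Tw: "T t (weyl z) = (\<lambda>f. c t z *\<^sub>C weyl (flow Z t z) f)" if "0 \<le> t" for t z
    using T that unfolding gaussian_qms_def c_def by blast
  \<comment> \<open>If the integrand is not integrable, the integral is \<open>0\<close> by
    convention, so nonnegativity holds in either case.\<close>
  have "0 \<le> integral {0..t} (\<lambda>s. flow Z s z \<bullet> C (flow Z s z))" for t z
    by (cases "(\<lambda>s. flow Z s z \<bullet> C (flow Z s z)) integrable_on {0..t}")
      (auto intro!: Henstock_Kurzweil_Integration.integral_nonneg gaussian_params_nonneg[OF par] simp: not_integrable_integral)
  then have c1: "cmod (c t z) \<le> 1" for t z by (simp add: c_def norm_exp_eq_Re)
  have \<mu>c: "\<mu> z = c t z * \<mu> (flow Z t z)" if "0 \<le> t" for t z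
    using invariant_state_trace[OF q \<rho> that bounded_op_weyl[of z]]
      op_state_simps(3)[OF op_state_density[OF \<rho>'] bounded_op_weyl bounded_op_weyl]
    unfolding Tw[OF that] \<mu>_def by simp
  \<comment> \<open>The threshold \<open>1 / 2\<close> separates: the modulus of
    \<open>\<mu>\<close> is at least \<open>1 / 2\<close> on this ball and smaller beyond radius
    \<open>b\<close>.\<close>
  obtain \<delta>0 where \<delta>0: "0 < \<delta>0" "\<And>z. norm z \<le> \<delta>0 \<Longrightarrow> cmod (\<mu> z - 1) \<le> 1 / 2"
    unfolding \<mu>_def by (rule weyl_expectation_near_0[OF \<rho>', of "1 / 2"]) auto
  have "eventually (\<lambda>z. dist (\<mu> z) 0 < 1 / 2) at_infinity"
    unfolding \<mu>_def by (rule tendstoD[OF weyl_expectation_tendsto_0[OF \<rho>']]) simp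
  then obtain b where b: "\<And>z. b \<le> norm z \<Longrightarrow> cmod (\<mu> z) < 1 / 2" unfolding eventually_at_infinity by auto
  define L where "L = \<bar>b\<bar> / \<delta>0"
  have L: "0 \<le> L" using \<delta>0(1) by (simp add: L_def)
  have ball: "norm (flow Z t z) \<le> \<bar>b\<bar>" if t: "0 \<le> t" and z: "norm z \<le> \<delta>0" for t z
  proof (rule ccontr)
    assume "\<not> norm (flow Z t z) \<le> \<bar>b\<bar>"
    then have "cmod (\<mu> (flow Z t z)) < 1 / 2" by (intro b) simp
    moreover have "cmod (\<mu> z) \<le> 1 * cmod (\<mu> (flow Z t z))"
      unfolding \<mu>c[OF t, of z] norm_mult by (intro mult_right_mono c1) simp
    ultimately have "cmod (\<mu> z) < 1 / 2" by simp
    moreover have "1 - cmod (\<mu> z) \<le> cmod (\<mu> z - 1)" using norm_triangle_ineq2[of 1 "\<mu> z"] by (simp add: norm_minus_commute)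
    ultimately show False using \<delta>0(2)[OF z] by simp
  qed
  have flow_le: "norm (flow Z t z) \<le> L * norm z" if t: "0 \<le> t" for t z
  proof (cases "z = 0")
    case True
    then show ?thesis using flow_scaleR[OF Z, of t 0 z] by simp
  next
    case False
    define a where "a = \<delta>0 / norm z"
    have a: "0 < a" using False \<delta>0(1) by (simp add: a_def)
    have "norm (a *\<^sub>R z) \<le> \<delta>0" using False \<delta>0(1) by (simp add: a_def)
    from ball[OF t this] have "a * norm (flow Z t z) \<le> \<bar>b\<bar>" using a by (simp add: flow_scaleR[OF Z])
    then have "norm (flow Z t z) \<le> \<bar>b\<bar> / a" using a by (simp add: pos_le_divide_eq mult.commute)
    then show ?thesis by (simp add: a_def L_def)
  qed
  \<comment> \<open>The cap \<open>1 / 2\<close> keeps \<open>\<mu>\<close> at the flowed point away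
    from \<open>0\<close>, so dividing by it costs a factor \<open>2\<close>. Then
    \<open>c t z\<close> is within \<open>4 * e\<close> of \<open>1\<close>, and with the vector
    state the total is \<open>5 * e\<close>.\<close>
  define e where "e = min (1 / 2) (\<epsilon> / 8)"
  have e: "0 < e" "e \<le> 1 / 2" "8 * e \<le> \<epsilon>" using \<epsilon> by (auto simp: e_def)
  obtain \<delta>1 where \<delta>1: "0 < \<delta>1" "\<And>z. norm z \<le> \<delta>1 \<Longrightarrow> cmod (\<mu> z - 1) \<le> e"
    unfolding \<mu>_def by (rule weyl_expectation_near_0[OF \<rho>' e(1)]) blast
  obtain \<delta>2 where \<delta>2: "0 < \<delta>2" "\<And>z. norm z \<le> \<delta>2 \<Longrightarrow> cmod (trace_op (rank1 v v \<circ> weyl z) - 1) \<le> e"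
    by (rule weyl_expectation_near_0[OF density_op_rank1[OF v] e(1)]) blast
  define m where "m = min \<delta>1 \<delta>2"
  have m: "0 < m" using \<delta>1 \<delta>2 by (simp add: m_def)
  \<comment> \<open>The radius \<open>m / (L + 1)\<close> keeps both \<open>z\<close> and its image
    under the flow in the ball of radius \<open>m\<close>, at all times.\<close>
  show thesis
  proof (rule that[of "m / (L + 1)"])
    show "0 < m / (L + 1)" using m L by simp
    fix t :: real and z :: "complex ^ 'd" assume t: "0 \<le> t" and z: "norm z \<le> m / (L + 1)"
    have "(L + 1) * norm z \<le> m" using z L by (simp add: pos_le_divide_eq mult.commute)
    moreover have "norm z \<le> (L + 1) * norm z" "L * norm z \<le> (L + 1) * norm z"
      using mult_right_mono[OF _ norm_ge_zero, of 1 "L + 1" z] mult_right_mono[OF _ norm_ge_zero, of L "L + 1" z] L by auto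
    ultimately have nz: "norm z \<le> m" and nf: "norm (flow Z t z) \<le> m" using flow_le[OF t, of z] by linarith+
    define \<psi> where "\<psi> = cinner v (weyl (flow Z t z) v)"
    have \<psi>: "cmod (\<psi> - 1) \<le> e"
      using \<delta>2(2)[of "flow Z t z"] nf by (simp add: m_def \<psi>_def trace_op_rank1'[OF bounded_op_weyl])
    have x: "cmod (\<mu> z - 1) \<le> e" "cmod (\<mu> (flow Z t z) - 1) \<le> e"
      using \<delta>1(2) nz nf by (simp_all add: m_def)
    have "1 - cmod (\<mu> (flow Z t z)) \<le> cmod (\<mu> (flow Z t z) - 1)"
      using norm_triangle_ineq2[of 1 "\<mu> (flow Z t z)"] by (simp add: norm_minus_commute)
    then have half: "1 / 2 \<le> cmod (\<mu> (flow Z t z))" using x(2) e(2) by linarith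
    have "cmod (c t z - 1) * (1 / 2) \<le> cmod (c t z - 1) * cmod (\<mu> (flow Z t z))"
      by (intro mult_left_mono half) simp
    also have "\<dots> = cmod ((\<mu> z - 1) - (\<mu> (flow Z t z) - 1))"
      unfolding norm_mult[symmetric] \<mu>c[OF t, of z] by (simp add: algebra_simps)
    also have "\<dots> \<le> e + e" by (rule order_trans[OF norm_triangle_ineq4 add_mono[OF x]])
    finally have cc: "cmod (c t z - 1) \<le> 4 * e" by simp
    have "cinner v (T t (weyl z) v) - 1 = c t z * (\<psi> - 1) + (c t z - 1)"
      unfolding Tw[OF t] \<psi>_def by (simp add: cinner_simps algebra_simps)
    also have "cmod \<dots> \<le> cmod (c t z) * cmod (\<psi> - 1) + cmod (c t z - 1)"
      unfolding norm_mult[symmetric] by (rule norm_triangle_ineq)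
    also have "\<dots> \<le> 1 * e + 4 * e" using e by (intro add_mono mult_mono c1 \<psi> cc) auto
    also have "\<dots> \<le> \<epsilon>" using e by linarith
    finally show "cmod (cinner v (T t (weyl z) v) - 1) \<le> \<epsilon>" .
  qed
qed

lemma gaussian_tight_orbit:
  fixes T :: "real \<Rightarrow> ('d::finite fock \<Rightarrow> 'd fock) \<Rightarrow> ('d fock \<Rightarrow> 'd fock)"
  assumes T: "gaussian_qms T Z C \<zeta>" and \<rho>: "invariant_state T \<rho>" and v: "norm v = 1"
  shows "tight_orbit T TYPE('d list) v"
  unfolding tight_orbit_def
proof (intro allI impI)
  fix \<epsilon> :: real assume "0 < \<epsilon>"
  \<comment> \<open>Compensates the factor \<open>4\<close> lost in
    \<open>density_tight\<close>.\<close>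
  then have \<epsilon>: "0 < \<epsilon> / 4" by simp
  obtain \<delta> where \<delta>: "0 < \<delta>" "\<And>t z. 0 \<le> t \<Longrightarrow> norm z \<le> \<delta> \<Longrightarrow> cmod (cinner v (T t (weyl z) v) - 1) \<le> \<epsilon> / 4"
    by (rule gaussian_orbit_equicontinuous[OF T \<rho> v \<epsilon>]) blast
  obtain n where n: "\<And>\<eta> :: 'd fock \<Rightarrow> 'd fock. density_op \<eta> \<Longrightarrow>
    (\<And>z. norm z \<le> \<delta> \<Longrightarrow> cmod (trace_op (\<eta> \<circ> weyl z) - 1) \<le> \<epsilon> / 4) \<Longrightarrow>
    1 - 4 * (\<epsilon> / 4) \<le> Re (trace_op (\<eta> \<circ> (\<lambda>f. \<Sum>ws | length ws \<le> n. rank1 (word_vec ws) (word_vec ws) f)))"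
    by (rule density_tight[OF \<delta>(1) \<epsilon>]) blast
  have q: "qms T" using T by (simp add: gaussian_qms_def)
  have tr: "trace_op (predual (T t) (rank1 v v) \<circ> A) = cinner v (T t A v)" if "0 \<le> t" "bounded_op A" for t A
    using qms_predual(2)[OF q that(1) density_op_rank1[OF v] that(2)] trace_op_rank1'[OF qms_bounded[OF q that]] by simp
  have "1 - \<epsilon> \<le> Re (cinner v (T t (\<lambda>f. \<Sum>ws | length ws \<le> n. rank1 (word_vec ws) (word_vec ws) f) v))" if t: "0 \<le> t" for t
  proof -
    have "bounded_op (\<lambda>f :: 'd fock. \<Sum>ws | length ws \<le> n. rank1 (word_vec ws) (word_vec ws) f)"
      by (rule bounded_op_sum) simp
    note P = tr[OF t this]
    have "1 - 4 * (\<epsilon> / 4) \<le> Re (trace_op (predual (T t) (rank1 v v) \<circ> (\<lambda>f. \<Sum>ws | length ws \<le> n. rank1 (word_vec ws) (word_vec ws) f)))"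
    proof (rule n[OF qms_predual(1)[OF q t density_op_rank1[OF v]]])
      show "cmod (trace_op (predual (T t) (rank1 v v) \<circ> weyl z) - 1) \<le> \<epsilon> / 4" if "norm z \<le> \<delta>" for z
        unfolding tr[OF t bounded_op_weyl] by (rule \<delta>(2)[OF t that])
    qed
    then show ?thesis unfolding P by simp
  qed
  then show "\<exists>(I :: 'd list set) s. finite I \<and> positive_op (\<lambda>x. x - (\<Sum>i\<in>I. rank1 (s i) (s i) x)) \<and>
      (\<forall>t\<ge>0. 1 - \<epsilon> \<le> Re (cinner v (T t (\<lambda>x. \<Sum>i\<in>I. rank1 (s i) (s i) x) v)))"
    by (intro exI[of _ "{ws. length ws \<le> n}"] exI[of _ word_vec] conjI allI impI finite_words_length_le word_projection_le_id)
qed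

text \<open>Conjugation by \<open>U\<close> carries an invariant density of \<open>T\<close> to one
  of \<open>T'\<close>. The trace of the conjugate is evaluated by moving \<open>U\<close> onto the
  basis.\<close>

lemma symp_conj_invariant_state:
  fixes T T' :: "real \<Rightarrow> ('d::finite fock \<Rightarrow> 'd fock) \<Rightarrow> ('d fock \<Rightarrow> 'd fock)"
  assumes q: "qms T" and q': "qms T'" and conj: "symp_conj T T'" and \<rho>: "invariant_state T \<rho>"
  shows "\<exists>\<rho>'. invariant_state T' \<rho>'"
proof -
  obtain U where U: "unitary_op U"
    and T': "\<And>t A. 0 \<le> t \<Longrightarrow> bounded_op A \<Longrightarrow> T' t A = U \<circ> T t (adj U \<circ> A \<circ> U) \<circ> adj U"
    using conj unfolding symp_conj_def by blast
  define V where "V = adj U"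
  have b: "bounded_op U" "bounded_op V" and UV: "U (V x) = x" "V (U x) = x" for x
    using U by (auto simp: unitary_op_def V_def bounded_op_adj fun_eq_iff)
  have VU: "cinner (V x) y = cinner x (U y)" for x y using cinner_adj_left[OF b(1)] by (simp add: V_def)
  have \<rho>': "density_op \<rho>" using \<rho> by (simp add: invariant_state_def)
  \<comment> \<open>The image of the chosen basis under the inverse of \<open>U\<close>; basis
    independence of the trace against \<open>\<rho>\<close> then replaces cyclicity.\<close>
  define E where "E = V ` (onb0 :: 'd fock set)"
  have E: "is_onb E"
    unfolding is_onb_def
  proof (intro conjI ballI allI impI)
    have ob: "\<And>e f. e \<in> onb0 \<Longrightarrow> f \<in> (onb0 :: 'd fock set) \<Longrightarrow> cinner e f = (if e = f then 1 else 0)"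
      using is_onb_onb0 unfolding is_onb_def by blast
    show "cinner e f = (if e = f then 1 else 0)" if ef: "e \<in> E" "f \<in> E" for e f
    proof -
      obtain e' f' where e': "e = V e'" "e' \<in> onb0" "f = V f'" "f' \<in> onb0" using ef unfolding E_def by blast
      have "V e' = V f' \<longleftrightarrow> e' = f'" using UV(1) by metis
      then show ?thesis using ob[OF e'(2,4)] by (simp add: e' VU UV)
    qed
    show "x = 0" if x: "\<forall>e\<in>E. cinner e x = 0" for x
    proof -
      have "U x = 0" by (rule onb_total[OF is_onb_onb0]) (use x in \<open>simp add: E_def VU\<close>)
      then show ?thesis using UV(2)[of x] bounded_op_simps(4)[OF b(2)] by simp
    qed
  qed
  have inj: "inj_on V onb0" using UV(1) by (metis inj_onI)
  have hs: "((\<lambda>e. cinner e ((U \<circ> \<rho> \<circ> V) (A e))) has_sum trace_op (\<rho> \<circ> (V \<circ> A \<circ> U))) onb0" if A: "bounded_op A" for A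
  proof -
    have bA: "bounded_op (V \<circ> A \<circ> U)" by (intro bounded_op_comp A b)
    obtain Q where "\<And>E B. is_onb E \<Longrightarrow> bounded_op B \<Longrightarrow> ((\<lambda>e. cinner e (\<rho> (B e))) has_sum trace_op (\<rho> \<circ> B)) E"
      by (rule density_opE[OF \<rho>']) blast
    from this[OF E bA] have "((\<lambda>e. cinner (V e) (\<rho> ((V \<circ> A \<circ> U) (V e)))) has_sum trace_op (\<rho> \<circ> (V \<circ> A \<circ> U))) onb0"
      unfolding E_def has_sum_reindex[OF inj] by (simp add: comp_def)
    then show ?thesis by (simp add: VU UV)
  qed
  have tr: "trace_op ((U \<circ> \<rho> \<circ> V) \<circ> A) = trace_op (\<rho> \<circ> (V \<circ> A \<circ> U))" if "bounded_op A" for A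
    unfolding trace_op_onb0[of "(U \<circ> \<rho> \<circ> V) \<circ> A"] using infsumI[OF hs[OF that]] by (simp add: comp_def)
  have "density_op (U \<circ> \<rho> \<circ> V)"
  proof (rule density_opI[OF _ is_onb_onb0])
    show "positive_op (U \<circ> \<rho> \<circ> V)"
      using density_op_positive[OF \<rho>'] by (auto simp: positive_op_def VU[symmetric] intro!: bounded_op_comp b)
    have "V \<circ> id \<circ> U = id" using UV(2) by (simp add: fun_eq_iff)
    then show "((\<lambda>e. cinner e ((U \<circ> \<rho> \<circ> V) e)) has_sum 1) onb0"
      using hs[OF bounded_op_id] \<rho>' by (simp add: density_op_def)
  qed
  then have "invariant_state T' (U \<circ> \<rho> \<circ> V)"
  proof (rule invariant_stateI[OF q'])
    fix t :: real and A :: "'d fock \<Rightarrow> 'd fock" assume t: "0 \<le> t" and A: "bounded_op A"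
    have bA: "bounded_op (V \<circ> A \<circ> U)" by (intro bounded_op_comp A b)
    have "V \<circ> T' t A \<circ> U = T t (V \<circ> A \<circ> U)"
      unfolding T'[OF t A] V_def[symmetric] using UV(2) by (simp add: fun_eq_iff)
    then show "trace_op (U \<circ> \<rho> \<circ> V \<circ> T' t A) = trace_op (U \<circ> \<rho> \<circ> V \<circ> A)"
      unfolding tr[OF qms_bounded[OF q' t A]] tr[OF A] by (simp add: invariant_state_trace[OF q \<rho> t bA])
  qed
  then show ?thesis by blast
qed

theorem corollary21:
  fixes T T' :: "real \<Rightarrow> ('d::{finite, linorder} fock \<Rightarrow> 'd fock) \<Rightarrow> ('d fock \<Rightarrow> 'd fock)"
    and Z C Z' C' :: "complex ^ 'd::{finite, linorder} \<Rightarrow> complex ^ 'd::{finite, linorder}"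
    and \<zeta> \<zeta>' :: "complex ^ 'd::{finite, linorder}"
  assumes "gaussian_qms T Z C \<zeta>"
    and "\<exists>\<rho>. invariant_state T \<rho>"
    and "symp_conj T T'"
    and "gaussian_qms T' Z' C' \<zeta>'"
    and "normal_form Z' C' \<zeta>'"
  shows "orth (positive_recurrent T') = transient T'"
proof -
  have q: "qms T" "qms T'" using assms(1,4) by (simp_all add: gaussian_qms_def)
  obtain \<rho> where "invariant_state T' \<rho>"
    using assms(2) symp_conj_invariant_state[OF q assms(3)] by blast
  then show ?thesis
    by (rule orth_recurrent_eq_transient[OF q(2) gaussian_tight_orbit[OF assms(4)]])
qed

end
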